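(* Let $S,S^*$ be countable sets, $\Lambda$ a transition kernel from $S^*$ to $S$, $\mathcal L$ a nonexplosive generator on $S$ and $\mathcal L^*$ a (possibly explosive) generator on $S^*$, and $\mu_0,\mu_0^*$ probability measures on $S,S^*$ respectively. Assume that $\sum_{x\in S}\Lambda(x^*,x)\mathcal L_x<\infty$ for every $x^*\in S^*$. Let $(X_t)_{t\ge0}$ be a Markov process with generator $\mathcal L$ and initial distribution $\mu_0$. If $$\mu_0^*\Lambda=\mu_0\qquad\text{and}\qquad \mathcal L^*\Lambda=\Lambda\mathcal L ,$$ then there exists, on the same probability space as $X$, a minimal process $(X^*_t)_{t\ge 0}$ on $S^*$ with generator $\mathcal L^*$ and initial distribution $\mu_0^*$ such that, denoting by $T$ its explosion time, for all $t\ge 0$: $$\mathscr L(X_t\mid \mathcal F^{X^*}_t,\ T>t)=\Lambda(X^*_t,\cdot),$$ $$\mathscr L(X^*_t\mid X,\ T>t)=\mathscr L(X^*_t\mid \mathcal F^{X}_t,\ T>t).$$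
   Context: A transition kernel from $S^*$ to $S$ is a matrix with $\Lambda(x^*,x)\ge 0$ and $\sum_{x\in S}\Lambda(x^*,x)=1$ for every $x^*\in S^*$; $\Lambda[f](x^* )=\sum_x\Lambda(x^*,x)f(x)$. Products such as $\mathcal L^*\Lambda$, $\Lambda\mathcal L$, $\mu_0^*\Lambda$ are matrix products (absolutely convergent here). A generator on a countable set $S$ is a matrix $(\mathcal L_{x,y})_{x,y\in S}$ with $0\le \mathcal L_{x,y}<\infty$ for $x\neq y$ and $\sum_{y\ne x}\mathcal L_{x,y}=-\mathcal L_{x,x}=:\mathcal L_x<\infty$. A minimal process with generator $\mathcal L$ is the jump process which stays at $x$ for an exponential time of parameter $\mathcal L_x$ and then jumps to $y\neq x$ with probability $\mathcal L_{x,y}/\mathcal L_x$, up to its explosion time $T$ (the limit of its jump times), and which is set equal to a cemetery point $\Delta\notin S$ from time $T$ on. $\mathcal L$ is nonexplosive if $T=\infty$ almost surely for every initial law. $\mathcal F^{Z}_t$ is the $\sigma$-algebra generated by $(Z_s)_{0\le s\le t}$. The first identity means $\mathbb E[H\mathbf 1_{T>t}f(X_t)]=\mathbb E[H\mathbf 1_{T>t}\Lambda[f](X^*_t)]$ for all bounded $f:S\to\mathbb R$ and all bounded $\mathcal F^{X^*}_t$-measurable $H$. The second means that, under $\mathbb P(\cdot\mid T>t)$, the conditional law of $X^*_t$ given the whole trajectory of $X$ equals its conditional law given $\mathcal F^X_t$. The probability space is assumed large enough (it may be enlarged by random variables independent of $X$). *)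

theory Defs
  imports "HOL-Probability.Probability"
begin

text \<open>
  Countable state spaces are types of class \<open>countable\<close>, and matrices are real-valued functions of
  two states. A process that may explode takes values in an \<open>option\<close> type, where \<open>None\<close> is the
  cemetery point. Only the times \<open>t \<ge> 0\<close> of a process indexed by \<open>real\<close> are relevant.
\<close>

definition transition_kernel :: "('t \<Rightarrow> 's \<Rightarrow> real) \<Rightarrow> bool" where
  "transition_kernel \<Lambda> \<longleftrightarrow> (\<forall>y. (\<forall>x. 0 \<le> \<Lambda> y x) \<and> (\<Lambda> y has_sum 1) UNIV)"

definition kernel_apply :: "('t \<Rightarrow> 's \<Rightarrow> real) \<Rightarrow> ('s \<Rightarrow> real) \<Rightarrow> 't \<Rightarrow> real" where
  "kernel_apply \<Lambda> f y = (\<Sum>\<^sub>\<infinity>x. \<Lambda> y x * f x)"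

definition mat_prod :: "('a \<Rightarrow> 'b \<Rightarrow> real) \<Rightarrow> ('b \<Rightarrow> 'c \<Rightarrow> real) \<Rightarrow> 'a \<Rightarrow> 'c \<Rightarrow> real" where
  "mat_prod A B x z = (\<Sum>\<^sub>\<infinity>y. A x y * B y z)"

definition vec_mat_prod :: "('b \<Rightarrow> real) \<Rightarrow> ('b \<Rightarrow> 'c \<Rightarrow> real) \<Rightarrow> 'c \<Rightarrow> real" where
  "vec_mat_prod v B z = (\<Sum>\<^sub>\<infinity>y. v y * B y z)"

definition jump_rate :: "('s \<Rightarrow> 's \<Rightarrow> real) \<Rightarrow> 's \<Rightarrow> real" where
  "jump_rate L x = - L x x"

definition generator :: "('s \<Rightarrow> 's \<Rightarrow> real) \<Rightarrow> bool" where
  "generator L \<longleftrightarrow>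
     (\<forall>x y. x \<noteq> y \<longrightarrow> 0 \<le> L x y) \<and> (\<forall>x. (L x has_sum jump_rate L x) (- {x}))"

text \<open>
  From a state of rate 0 the process never jumps; the embedded chain is then constant by convention
  (and the holding time is infinite, see below).
\<close>

definition jump_prob :: "('s \<Rightarrow> 's \<Rightarrow> real) \<Rightarrow> 's \<Rightarrow> 's \<Rightarrow> real" where
  "jump_prob L x y =
     (if jump_rate L x = 0 then (if x = y then 1 else 0)
      else if x = y then 0 else L x y / jump_rate L x)"

text \<open>
  \<open>Y\<close> is the sequence of states visited and \<open>W\<close> the sequence of holding times: \<open>Y\<close> is a Markov
  chain with transition matrix \<open>jump_prob L\<close> and initial law \<open>\<mu>\<close>, and given \<open>Y\<close> the \<open>W n\<close> are
  independent, exponential with parameter \<open>jump_rate L (Y n)\<close>. If this parameter is 0, the formula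
  says that \<open>W n = \<infinity>\<close> almost surely.
\<close>

definition jump_hold :: "'w measure \<Rightarrow> ('s \<Rightarrow> 's \<Rightarrow> real) \<Rightarrow> 's pmf \<Rightarrow>
    (nat \<Rightarrow> 'w \<Rightarrow> 's) \<Rightarrow> (nat \<Rightarrow> 'w \<Rightarrow> ennreal) \<Rightarrow> bool" where
  "jump_hold M L \<mu> Y W \<longleftrightarrow>
     (\<forall>n. Y n \<in> measurable M (count_space UNIV)) \<and>
     (\<forall>n. W n \<in> borel_measurable M) \<and>
     (\<forall>n (y :: nat \<Rightarrow> 's) (t :: nat \<Rightarrow> real). (\<forall>k\<le>n. 0 \<le> t k) \<longrightarrow>
        measure M {\<omega> \<in> space M. \<forall>k\<le>n. Y k \<omega> = y k \<and> W k \<omega> > ennreal (t k)} =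
        pmf \<mu> (y 0) * (\<Prod>k<n. jump_prob L (y k) (y (Suc k))) *
        (\<Prod>k\<le>n. exp (- (jump_rate L (y k) * t k))))"

definition jump_time :: "(nat \<Rightarrow> 'w \<Rightarrow> ennreal) \<Rightarrow> nat \<Rightarrow> 'w \<Rightarrow> ennreal" where
  "jump_time W n \<omega> = (\<Sum>k<n. W k \<omega>)"

definition explosion_time :: "(nat \<Rightarrow> 'w \<Rightarrow> ennreal) \<Rightarrow> 'w \<Rightarrow> ennreal" where
  "explosion_time W \<omega> = (SUP n. jump_time W n \<omega>)"

text \<open>The value is \<open>Y n\<close> on the interval from \<open>jump_time W n\<close> (included) to \<open>jump_time W (Suc n)\<close>
  (excluded).\<close>

definition jump_path :: "(nat \<Rightarrow> 'w \<Rightarrow> 's) \<Rightarrow> (nat \<Rightarrow> 'w \<Rightarrow> ennreal) \<Rightarrow> real \<Rightarrow> 'w \<Rightarrow> 's option" where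
  "jump_path Y W t \<omega> =
     (if ennreal t < explosion_time W \<omega>
      then Some (Y (LEAST n. ennreal t < jump_time W (Suc n) \<omega>) \<omega>) else None)"

text \<open>\<open>Z\<close> is, up to indistinguishability, a minimal process with generator \<open>L\<close>, initial law \<open>\<mu>\<close> and
  explosion time \<open>T\<close>.\<close>

definition minimal_process :: "'w measure \<Rightarrow> ('s \<Rightarrow> 's \<Rightarrow> real) \<Rightarrow> 's pmf \<Rightarrow>
    (real \<Rightarrow> 'w \<Rightarrow> 's option) \<Rightarrow> ('w \<Rightarrow> ennreal) \<Rightarrow> bool" where
  "minimal_process M L \<mu> Z T \<longleftrightarrow>
     (\<forall>t\<ge>0. Z t \<in> measurable M (count_space UNIV)) \<and>
     T \<in> borel_measurable M \<and>
     (\<exists>Y W. jump_hold M L \<mu> Y W \<and>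
        (AE \<omega> in M. T \<omega> = explosion_time W \<omega> \<and> (\<forall>t\<ge>0. Z t \<omega> = jump_path Y W t \<omega>)))"

text \<open>
  One cannot quantify over the type of the sample space inside a formula. Since explosion only depends
  on the joint law of the visited states and the holding times, it is enough to consider all
  probability measures on the space of sequences of pairs (state, holding time).
\<close>

definition nonexplosive :: "('s \<Rightarrow> 's \<Rightarrow> real) \<Rightarrow> bool" where
  "nonexplosive L \<longleftrightarrow>
     (\<forall>(M :: (nat \<Rightarrow> 's \<times> ennreal) measure) \<mu> Z T.
        prob_space M \<longrightarrow> minimal_process M L \<mu> Z T \<longrightarrow> (AE \<omega> in M. T \<omega> = \<infinity>))"

text \<open>The \<open>\<sigma>\<close>-algebra generated by the variables \<open>Z s\<close>, \<open>s \<in> I\<close>, with values in a discrete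
  countable space.\<close>

definition process_sigma :: "'w measure \<Rightarrow> (real \<Rightarrow> 'w \<Rightarrow> 'b) \<Rightarrow> real set \<Rightarrow> 'w measure" where
  "process_sigma M Z I = sigma (space M) {Z s -` A \<inter> space M | s A. s \<in> I}"

end

theory Submission
  imports Defs
begin

text \<open>
  While the dual process stays at \<open>y\<close>, the conditional law of \<open>X\<close> has to remain \<open>\<Lambda> y\<close>. The relation
  \<open>Ls \<Lambda> = \<Lambda> L\<close> says that, at every \<open>x\<close>, the flow of \<open>X\<close> into \<open>x\<close> minus the flow that the jumps of the dual
  process have to carry away equals \<open>\<Lambda> y x\<close> times the difference of the two jump rates. Hence it is enough
  to let the dual process jump, with suitable probabilities, together with the jumps of \<open>X\<close> and, where \<open>X\<close>
  jumps more slowly than the dual process should, at an additional exponential alarm. The resulting dual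
  process is a function of the path of \<open>X\<close> up to the present and of an independent noise, which gives the
  second identity.

  For the law of one stay at \<open>y\<close>, the expected rewards collected at the successive jumps of \<open>X\<close> are
  iterates of an operator for which the resolvent equation of the Laplace transform yields a conservation
  law. It bounds the law of the exit time, exit point and future of \<open>X\<close> from above by an exponential time, the
  jump law of \<open>Ls\<close> and a fresh copy of \<open>X\<close> started from the kernel, and likewise the law of \<open>X\<close> before the
  exit. Since \<open>X\<close> does not explode, both sides have the same mass, so that the bounds are equalities.
  Iterating over the stays gives the law of the dual process and the first identity.
\<close>

section \<open>Sampling from a uniform variable\<close>

text \<open>Jump rates may be unbounded and the dual process may explode, so no semigroup is
  differentiated; only nonnegative integrals are exchanged, one step of X at a time. The rates of
  the coupling come from asking that during a stay at \<open>y\<close> the mass of X at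
  \<open>x\<close> be \<open>exp (- (dual_rate y * t)) * \<Lambda> y x\<close>. With
  \<open>max (rate x) (dual_rate y)\<close> as total rate of events at \<open>x\<close>, the jumps
  of X that do not end the stay must return what exceeds \<open>dual_rate y\<close>; the
  intertwining relation makes the rest of the flow the one that \<open>Ls\<close> demands. The
  telescoped conservation law leaves a remainder that is not shown to vanish: this is why only upper
  bounds come out of it and total masses have to be compared.

  A second obstacle is measurability. The visited states and holding times of X are merely given to
  exist, whereas the randomization \<open>U\<close> is independent only of the \<sigma>-algebra of
  X. The itinerary is therefore recomputed from X at rational times, and all further randomness is
  extracted from \<open>U\<close> by samplers for laws on spaces coded by bit sequences.\<close>

definition bit_space :: "(nat \<Rightarrow> bool) measure" where
  "bit_space = PiM UNIV (\<lambda>_. count_space UNIV)"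

text \<open>A substitute for being a standard Borel space that is easily seen to be closed under
  countable products.\<close>

definition coded :: "'a measure \<Rightarrow> bool" where
  "coded N \<longleftrightarrow> (\<exists>b d. b \<in> N \<rightarrow>\<^sub>M bit_space \<and> d \<in> bit_space \<rightarrow>\<^sub>M N \<and> (\<forall>v\<in>space N. d (b v) = v))"

lemma measurable_bit: "(\<lambda>f. f n) \<in> bit_space \<rightarrow>\<^sub>M count_space UNIV"
  unfolding bit_space_def by measurable

lemma measurable_to_bit_space:
  assumes "\<And>n. (\<lambda>x. g x n) \<in> N \<rightarrow>\<^sub>M count_space UNIV"
  shows "g \<in> N \<rightarrow>\<^sub>M bit_space"
  unfolding bit_space_def using assms by (intro measurable_PiM_single') (auto simp: PiE_UNIV_domain)

lemma coded_pair:
  assumes "coded N1" "coded N2" shows "coded (N1 \<Otimes>\<^sub>M N2)"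
proof -
  note measurable_bit [measurable]
  obtain b1 d1 where 1 [measurable]: "b1 \<in> N1 \<rightarrow>\<^sub>M bit_space" "d1 \<in> bit_space \<rightarrow>\<^sub>M N1"
    and i1: "\<forall>v\<in>space N1. d1 (b1 v) = v" using assms(1) unfolding coded_def by blast
  obtain b2 d2 where 2 [measurable]: "b2 \<in> N2 \<rightarrow>\<^sub>M bit_space" "d2 \<in> bit_space \<rightarrow>\<^sub>M N2"
    and i2: "\<forall>v\<in>space N2. d2 (b2 v) = v" using assms(2) unfolding coded_def by blast
  let ?b = "\<lambda>p n. if even n then b1 (fst p) (n div 2) else b2 (snd p) (n div 2)"
  let ?d = "\<lambda>f. (d1 (\<lambda>n. f (2 * n)), d2 (\<lambda>n. f (2 * n + 1)))"
  have "?b \<in> N1 \<Otimes>\<^sub>M N2 \<rightarrow>\<^sub>M bit_space"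
    by (rule measurable_to_bit_space) auto
  moreover have [measurable]: "(\<lambda>f n. f (2 * n)) \<in> bit_space \<rightarrow>\<^sub>M bit_space" "(\<lambda>f n. f (2 * n + 1)) \<in> bit_space \<rightarrow>\<^sub>M bit_space"
    by (rule measurable_to_bit_space, measurable)+
  have "?d \<in> bit_space \<rightarrow>\<^sub>M N1 \<Otimes>\<^sub>M N2" by measurable
  ultimately show ?thesis
    unfolding coded_def using i1 i2
    by (intro exI[of _ ?b] exI[of _ ?d]) (auto simp: space_pair_measure)
qed

lemma coded_stream:
  assumes "coded N" shows "coded (stream_space N)"
proof -
  note measurable_bit [measurable]
  obtain b d where 1 [measurable]: "b \<in> N \<rightarrow>\<^sub>M bit_space" "d \<in> bit_space \<rightarrow>\<^sub>M N"
    and i: "\<forall>v\<in>space N. d (b v) = v" using assms(1) unfolding coded_def by blast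
  let ?b = "\<lambda>s n. b (s !! fst (prod_decode n)) (snd (prod_decode n))"
  let ?d = "\<lambda>f. to_stream (\<lambda>i. d (\<lambda>j. f (prod_encode (i, j))))"
  have "?b \<in> stream_space N \<rightarrow>\<^sub>M bit_space"
    by (rule measurable_to_bit_space) measurable
  moreover have [measurable]: "(\<lambda>f j. f (prod_encode (i, j))) \<in> bit_space \<rightarrow>\<^sub>M bit_space" for i
    by (rule measurable_to_bit_space) measurable
  have "(\<lambda>f i. d (\<lambda>j. f (prod_encode (i, j)))) \<in> bit_space \<rightarrow>\<^sub>M PiM UNIV (\<lambda>_. N)"
    by (intro measurable_PiM_single')
      (auto simp: PiE_UNIV_domain intro!: measurable_space[OF 1(2)] measurable_space[OF \<open>\<And>i. (\<lambda>f j. f (prod_encode (i, j))) \<in> bit_space \<rightarrow>\<^sub>M bit_space\<close>])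
  then have "?d \<in> bit_space \<rightarrow>\<^sub>M stream_space N"
    by (rule measurable_compose[OF _ measurable_to_stream])
  moreover have "?d (?b s) = s" if "s \<in> space (stream_space N)" for s
  proof -
    have "s !! i \<in> space N" for i
      using that by (simp add: space_stream_space snth_in)
    then show ?thesis using i by (simp add: to_stream_def stream_smap_nats[symmetric])
  qed
  ultimately show ?thesis
    unfolding coded_def by (intro exI[of _ ?b] exI[of _ ?d]) auto
qed

lemma coded_count_space: "coded (count_space (UNIV :: 'a::countable set))"
proof -
  note measurable_bit [measurable]
  let ?b = "\<lambda>(x::'a) n. n = to_nat x"
  let ?d = "\<lambda>f. from_nat (LEAST n. f n) :: 'a"
  have "?d \<in> bit_space \<rightarrow>\<^sub>M count_space UNIV" by measurable
  moreover have "?d (?b x) = x" for x by (simp add: Least_equality)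
  moreover have "?b \<in> count_space UNIV \<rightarrow>\<^sub>M bit_space" by (rule measurable_to_bit_space) simp
  ultimately show ?thesis unfolding coded_def by blast
qed

text \<open>The bits are the upper Dedekind cut of the number in the rationals, and the infimum of
  the cut gives the number back. The decoder \<open>?d\<close> is defined on all bit sequences, also
  on those that are no cuts.\<close>

lemma coded_ennreal: "coded (borel :: ennreal measure)"
proof -
  note measurable_bit [measurable]
  define q where "q n = ennreal (real_of_rat (from_nat n))" for n :: nat
  let ?b = "\<lambda>x n. x < q n"
  let ?d = "\<lambda>f. (INF n. if f n then q n else \<infinity>)"
  have "?d \<in> bit_space \<rightarrow>\<^sub>M borel" by measurable
  moreover have "?d (?b x) = x" for x
  proof (rule antisym)
    show "x \<le> ?d (?b x)" by (intro INF_greatest) auto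
    show "?d (?b x) \<le> x"
    proof (rule ccontr)
      assume "\<not> ?thesis"
      then have "x < ?d (?b x)" by simp
      then obtain r where r: "x < ennreal (real_of_rat r)" "ennreal (real_of_rat r) < ?d (?b x)"
        using ennreal_rat_dense by blast
      have "?d (?b x) \<le> (if ?b x (to_nat r) then q (to_nat r) else \<infinity>)" by (rule INF_lower) simp
      with r show False by (simp add: q_def)
    qed
  qed
  moreover have "?b \<in> borel \<rightarrow>\<^sub>M bit_space" by (rule measurable_to_bit_space) measurable
  ultimately show ?thesis unfolding coded_def by blast
qed

text \<open>The same cut; the infimum is formed in the complete lattice \<open>ereal\<close>, so
  that arbitrary bit sequences do no harm.\<close>

lemma coded_real: "coded (borel :: real measure)"
proof -
  note measurable_bit [measurable]
  define q where "q n = ereal (real_of_rat (from_nat n))" for n :: nat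
  let ?b = "\<lambda>x n. ereal x < q n"
  let ?d = "\<lambda>f. real_of_ereal (INF n. if f n then q n else \<infinity>)"
  have "?d \<in> bit_space \<rightarrow>\<^sub>M borel" by measurable
  moreover have "(INF n. if ?b x n then q n else \<infinity>) = ereal x" for x
  proof (rule antisym)
    show "ereal x \<le> (INF n. if ?b x n then q n else \<infinity>)" by (intro INF_greatest) auto
    show "(INF n. if ?b x n then q n else \<infinity>) \<le> ereal x"
    proof (rule ccontr)
      assume "\<not> ?thesis"
      then have "ereal x < (INF n. if ?b x n then q n else \<infinity>)" by (simp only: not_le)
      from ereal_dense2[OF this] obtain y
        where y: "ereal x < ereal y" "ereal y < (INF n. if ?b x n then q n else \<infinity>)" by blast
      then have "x < y" by simp
      then obtain r where r: "x < real_of_rat r" "real_of_rat r < y" using of_rat_dense by auto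
      have "(INF n. if ?b x n then q n else \<infinity>) \<le> (if ?b x (to_nat r) then q (to_nat r) else \<infinity>)"
        by (rule INF_lower) simp
      also have "\<dots> = ereal (real_of_rat r)" using r by (simp add: q_def)
      also have "\<dots> < ereal y" using r by simp
      finally show False using y by simp
    qed
  qed
  then have "?d (?b x) = x" for x by simp
  moreover have "?b \<in> borel \<rightarrow>\<^sub>M bit_space" by (rule measurable_to_bit_space) measurable
  ultimately show ?thesis unfolding coded_def by blast
qed

section \<open>Transfer of laws on coded spaces to the unit interval\<close>

definition cantor :: "(nat \<Rightarrow> bool) \<Rightarrow> real" where
  "cantor f = (\<Sum>n. (if f n then 2 else 0) * (1 / 3) ^ Suc n)"

text \<open>Ternary expansions with digits 0 and 2 are unique, unlike binary ones, so
  \<open>cantor\<close> is injective. Its digits are read off by measurable operations: comparison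
  with 1/2 gives the leading digit, and one step of this recursion removes it.\<close>

fun ternary_rest :: "nat \<Rightarrow> real \<Rightarrow> real" where
  "ternary_rest 0 x = x"
| "ternary_rest (Suc n) x = 3 * ternary_rest n x - (if 1 / 2 \<le> ternary_rest n x then 2 else 0)"

lemma summable_cantor: "summable (\<lambda>n. (if f n then 2 else 0) * (1 / 3 :: real) ^ Suc n)"
  by (rule summable_comparison_test'[where g = "\<lambda>n. 2 * (1 / 3) ^ Suc n" and N = 0])
    (auto intro!: summable_mult summable_geometric simp del: power_Suc simp: summable_Suc_iff)

lemma cantor_bounds: "0 \<le> cantor f" "cantor f \<le> 1"
proof -
  show "0 \<le> cantor f" unfolding cantor_def by (intro suminf_nonneg summable_cantor) auto
  have "(\<lambda>n. (2 / 3) * (1 / 3 :: real) ^ n) sums ((2 / 3) * (1 / (1 - 1 / 3)))"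
    by (intro sums_mult geometric_sums) simp
  then have s: "(\<lambda>n. 2 * (1 / 3 :: real) ^ Suc n) sums 1" by simp
  have "cantor f \<le> (\<Sum>n. 2 * (1 / 3 :: real) ^ Suc n)"
    unfolding cantor_def by (intro suminf_le summable_cantor sums_summable[OF s]) auto
  then show "cantor f \<le> 1" using sums_unique[OF s] by simp
qed

lemma cantor_shift: "cantor f = (if f 0 then 2 / 3 else 0) + cantor (\<lambda>n. f (Suc n)) / 3"
proof -
  define g where "g n = (if f n then 2 else 0) * (1 / 3 :: real) ^ Suc n" for n
  define h where "h n = (if f (Suc n) then 2 else 0) * (1 / 3 :: real) ^ Suc n" for n
  have a1: "(\<Sum>n. g (Suc n)) = suminf g - g 0"
    unfolding g_def by (rule suminf_split_head[OF summable_cantor])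
  have a2: "(\<lambda>n. g (Suc n)) = (\<lambda>n. h n / 3)" by (simp add: g_def h_def fun_eq_iff)
  have a3: "(\<Sum>n. h n / 3) = suminf h / 3"
    unfolding h_def by (rule suminf_divide[OF summable_cantor])
  have "suminf h / 3 = suminf g - g 0" using a1 unfolding a2 a3 .
  then have "suminf g = g 0 + suminf h / 3" by linarith
  moreover have "cantor f = suminf g" "cantor (\<lambda>n. f (Suc n)) = suminf h"
    unfolding cantor_def g_def h_def by (rule refl)+
  moreover have "g 0 = (if f 0 then 2 / 3 else 0)" by (simp add: g_def)
  ultimately show ?thesis by (simp only:)
qed

lemma cantor_ge_half: "1 / 2 \<le> cantor f \<longleftrightarrow> f 0"
  using cantor_bounds[of "\<lambda>n. f (Suc n)"] by (simp add: cantor_shift[of f])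

lemma ternary_rest_cantor: "ternary_rest n (cantor f) = cantor (\<lambda>k. f (k + n))"
proof (induction n)
  case (Suc n)
  show ?case using cantor_shift[of "\<lambda>k. f (k + n)"] cantor_ge_half[of "\<lambda>k. f (k + n)"]
    by (simp add: Suc)
qed simp

lemma measurable_ternary_rest [measurable]: "ternary_rest n \<in> borel_measurable borel"
  by (induction n) (simp_all add: ternary_rest.simps[abs_def])

definition unit_uniform :: "real measure" where
  "unit_uniform = uniform_measure lborel {0..1}"

lemma prob_space_unit_uniform: "prob_space unit_uniform"
  unfolding unit_uniform_def by (rule prob_space_uniform_measure) auto

lemma sets_unit_uniform [simp, measurable_cong]: "sets unit_uniform = sets borel"
  by (simp add: unit_uniform_def)

lemma space_unit_uniform [simp]: "space unit_uniform = UNIV"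
  by (simp add: unit_uniform_def)

text \<open>Inverse transform sampling: \<open>I\<close> is the quantile function of
  \<open>P\<close>. It lives on the open unit interval; the endpoints of \<open>{0..1}\<close> form
  a null set.\<close>

lemma exists_real_sampler:
  assumes "real_distribution P"
  shows "\<exists>f \<in> borel \<rightarrow>\<^sub>M borel. distr unit_uniform borel f = P"
proof -
  interpret P: real_distribution P by fact
  interpret cdf_distribution P by standard
  let ?f = "\<lambda>u. if u \<in> {0<..<1} then I u else 0"
  have f: "?f \<in> borel \<rightarrow>\<^sub>M borel"
    using measurable_CI by (subst measurable_restrict_space_iff[symmetric]) auto
  have "distr unit_uniform borel ?f = distr (restrict_space lborel {0<..<1::real}) borel I"
  proof (rule measure_eqI)
    fix A :: "real set" assume "A \<in> sets (distr unit_uniform borel ?f)"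
    then have A: "A \<in> sets borel" by simp
    have mA: "?f -` A \<in> sets borel" using measurable_sets[OF f A] by simp
    have "emeasure (distr unit_uniform borel ?f) A = emeasure lborel ({0..1} \<inter> ?f -` A)"
      using mA A f by (simp add: emeasure_distr unit_uniform_def emeasure_uniform_measure divide_ennreal_def)
    also have "\<dots> = emeasure lborel ({0<..<1} \<inter> I -` A)"
    proof (rule emeasure_eq_AE)
      show "AE x in lborel. (x \<in> {0..1} \<inter> ?f -` A) = (x \<in> {0<..<1} \<inter> I -` A)"
        using AE_lborel_singleton[of 0] AE_lborel_singleton[of 1] by eventually_elim auto
      show "{0<..<1} \<inter> I -` A \<in> sets lborel"
      proof -
        have "{0<..<1} \<inter> I -` A = {0<..<1} \<inter> ?f -` A" by auto
        then show ?thesis using mA by simp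
      qed
    qed (use mA in auto)
    also have "\<dots> = emeasure (distr (restrict_space lborel {0<..<1::real}) borel I) A"
    proof -
      have "I \<in> restrict_space lborel {0<..<1} \<rightarrow>\<^sub>M borel"
        using measurable_CI by (simp cong: measurable_cong_sets add: sets_restrict_space)
      then have "emeasure (distr (restrict_space lborel {0<..<1}) borel I) A =
          emeasure (restrict_space lborel {0<..<1}) (I -` A \<inter> {0<..<1})"
        using A by (subst emeasure_distr) (simp_all add: space_restrict_space)
      also have "\<dots> = emeasure lborel ({0<..<1} \<inter> I -` A)"
        by (subst emeasure_restrict_space) (simp_all add: Int_commute)
      finally show ?thesis by simp
    qed
    finally show "emeasure (distr unit_uniform borel ?f) A = emeasure (distr (restrict_space lborel {0<..<1::real}) borel I) A" .
  qed simp
  then show ?thesis using f distr_I_eq_M by auto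
qed

text \<open>The law is pushed to the real line by the code followed by \<open>cantor\<close>,
  sampled there by its quantile function, and pulled back by reading the ternary digits and
  decoding.\<close>

lemma exists_sampler:
  assumes "coded N" "prob_space P" "sets P = sets N"
  shows "\<exists>f \<in> borel \<rightarrow>\<^sub>M N. distr unit_uniform N f = P"
proof -
  note measurable_bit [measurable]
  obtain b d where 1 [measurable]: "b \<in> N \<rightarrow>\<^sub>M bit_space" "d \<in> bit_space \<rightarrow>\<^sub>M N"
    and i: "\<forall>v\<in>space N. d (b v) = v" using assms(1) unfolding coded_def by blast
  have [measurable_cong]: "sets P = sets N" by fact
  interpret P: prob_space P by fact
  have [measurable]: "cantor \<in> borel_measurable bit_space"
    unfolding cantor_def by measurable
  have [measurable]: "(\<lambda>x n. 1 / 2 \<le> ternary_rest n x) \<in> borel \<rightarrow>\<^sub>M bit_space"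
    by (rule measurable_to_bit_space) measurable
  let ?c = "\<lambda>v. cantor (b v)" and ?e = "\<lambda>x. d (\<lambda>n. 1 / 2 \<le> ternary_rest n x)"
  have inv: "?e (?c v) = v" if "v \<in> space N" for v
    unfolding ternary_rest_cantor cantor_ge_half using i that by simp
  have c: "?c \<in> P \<rightarrow>\<^sub>M borel" by measurable
  have e: "?e \<in> borel \<rightarrow>\<^sub>M N" by (rule measurable_compose[OF _ 1(2)]) fact
  have "real_distribution (distr P borel ?c)"
    by (intro real_distribution.intro P.prob_space_distr real_distribution_axioms.intro c) auto
  then obtain f where f [measurable]: "f \<in> borel \<rightarrow>\<^sub>M borel" and fP: "distr unit_uniform borel f = distr P borel ?c"
    using exists_real_sampler by blast
  have f': "f \<in> unit_uniform \<rightarrow>\<^sub>M borel" by measurable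
  have "distr unit_uniform N (\<lambda>u. ?e (f u)) = distr (distr unit_uniform borel f) N ?e"
    using distr_distr[OF e f'] by (simp only: comp_def)
  also have "\<dots> = distr P N (\<lambda>v. ?e (?c v))"
    unfolding fP using distr_distr[OF e c] by (simp only: comp_def)
  also have "\<dots> = distr P N (\<lambda>v. v)"
    using sets_eq_imp_space_eq[OF assms(3)] inv by (intro distr_cong) auto
  also have "\<dots> = P" using assms(3) by (intro distr_id2) auto
  finally have "distr unit_uniform N (\<lambda>u. ?e (f u)) = P" .
  then show ?thesis by (rule bexI[where x = "\<lambda>u. ?e (f u)"]) (rule measurable_compose[OF f e])
qed

definition sampler :: "'a measure \<Rightarrow> real \<Rightarrow> 'a" where
  "sampler P = (SOME f. f \<in> borel \<rightarrow>\<^sub>M P \<and> distr unit_uniform P f = P)"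

lemma
  assumes "coded P" "prob_space P"
  shows measurable_sampler: "sampler P \<in> borel \<rightarrow>\<^sub>M P"
    and distr_sampler: "distr unit_uniform P (sampler P) = P"
proof -
  have "\<exists>f. f \<in> borel \<rightarrow>\<^sub>M P \<and> distr unit_uniform P f = P"
    using exists_sampler[OF assms refl] by blast
  then have "sampler P \<in> borel \<rightarrow>\<^sub>M P \<and> distr unit_uniform P (sampler P) = P"
    unfolding sampler_def by (rule someI_ex)
  then show "sampler P \<in> borel \<rightarrow>\<^sub>M P" "distr unit_uniform P (sampler P) = P" by auto
qed

lemma nn_integral_sampler:
  assumes "coded P" "prob_space P" "g \<in> borel_measurable P"
  shows "(\<integral>\<^sup>+u. g (sampler P u) \<partial>unit_uniform) = (\<integral>\<^sup>+x. g x \<partial>P)"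
proof -
  have "(\<integral>\<^sup>+x. g x \<partial>P) = (\<integral>\<^sup>+x. g x \<partial>distr unit_uniform P (sampler P))"
    using distr_sampler[OF assms(1,2)] by simp
  also have "\<dots> = (\<integral>\<^sup>+u. g (sampler P u) \<partial>unit_uniform)"
    using assms measurable_sampler[OF assms(1,2)] by (subst nn_integral_distr) auto
  finally show ?thesis by simp
qed

section \<open>Exponential times and Laplace transforms\<close>

text \<open>Without the normalizing factor \<open>c\<close>, so that rate 0 is allowed and the
  resolvent equation takes its usual form. The argument \<open>h\<close> is a function of extended
  times because a holding time may be infinite.\<close>

definition laplace :: "real \<Rightarrow> (ennreal \<Rightarrow> ennreal) \<Rightarrow> ennreal" where
  "laplace c h = (\<integral>\<^sup>+s. ennreal (exp (- (c * s))) * h (ennreal s) * indicator {0..} s \<partial>lborel)"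

text \<open>Rate 0 gives the infinite holding time of an absorbing state. Negative parameters are
  treated alike, so that \<open>expo c\<close> is a probability measure without any
  condition.\<close>

definition expo :: "real \<Rightarrow> ennreal measure" where
  "expo c = (if c \<le> 0 then return borel \<infinity>
    else distr (density lborel (exponential_density c)) borel ennreal)"

lemma sets_expo [simp, measurable_cong]: "sets (expo c) = sets borel"
  by (simp add: expo_def)

lemma space_expo [simp]: "space (expo c) = UNIV"
  by (simp add: expo_def)

lemma prob_space_expo: "prob_space (expo c)"
proof (cases "c \<le> 0")
  case False
  then have "prob_space (density lborel (exponential_density c))"
    by (intro prob_space_exponential_density) simp
  then show ?thesis using False
    by (simp add: expo_def prob_space.prob_space_distr)
qed (simp add: expo_def prob_space_return)

lemma coded_expo: "coded (expo c)"
  using coded_ennreal unfolding coded_def by (simp cong: measurable_cong_sets)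

lemma nn_integral_expo:
  assumes "0 \<le> c" and [measurable]: "h \<in> borel_measurable borel"
  shows "(\<integral>\<^sup>+w. h w \<partial>expo c) = ennreal c * laplace c h + (if c = 0 then h \<infinity> else 0)"
proof (cases "c = 0")
  case True
  then show ?thesis by (simp add: expo_def nn_integral_return)
next
  case False
  with assms have c: "0 < c" by simp
  have "(\<integral>\<^sup>+w. h w \<partial>expo c) = (\<integral>\<^sup>+s. ennreal (exponential_density c s) * h (ennreal s) \<partial>lborel)"
    using c by (simp add: expo_def nn_integral_distr nn_integral_density)
  also have "\<dots> = (\<integral>\<^sup>+s. ennreal c * (ennreal (exp (- (c * s))) * h (ennreal s) * indicator {0..} s) \<partial>lborel)"
  proof (intro nn_integral_cong)
    fix s :: real
    have "ennreal (c * exp (- (s * c))) = ennreal c * ennreal (exp (- (c * s)))"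
      using c by (simp add: ennreal_mult' mult.commute[of s c])
    then show "ennreal (exponential_density c s) * h (ennreal s)
        = ennreal c * (ennreal (exp (- (c * s))) * h (ennreal s) * indicator {0..} s)"
      by (simp add: exponential_density_def mult.assoc)
  qed
  also have "\<dots> = ennreal c * laplace c h"
    unfolding laplace_def by (subst nn_integral_cmult) auto
  finally show ?thesis using False by simp
qed

lemma laplace_cong:
  assumes "\<And>s. 0 \<le> s \<Longrightarrow> f (ennreal s) = g (ennreal s)"
  shows "laplace c f = laplace c g"
  unfolding laplace_def by (intro nn_integral_cong) (auto simp: indicator_def assms)

lemma measurable_laplace [measurable]:
  assumes [measurable]: "(\<lambda>(x, s). h x s) \<in> borel_measurable (M \<Otimes>\<^sub>M borel)"
  shows "(\<lambda>x. laplace c (h x)) \<in> borel_measurable M"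
  unfolding laplace_def by measurable

lemma laplace_cmult:
  assumes [measurable]: "h \<in> borel_measurable borel"
  shows "laplace c (\<lambda>s. k * h s) = k * laplace c h"
proof -
  have "laplace c (\<lambda>s. k * h s) = (\<integral>\<^sup>+s. k * (ennreal (exp (- (c * s))) * h (ennreal s) * indicator {0..} s) \<partial>lborel)"
    unfolding laplace_def by (intro nn_integral_cong) (simp add: mult_ac)
  also have "\<dots> = k * laplace c h" unfolding laplace_def by (rule nn_integral_cmult) measurable
  finally show ?thesis .
qed

lemma laplace_add:
  assumes [measurable]: "f \<in> borel_measurable borel" "g \<in> borel_measurable borel"
  shows "laplace c (\<lambda>s. f s + g s) = laplace c f + laplace c g"
proof -
  have "laplace c (\<lambda>s. f s + g s) = (\<integral>\<^sup>+s. ennreal (exp (- (c * s))) * f (ennreal s) * indicator {0..} s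
      + ennreal (exp (- (c * s))) * g (ennreal s) * indicator {0..} s \<partial>lborel)"
    unfolding laplace_def by (intro nn_integral_cong) (simp add: distrib_left distrib_right)
  also have "\<dots> = laplace c f + laplace c g" unfolding laplace_def by (rule nn_integral_add) measurable
  finally show ?thesis .
qed

lemma laplace_sum_count_space:
  fixes f :: "'a::countable \<Rightarrow> ennreal \<Rightarrow> ennreal"
  assumes [measurable]: "\<And>x. f x \<in> borel_measurable borel"
  shows "laplace c (\<lambda>s. \<integral>\<^sup>+x. f x s \<partial>count_space UNIV) = (\<integral>\<^sup>+x. laplace c (f x) \<partial>count_space UNIV)"
proof -
  have "laplace c (\<lambda>s. \<integral>\<^sup>+x. f x s \<partial>count_space UNIV)
      = (\<integral>\<^sup>+s. \<integral>\<^sup>+x. ennreal (exp (- (c * s))) * f x (ennreal s) * indicator {0..} s \<partial>count_space UNIV \<partial>lborel)"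
    unfolding laplace_def
    by (intro nn_integral_cong) (simp add: nn_integral_cmult[symmetric] nn_integral_multc[symmetric])
  also have "\<dots> = (\<integral>\<^sup>+x. laplace c (f x) \<partial>count_space UNIV)"
    unfolding laplace_def by (rule nn_integral_count_space_nn_integral) auto
  finally show ?thesis .
qed

text \<open>Duhamel's formula: the derivative of
  \<open>exp (- (a * s)) * exp (- (c * (u - s)))\<close> in \<open>s\<close> is \<open>c - a\<close>
  times the same product, and is integrated over \<open>{0..u}\<close>.\<close>

lemma exp_variation:
  assumes "a \<le> c" "0 \<le> u"
  shows "ennreal (exp (- (c * u))) + ennreal (c - a) *
      (\<integral>\<^sup>+s. ennreal (exp (- (a * s))) * ennreal (exp (- (c * (u - s)))) * indicator {0..u} s \<partial>lborel)
    = ennreal (exp (- (a * u)))"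
proof -
  let ?f = "\<lambda>s. (c - a) * (exp (- (a * s)) * exp (- (c * (u - s))))"
  have "(\<integral>\<^sup>+s. ennreal (?f s) * indicator {0..u} s \<partial>lborel)
      = ennreal (exp (- (a * u)) * exp (- (c * (u - u))) - exp (- (a * 0)) * exp (- (c * (u - 0))))"
    using assms
    by (intro nn_integral_FTC_Icc[where F = "\<lambda>s. exp (- (a * s)) * exp (- (c * (u - s)))"])
      (auto intro!: derivative_eq_intros simp: algebra_simps)
  also have "(\<integral>\<^sup>+s. ennreal (?f s) * indicator {0..u} s \<partial>lborel) = ennreal (c - a) *
      (\<integral>\<^sup>+s. ennreal (exp (- (a * s))) * ennreal (exp (- (c * (u - s)))) * indicator {0..u} s \<partial>lborel)"
    using assms by (subst nn_integral_cmult[symmetric]) (auto simp: ennreal_mult' mult.assoc intro!: nn_integral_cong)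
  finally have e: "ennreal (c - a) *
      (\<integral>\<^sup>+s. ennreal (exp (- (a * s))) * ennreal (exp (- (c * (u - s)))) * indicator {0..u} s \<partial>lborel)
    = ennreal (exp (- (a * u)) - exp (- (c * u)))" by simp
  have "exp (- (c * u)) \<le> exp (- (a * u))" using assms by (simp add: mult_right_mono)
  then show ?thesis unfolding e by (subst ennreal_plus[symmetric]) auto
qed

text \<open>The resolvent equation of the translation semigroup. After the substitution
  \<open>u = s + r\<close> and Tonelli, the inner integral in \<open>s\<close> is the one in
  \<open>exp_variation\<close>.\<close>

lemma laplace_resolvent:
  assumes "a \<le> c" and [measurable]: "h \<in> borel_measurable borel"
  shows "laplace c h + ennreal (c - a) * laplace a (\<lambda>s. laplace c (\<lambda>r. h (s + r))) = laplace a h"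
proof -
  have [measurable]: "Measurable.pred (borel \<Otimes>\<^sub>M borel) (\<lambda>x :: real \<times> real. snd x \<in> {0..fst x})"
    "Measurable.pred (borel \<Otimes>\<^sub>M borel) (\<lambda>x :: real \<times> real. fst x \<in> {0..snd x})"
    by simp_all
  let ?k = "\<lambda>s u. ennreal (exp (- (a * s))) * ennreal (exp (- (c * (u - s)))) * indicator {0..u} s :: ennreal"
  have inner: "laplace c (\<lambda>r. h (ennreal s + r))
      = (\<integral>\<^sup>+u. ennreal (exp (- (c * (u - s)))) * h (ennreal u) * indicator {s..} u \<partial>lborel)"
    if "0 \<le> s" for s
  proof -
    have "(\<integral>\<^sup>+u. ennreal (exp (- (c * (u - s)))) * h (ennreal u) * indicator {s..} u \<partial>lborel)
      = (\<integral>\<^sup>+r. ennreal (exp (- (c * ((s + 1 * r) - s)))) * h (ennreal (s + 1 * r)) * indicator {s..} (s + 1 * r) \<partial>lborel)"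
      by (subst nn_integral_real_affine[where c = 1 and t = s]) auto
    also have "\<dots> = laplace c (\<lambda>r. h (ennreal s + r))"
      unfolding laplace_def using that by (intro nn_integral_cong) (auto simp: indicator_def ennreal_plus)
    finally show ?thesis by simp
  qed
  have "laplace a (\<lambda>s. laplace c (\<lambda>r. h (s + r)))
    = (\<integral>\<^sup>+s. \<integral>\<^sup>+u. h (ennreal u) * (?k s u * indicator {0..} u) \<partial>lborel \<partial>lborel)"
    unfolding laplace_def[of a]
  proof (intro nn_integral_cong)
    fix s :: real
    show "ennreal (exp (- (a * s))) * laplace c (\<lambda>r. h (ennreal s + r)) * indicator {0..} s
       = (\<integral>\<^sup>+u. h (ennreal u) * (?k s u * indicator {0..} u) \<partial>lborel)"
    proof (cases "0 \<le> s")
      case True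
      have "ennreal (exp (- (a * s))) * laplace c (\<lambda>r. h (ennreal s + r)) * indicator {0..} s
        = (\<integral>\<^sup>+u. ennreal (exp (- (a * s))) * (ennreal (exp (- (c * (u - s)))) * h (ennreal u) * indicator {s..} u) \<partial>lborel)"
        using True by (simp add: inner nn_integral_cmult)
      also have "\<dots> = (\<integral>\<^sup>+u. h (ennreal u) * (?k s u * indicator {0..} u) \<partial>lborel)"
        using True by (intro nn_integral_cong) (auto simp: indicator_def mult_ac)
      finally show ?thesis .
    qed (auto simp: indicator_def)
  qed
  also have "\<dots> = (\<integral>\<^sup>+u. \<integral>\<^sup>+s. h (ennreal u) * (?k s u * indicator {0..} u) \<partial>lborel \<partial>lborel)"
    by (rule lborel_pair.Fubini') measurable
  also have "\<dots> = (\<integral>\<^sup>+u. h (ennreal u) * indicator {0..} u * (\<integral>\<^sup>+s. ?k s u \<partial>lborel) \<partial>lborel)"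
    by (intro nn_integral_cong) (simp add: nn_integral_cmult[symmetric] mult_ac)
  finally have "laplace c h + ennreal (c - a) * laplace a (\<lambda>s. laplace c (\<lambda>r. h (s + r)))
    = (\<integral>\<^sup>+u. ennreal (exp (- (c * u))) * h (ennreal u) * indicator {0..} u
        + ennreal (c - a) * (h (ennreal u) * indicator {0..} u * (\<integral>\<^sup>+s. ?k s u \<partial>lborel)) \<partial>lborel)"
    by (subst nn_integral_add) (auto simp: nn_integral_cmult laplace_def)
  also have "\<dots> = laplace a h"
    unfolding laplace_def
  proof (intro nn_integral_cong)
    fix u :: real
    show "ennreal (exp (- (c * u))) * h (ennreal u) * indicator {0..} u
        + ennreal (c - a) * (h (ennreal u) * indicator {0..} u * (\<integral>\<^sup>+s. ?k s u \<partial>lborel))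
       = ennreal (exp (- (a * u))) * h (ennreal u) * indicator {0..} u"
    proof (cases "0 \<le> u")
      case True
      have "ennreal (exp (- (c * u))) * h (ennreal u)
        + ennreal (c - a) * (h (ennreal u) * (\<integral>\<^sup>+s. ?k s u \<partial>lborel))
        = h (ennreal u) * (ennreal (exp (- (c * u))) + ennreal (c - a) * (\<integral>\<^sup>+s. ?k s u \<partial>lborel))"
        by (simp only: distrib_left mult_ac)
      also have "\<dots> = h (ennreal u) * ennreal (exp (- (a * u)))"
        by (subst exp_variation[OF assms(1) True]) simp
      finally show ?thesis using True by (simp add: mult.commute)
    qed (auto simp: indicator_def)
  qed
  finally show ?thesis .
qed

text \<open>A translation by \<open>s\<close> in the density. At rate 0 both sides are
  \<open>g \<infinity>\<close>, because \<open>\<infinity> - s = \<infinity>\<close> for finite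
  \<open>s\<close>.\<close>

lemma expo_memoryless:
  assumes "0 \<le> l" "0 \<le> s" and [measurable]: "g \<in> borel_measurable borel"
  shows "(\<integral>\<^sup>+w. (if ennreal s < w then g (w - ennreal s) else 0) \<partial>expo l)
    = ennreal (exp (- (l * s))) * (\<integral>\<^sup>+w. g w \<partial>expo l)"
proof (cases "l = 0")
  case True
  then show ?thesis by (simp add: nn_integral_expo)
next
  case False
  with assms have l: "0 < l" by simp
  have "(\<integral>\<^sup>+w. (if ennreal s < w then g (w - ennreal s) else 0) \<partial>expo l)
    = ennreal l * (\<integral>\<^sup>+u. ennreal (exp (- (l * u))) * (if ennreal s < ennreal u then g (ennreal u - ennreal s) else 0)
        * indicator {0..} u \<partial>lborel)"
    using False assms by (simp add: nn_integral_expo laplace_def)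
  also have "(\<integral>\<^sup>+u. ennreal (exp (- (l * u))) * (if ennreal s < ennreal u then g (ennreal u - ennreal s) else 0)
        * indicator {0..} u \<partial>lborel)
    = (\<integral>\<^sup>+u. ennreal (exp (- (l * u))) * g (ennreal (u - s)) * indicator {s<..} u \<partial>lborel)"
    using assms by (intro nn_integral_cong) (auto simp: indicator_def ennreal_less_iff ennreal_minus)
  also have "\<dots> = (\<integral>\<^sup>+u. ennreal (exp (- (l * (s + 1 * u)))) * g (ennreal ((s + 1 * u) - s)) * indicator {s<..} (s + 1 * u) \<partial>lborel)"
    by (subst nn_integral_real_affine[where c = 1 and t = s]) auto
  also have "\<dots> = (\<integral>\<^sup>+u. ennreal (exp (- (l * s))) * (ennreal (exp (- (l * u))) * g (ennreal u) * indicator {0..} u) \<partial>lborel)"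
  proof (rule nn_integral_cong_AE)
    show "AE u in lborel. ennreal (exp (- (l * (s + 1 * u)))) * g (ennreal ((s + 1 * u) - s)) * indicator {s<..} (s + 1 * u)
      = ennreal (exp (- (l * s))) * (ennreal (exp (- (l * u))) * g (ennreal u) * indicator {0..} u)"
      using AE_lborel_singleton[of 0]
    proof eventually_elim
      case (elim u)
      have "exp (- (l * (s + u))) = exp (- (l * s)) * exp (- (l * u))"
        by (simp add: exp_add[symmetric] algebra_simps)
      with elim show ?case by (auto simp: indicator_def ennreal_mult' mult.assoc)
    qed
  qed
  also have "\<dots> = ennreal (exp (- (l * s))) * laplace l g"
    unfolding laplace_def by (rule nn_integral_cmult) measurable
  finally show ?thesis using False assms by (simp add: nn_integral_expo mult_ac)
qed

lemma emeasure_expo_greater: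
  assumes "0 \<le> c" "0 \<le> t"
  shows "emeasure (expo c) {ennreal t<..} = ennreal (exp (- (c * t)))"
proof -
  have "emeasure (expo c) {ennreal t<..} = (\<integral>\<^sup>+w. (if ennreal t < w then 1 else 0) \<partial>expo c)"
  proof -
    have "(\<lambda>w. if ennreal t < w then 1 else 0) = (indicator {ennreal t<..} :: ennreal \<Rightarrow> ennreal)"
      by (auto simp: fun_eq_iff)
    then show ?thesis by simp
  qed
  also have "\<dots> = ennreal (exp (- (c * t)))"
    using expo_memoryless[OF assms, of "\<lambda>_. 1"] prob_space.emeasure_space_1[OF prob_space_expo, of c] by simp
  finally show ?thesis .
qed

lemma AE_expo_pos: "AE w in expo c. 0 < w"
proof (cases "0 \<le> c")
  case True
  then have "emeasure (expo c) {0<..} = 1" using emeasure_expo_greater[of c 0] by simp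
  then have "AE w in expo c. w \<in> {0<..}"
    by (intro prob_space.AE_in_set_eq_1[OF prob_space_expo, THEN iffD2]) (auto simp: measure_def)
  then show ?thesis by simp
next
  case False
  then have e: "expo c = return borel \<infinity>" by (simp add: expo_def)
  show ?thesis unfolding e by (subst AE_return) auto
qed

lemma AE_expo_finite: "0 < c \<Longrightarrow> AE w in expo c. w < \<infinity>"
  unfolding expo_def by (simp add: AE_distr_iff del: infinity_ennreal_def) (simp add: AE_density)

lemma expo_0: "expo 0 = return borel \<infinity>"
  by (simp add: expo_def)

lemma expo_atLeast:
  assumes "0 \<le> c" "0 \<le> t"
  shows "emeasure (expo c) {ennreal t..} = ennreal (exp (- (c * t)))"
proof -
  have "AE w in expo c. w \<noteq> ennreal t"
  proof (cases "c = 0")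
    case False
    have "AE s in lborel. s \<noteq> t" by (rule AE_lborel_singleton)
    then show ?thesis
      using False assms unfolding expo_def
      by (subst if_not_P, simp, subst AE_distr_iff, simp, simp, subst AE_density, simp)
        (auto elim!: eventually_mono simp: exponential_density_def)
  next
    case True
    then have e: "expo c = return borel \<infinity>" by (simp add: expo_def)
    show ?thesis unfolding e by (subst AE_return) auto
  qed
  then have "emeasure (expo c) {ennreal t..} = emeasure (expo c) {ennreal t<..}"
    by (intro emeasure_eq_AE) (auto elim!: eventually_mono)
  then show ?thesis using emeasure_expo_greater[OF assms] by simp
qed

text \<open>An alarm \<open>s\<close> of rate \<open>e\<close> competes with a holding time
  \<open>w\<close> of rate \<open>l\<close>. If the alarm wins, the residual holding time is fresh
  by memorylessness; if it loses, its survival probability changes the decay rate from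
  \<open>l\<close> to \<open>l + e\<close>. The condition \<open>H \<infinity> = 0\<close> removes
  the atom at infinity that appears for \<open>l = 0\<close>.\<close>

lemma expo_race:
  assumes "0 \<le> l" "0 \<le> e"
    and [measurable]: "(\<lambda>(s, w). G s w) \<in> borel_measurable (borel \<Otimes>\<^sub>M borel)" "H \<in> borel_measurable borel"
    and "H \<infinity> = 0"
  shows "(\<integral>\<^sup>+w. \<integral>\<^sup>+s. (if s < w then G s (w - s) else H w) \<partial>expo e \<partial>expo l)
    = ennreal e * laplace (l + e) (\<lambda>s. \<integral>\<^sup>+w. G s w \<partial>expo l) + ennreal l * laplace (l + e) H"
proof -
  interpret l: prob_space "expo l" by (rule prob_space_expo)
  interpret e: prob_space "expo e" by (rule prob_space_expo)
  interpret le: pair_sigma_finite "expo e" "expo l" ..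
  have [measurable]: "Measurable.pred (borel \<Otimes>\<^sub>M borel) (\<lambda>x :: ennreal \<times> ennreal. snd x \<in> {fst x..})"
    by simp
  have "(\<integral>\<^sup>+w. \<integral>\<^sup>+s. (if s < w then G s (w - s) else H w) \<partial>expo e \<partial>expo l)
    = (\<integral>\<^sup>+w. (\<integral>\<^sup>+s. (if s < w then G s (w - s) else 0) \<partial>expo e) + H w * emeasure (expo e) {w..} \<partial>expo l)"
  proof (intro nn_integral_cong)
    fix w
    have "(\<integral>\<^sup>+s. (if s < w then G s (w - s) else H w) \<partial>expo e)
      = (\<integral>\<^sup>+s. (if s < w then G s (w - s) else 0) + H w * indicator {w..} s \<partial>expo e)"
      by (intro nn_integral_cong) (auto simp: indicator_def)
    also have "\<dots> = (\<integral>\<^sup>+s. (if s < w then G s (w - s) else 0) \<partial>expo e) + H w * emeasure (expo e) {w..}"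
      by (subst nn_integral_add) (auto simp: nn_integral_cmult_indicator)
    finally show "(\<integral>\<^sup>+s. (if s < w then G s (w - s) else H w) \<partial>expo e) = \<dots>" .
  qed
  also have "\<dots> = (\<integral>\<^sup>+w. \<integral>\<^sup>+s. (if s < w then G s (w - s) else 0) \<partial>expo e \<partial>expo l)
      + (\<integral>\<^sup>+w. H w * emeasure (expo e) {w..} \<partial>expo l)"
    by (rule nn_integral_add) measurable
  also have "(\<integral>\<^sup>+w. \<integral>\<^sup>+s. (if s < w then G s (w - s) else 0) \<partial>expo e \<partial>expo l)
      = (\<integral>\<^sup>+s. \<integral>\<^sup>+w. (if s < w then G s (w - s) else 0) \<partial>expo l \<partial>expo e)"
    by (rule le.Fubini') measurable
  also have "\<dots> = ennreal e * laplace (l + e) (\<lambda>s. \<integral>\<^sup>+w. G s w \<partial>expo l)"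
  proof -
    have "(\<integral>\<^sup>+s. \<integral>\<^sup>+w. (if s < w then G s (w - s) else 0) \<partial>expo l \<partial>expo e)
      = ennreal e * laplace e (\<lambda>s. \<integral>\<^sup>+w. (if s < w then G s (w - s) else 0) \<partial>expo l)"
      using assms(2) by (subst nn_integral_expo) auto
    also have "laplace e (\<lambda>s. \<integral>\<^sup>+w. (if s < w then G s (w - s) else 0) \<partial>expo l)
      = laplace (l + e) (\<lambda>s. \<integral>\<^sup>+w. G s w \<partial>expo l)"
      unfolding laplace_def
    proof (intro nn_integral_cong)
      fix s :: real
      show "ennreal (exp (- (e * s))) * (\<integral>\<^sup>+w. (if ennreal s < w then G (ennreal s) (w - ennreal s) else 0) \<partial>expo l) * indicator {0..} s
        = ennreal (exp (- ((l + e) * s))) * (\<integral>\<^sup>+w. G (ennreal s) w \<partial>expo l) * indicator {0..} s"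
      proof (cases "0 \<le> s")
        case True
        have "exp (- ((l + e) * s)) = exp (- (e * s)) * exp (- (l * s))"
          by (simp add: exp_add[symmetric] algebra_simps)
        then show ?thesis using True assms(1)
          by (simp add: expo_memoryless ennreal_mult' mult.assoc)
      qed (auto simp: indicator_def)
    qed
    finally show ?thesis .
  qed
  also have "(\<integral>\<^sup>+w. H w * emeasure (expo e) {w..} \<partial>expo l) = ennreal l * laplace (l + e) H"
  proof -
    have [measurable]: "Measurable.pred (borel \<Otimes>\<^sub>M borel) (\<lambda>x :: ennreal \<times> ennreal. snd x \<in> {fst x..})"
      by simp
    have "(\<lambda>w. emeasure (expo e) {w..}) = (\<lambda>w. \<integral>\<^sup>+s. (if w \<le> s then 1 else 0) \<partial>expo e)"
    proof
      fix w
      have "(\<lambda>s. if w \<le> s then 1 else 0) = (indicator {w..} :: ennreal \<Rightarrow> ennreal)"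
        by (auto simp: fun_eq_iff)
      then show "emeasure (expo e) {w..} = (\<integral>\<^sup>+s. (if w \<le> s then 1 else 0) \<partial>expo e)" by simp
    qed
    then have [measurable]: "(\<lambda>w. emeasure (expo e) {w..}) \<in> borel_measurable borel" by simp
    have "(\<integral>\<^sup>+w. H w * emeasure (expo e) {w..} \<partial>expo l) = ennreal l * laplace l (\<lambda>w. H w * emeasure (expo e) {w..})"
      using assms by (subst nn_integral_expo) auto
    also have "laplace l (\<lambda>w. H w * emeasure (expo e) {w..}) = laplace (l + e) H"
      unfolding laplace_def
    proof (intro nn_integral_cong)
      fix s :: real
      have "exp (- ((l + e) * s)) = exp (- (l * s)) * exp (- (e * s))"
        by (simp add: exp_add[symmetric] algebra_simps)
      then show "ennreal (exp (- (l * s))) * (H (ennreal s) * emeasure (expo e) {ennreal s..}) * indicator {0..} s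
        = ennreal (exp (- ((l + e) * s))) * H (ennreal s) * indicator {0..} s"
        using assms(2) by (auto simp: indicator_def expo_atLeast ennreal_mult' mult_ac)
    qed
    finally show ?thesis .
  qed
  finally show ?thesis .
qed

section \<open>The law of a jump process\<close>

abbreviation itinerary_space :: "('s \<times> ennreal) stream measure" where
  "itinerary_space \<equiv> stream_space (count_space UNIV \<Otimes>\<^sub>M borel)"

lemma space_itinerary_space [simp]: "space itinerary_space = UNIV"
  by (simp add: space_stream_space space_pair_measure)

definition jump_pmf :: "('s \<Rightarrow> 's \<Rightarrow> real) \<Rightarrow> 's \<Rightarrow> 's pmf" where
  "jump_pmf L x = embed_pmf (jump_prob L x)"

lemma jump_rate_nonneg: "generator L \<Longrightarrow> 0 \<le> jump_rate L x"
  unfolding generator_def by (metis ComplD has_sum_nonneg singletonI)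

lemma nn_integral_has_sum:
  fixes f :: "'a \<Rightarrow> real"
  assumes s: "(f has_sum s) A" and nn: "\<And>x. x \<in> A \<Longrightarrow> 0 \<le> f x"
  shows "(\<integral>\<^sup>+x. ennreal (f x) \<partial>count_space A) = ennreal s"
proof -
  have "(\<lambda>x. norm (f x)) summable_on A"
    using has_sum_imp_summable[OF s] by (rule summable_on_cong[THEN iffD1, rotated]) (simp add: nn)
  then have a: "Infinite_Set_Sum.abs_summable_on f A" using abs_summable_equivalent by blast
  then have "integrable (count_space A) f" by (simp add: Infinite_Set_Sum.abs_summable_on_def)
  then have "(\<integral>\<^sup>+x. ennreal (f x) \<partial>count_space A) = ennreal (infsetsum f A)"
    unfolding infsetsum_def using nn by (intro nn_integral_eq_integral) (auto intro: AE_I2)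
  also have "infsetsum f A = s" using a infsumI[OF s] by (simp add: infsetsum_infsum)
  finally show ?thesis .
qed

lemma nn_integral_generator_row:
  fixes L :: "'s::countable \<Rightarrow> 's \<Rightarrow> real"
  assumes "generator L"
  shows "(\<integral>\<^sup>+y. (if y = x then 0 else ennreal (L x y)) \<partial>count_space UNIV) = ennreal (jump_rate L x)"
proof -
  have "(\<integral>\<^sup>+y. (if y = x then 0 else ennreal (L x y)) \<partial>count_space UNIV)
      = (\<integral>\<^sup>+y. ennreal (L x y) \<partial>count_space (- {x}))"
    by (subst nn_integral_count_space_indicator[of "- {x}"]) (auto intro!: nn_integral_cong simp: indicator_def)
  also have "\<dots> = ennreal (jump_rate L x)"
    using assms unfolding generator_def by (intro nn_integral_has_sum) auto
  finally show ?thesis .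
qed

lemma jump_prob_nonneg: "generator L \<Longrightarrow> 0 \<le> jump_prob L x y"
  using jump_rate_nonneg[of L x] unfolding jump_prob_def generator_def by auto

lemma nn_integral_jump_prob:
  fixes L :: "'s::countable \<Rightarrow> 's \<Rightarrow> real"
  assumes "generator L"
  shows "(\<integral>\<^sup>+y. ennreal (jump_prob L x y) \<partial>count_space UNIV) = 1"
proof (cases "jump_rate L x = 0")
  case True
  then have "(\<integral>\<^sup>+y. ennreal (jump_prob L x y) \<partial>count_space UNIV)
      = (\<integral>\<^sup>+y. indicator {x} y \<partial>count_space UNIV)"
    by (intro nn_integral_cong) (auto simp: jump_prob_def indicator_def)
  then show ?thesis by simp
next
  case False
  then have r: "0 < jump_rate L x" using jump_rate_nonneg[OF assms, of x] by simp
  have "(\<integral>\<^sup>+y. ennreal (jump_prob L x y) \<partial>count_space UNIV)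
    = (\<integral>\<^sup>+y. ennreal (1 / jump_rate L x) * (if y = x then 0 else ennreal (L x y)) \<partial>count_space UNIV)"
    using r assms by (intro nn_integral_cong)
      (auto simp: jump_prob_def generator_def ennreal_mult'[symmetric])
  also have "\<dots> = ennreal (1 / jump_rate L x) * ennreal (jump_rate L x)"
    by (simp add: nn_integral_cmult nn_integral_generator_row[OF assms])
  also have "\<dots> = 1" using r by (simp add: ennreal_mult'[symmetric])
  finally show ?thesis .
qed

lemma pmf_jump_pmf:
  fixes L :: "'s::countable \<Rightarrow> 's \<Rightarrow> real"
  assumes "generator L"
  shows "pmf (jump_pmf L x) y = jump_prob L x y"
  unfolding jump_pmf_def using assms
  by (intro pmf_embed_pmf jump_prob_nonneg nn_integral_jump_prob)

lemma coded_measure_pmf: "coded (measure_pmf (p :: 'a::countable pmf))"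
  using coded_count_space[where 'a='a] unfolding coded_def by (simp cong: measurable_cong_sets)

lemma measurable_nn_integral_countable [measurable (raw)]:
  fixes f :: "'m \<Rightarrow> 'a::countable \<Rightarrow> ennreal"
  assumes "\<And>x. (\<lambda>w. f w x) \<in> borel_measurable M"
  shows "(\<lambda>w. \<integral>\<^sup>+x. f w x \<partial>count_space UNIV) \<in> borel_measurable M"
proof -
  interpret sigma_finite_measure "count_space (UNIV :: 'a set)"
    by (rule sigma_finite_measure_count_space_countable) simp
  have "(\<lambda>p. f (fst p) (snd p)) \<in> borel_measurable (M \<Otimes>\<^sub>M count_space UNIV)"
    by (rule measurable_compose_countable[of "\<lambda>x p. f (fst p) x"])
      (auto intro: measurable_compose[OF measurable_fst assms])
  then show ?thesis by (intro borel_measurable_nn_integral) (simp add: case_prod_beta')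
qed

text \<open>Samplers are chosen separately for each law, without any regularity in the parameter;
  joint measurability holds because the parameter is discrete and countable.\<close>

lemma measurable_sampler_kernel [measurable (raw)]:
  fixes K :: "'a::countable \<Rightarrow> 'b measure"
  assumes "\<And>a. coded (K a)" "\<And>a. prob_space (K a)" "\<And>a. sets (K a) = sets N"
    and a [measurable]: "a \<in> M \<rightarrow>\<^sub>M count_space UNIV" and [measurable]: "u \<in> borel_measurable M"
  shows "(\<lambda>x. sampler (K (a x)) (u x)) \<in> M \<rightarrow>\<^sub>M N"
proof (rule measurable_compose_countable[OF _ a])
  fix i
  have "sampler (K i) \<in> borel \<rightarrow>\<^sub>M N"
    using measurable_sampler[OF assms(1,2), of i] assms(3) by (simp cong: measurable_cong_sets)
  then show "(\<lambda>x. sampler (K i) (u x)) \<in> M \<rightarrow>\<^sub>M N" by (rule measurable_compose[rotated]) measurable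
qed

lemma measurable_sampler_expo [measurable (raw)]:
  fixes a :: "'m \<Rightarrow> 'a::countable"
  assumes "a \<in> M \<rightarrow>\<^sub>M count_space UNIV" "u \<in> borel_measurable M"
  shows "(\<lambda>x. sampler (expo (f (a x))) (u x)) \<in> M \<rightarrow>\<^sub>M borel"
  using measurable_sampler_kernel[of "\<lambda>a. expo (f a)" borel a M u] assms
  by (simp add: coded_expo prob_space_expo)

lemma measurable_sampler_pmf [measurable (raw)]:
  fixes a :: "'m \<Rightarrow> 'a::countable" and f :: "'a \<Rightarrow> 'b::countable pmf"
  assumes "a \<in> M \<rightarrow>\<^sub>M count_space UNIV" "u \<in> borel_measurable M"
  shows "(\<lambda>x. sampler (measure_pmf (f (a x))) (u x)) \<in> M \<rightarrow>\<^sub>M count_space UNIV"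
  using measurable_sampler_kernel[of "\<lambda>a. measure_pmf (f a)" "count_space UNIV" a M u] assms
  by (simp add: coded_measure_pmf prob_space_measure_pmf)

text \<open>One pair of uniform variables per step: the first produces a time, the second a discrete
  choice.\<close>

definition step_noise :: "(real \<times> real) measure" where
  "step_noise = unit_uniform \<Otimes>\<^sub>M unit_uniform"

lemma sets_step_noise [simp]: "sets step_noise = sets (borel \<Otimes>\<^sub>M borel)"
  unfolding step_noise_def by (intro sets_pair_measure_cong) auto

lemma measurable_step_noise [measurable]:
  "fst \<in> borel_measurable step_noise" "snd \<in> borel_measurable step_noise"
  by (simp_all cong: measurable_cong_sets)

lemma prob_space_step_noise: "prob_space step_noise"
proof -
  interpret unit_uniform: prob_space unit_uniform by (rule prob_space_unit_uniform)
  interpret pair_prob_space unit_uniform unit_uniform ..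
  show ?thesis unfolding step_noise_def by unfold_locales
qed

lemma coded_step_noise: "coded step_noise"
  using coded_pair[OF coded_real coded_real] unfolding coded_def
  by (simp add: space_pair_measure sets_eq_imp_space_eq[OF sets_step_noise] cong: measurable_cong_sets)

primcorec jump_sim :: "('s \<Rightarrow> 's \<Rightarrow> real) \<Rightarrow> 's \<Rightarrow> (real \<times> real) stream \<Rightarrow> ('s \<times> ennreal) stream" where
  "shd (jump_sim L x us) = (x, sampler (expo (jump_rate L x)) (fst (shd us)))"
| "stl (jump_sim L x us) = jump_sim L (sampler (measure_pmf (jump_pmf L x)) (snd (shd us))) (stl us)"

lemma measurable_jump_sim [measurable (raw)]:
  fixes x :: "'m \<Rightarrow> 's::countable"
  assumes "x \<in> M \<rightarrow>\<^sub>M count_space UNIV" "us \<in> M \<rightarrow>\<^sub>M stream_space step_noise"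
  shows "(\<lambda>\<omega>. jump_sim L (x \<omega>) (us \<omega>)) \<in> M \<rightarrow>\<^sub>M itinerary_space"
proof -
  define R where "R f \<longleftrightarrow> (\<exists>x \<in> M \<rightarrow>\<^sub>M count_space UNIV. \<exists>us \<in> M \<rightarrow>\<^sub>M stream_space step_noise.
    f = (\<lambda>\<omega>. jump_sim L (x \<omega>) (us \<omega>)))" for f :: "'m \<Rightarrow> ('s \<times> ennreal) stream"
  have "R (\<lambda>\<omega>. jump_sim L (x \<omega>) (us \<omega>))" unfolding R_def using assms by blast
  then show ?thesis
  proof (coinduct rule: measurable_stream_coinduct)
    case (shd f)
    then obtain x us where [measurable]: "x \<in> M \<rightarrow>\<^sub>M count_space UNIV" "us \<in> M \<rightarrow>\<^sub>M stream_space step_noise"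
      and f: "f = (\<lambda>\<omega>. jump_sim L (x \<omega>) (us \<omega>))" unfolding R_def by blast
    show ?case unfolding f jump_sim.sel by (intro measurable_Pair measurable_sampler_expo) measurable
  next
    case (stl f)
    then obtain x us where [measurable]: "x \<in> M \<rightarrow>\<^sub>M count_space UNIV" "us \<in> M \<rightarrow>\<^sub>M stream_space step_noise"
      and f: "f = (\<lambda>\<omega>. jump_sim L (x \<omega>) (us \<omega>))" unfolding R_def by blast
    show ?case unfolding f R_def
      by (intro bexI[of _ "\<lambda>\<omega>. sampler (measure_pmf (jump_pmf L (x \<omega>))) (snd (shd (us \<omega>)))"]
          bexI[of _ "\<lambda>\<omega>. stl (us \<omega>)"]) simp_all
  qed
qed

definition jump_law_at :: "('s::countable \<Rightarrow> 's \<Rightarrow> real) \<Rightarrow> 's \<Rightarrow> ('s \<times> ennreal) stream measure" where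
  "jump_law_at L x = distr (stream_space step_noise) itinerary_space (jump_sim L x)"

definition jump_law :: "('s::countable \<Rightarrow> 's \<Rightarrow> real) \<Rightarrow> 's pmf \<Rightarrow> ('s \<times> ennreal) stream measure" where
  "jump_law L p = measure_pmf p \<bind> jump_law_at L"

lemma sets_jump_law_at [simp, measurable_cong]: "sets (jump_law_at L x) = sets itinerary_space"
  by (simp add: jump_law_at_def)

lemma space_jump_law_at [simp]: "space (jump_law_at L x) = UNIV"
  by (simp add: jump_law_at_def)

lemma prob_space_jump_law_at: "prob_space (jump_law_at L x)"
  unfolding jump_law_at_def
  by (intro prob_space.prob_space_distr prob_space.prob_space_stream_space prob_space_step_noise) simp

lemma measurable_jump_law_at: "jump_law_at L \<in> measure_pmf p \<rightarrow>\<^sub>M subprob_algebra itinerary_space"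
  by (auto simp: space_subprob_algebra intro!: prob_space_imp_subprob_space prob_space_jump_law_at)

lemma sets_jump_law [simp, measurable_cong]: "sets (jump_law L p) = sets itinerary_space"
  unfolding jump_law_def by (subst sets_bind) auto

lemma space_jump_law [simp]: "space (jump_law L p) = UNIV"
  using sets_eq_imp_space_eq[OF sets_jump_law] by simp

lemma prob_space_jump_law: "prob_space (jump_law L p)"
  unfolding jump_law_def
  by (rule prob_space.prob_space_bind[OF prob_space_measure_pmf _ measurable_jump_law_at])
    (simp add: prob_space_jump_law_at)

lemma nn_integral_jump_law:
  assumes "F \<in> borel_measurable itinerary_space"
  shows "(\<integral>\<^sup>+d. F d \<partial>jump_law L p) = (\<integral>\<^sup>+x. \<integral>\<^sup>+d. F d \<partial>jump_law_at L x \<partial>measure_pmf p)"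
  unfolding jump_law_def by (rule nn_integral_bind[OF assms measurable_jump_law_at])

text \<open>The Markov property at the first jump, obtained by splitting off the first noise pair.
  All later computations with the law of X reduce to this recursion.\<close>

lemma nn_integral_jump_law_at:
  assumes [measurable]: "F \<in> borel_measurable itinerary_space"
  shows "(\<integral>\<^sup>+d. F d \<partial>jump_law_at L x)
    = (\<integral>\<^sup>+w. \<integral>\<^sup>+x'. \<integral>\<^sup>+d. F ((x, w) ## d) \<partial>jump_law_at L x' \<partial>measure_pmf (jump_pmf L x) \<partial>expo (jump_rate L x))"
proof -
  interpret step_noise: prob_space step_noise by (rule prob_space_step_noise)
  interpret unit_uniform: prob_space unit_uniform by (rule prob_space_unit_uniform)
  interpret S: prob_space "stream_space step_noise" by (rule step_noise.prob_space_stream_space)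
  interpret U: pair_prob_space unit_uniform unit_uniform ..
  let ?G = "\<lambda>w x'. \<integral>\<^sup>+d. F ((x, w) ## d) \<partial>jump_law_at L x'"
  have G: "?G w x' = (\<integral>\<^sup>+us. F ((x, w) ## jump_sim L x' us) \<partial>stream_space step_noise)" for w x'
    unfolding jump_law_at_def by (subst nn_integral_distr) auto
  have [measurable]: "(\<lambda>w. ?G w x') \<in> borel_measurable borel" for x'
    unfolding G by measurable
  have "(\<integral>\<^sup>+d. F d \<partial>jump_law_at L x) = (\<integral>\<^sup>+us. F (jump_sim L x us) \<partial>stream_space step_noise)"
    unfolding jump_law_at_def by (subst nn_integral_distr) auto
  also have "\<dots> = (\<integral>\<^sup>+u. \<integral>\<^sup>+us. F (jump_sim L x (u ## us)) \<partial>stream_space step_noise \<partial>step_noise)"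
    by (subst step_noise.nn_integral_stream_space) auto
  also have "\<dots> = (\<integral>\<^sup>+u. ?G (sampler (expo (jump_rate L x)) (fst u)) (sampler (measure_pmf (jump_pmf L x)) (snd u)) \<partial>step_noise)"
    unfolding G by (intro nn_integral_cong) (subst jump_sim.ctr, simp)
  also have "\<dots> = (\<integral>\<^sup>+u. \<integral>\<^sup>+v. ?G (sampler (expo (jump_rate L x)) u) (sampler (measure_pmf (jump_pmf L x)) v) \<partial>unit_uniform \<partial>unit_uniform)"
    unfolding step_noise_def unfolding G by (subst unit_uniform.nn_integral_fst[symmetric]) auto
  also have "\<dots> = (\<integral>\<^sup>+u. \<integral>\<^sup>+x'. ?G (sampler (expo (jump_rate L x)) u) x' \<partial>measure_pmf (jump_pmf L x) \<partial>unit_uniform)"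
    by (intro nn_integral_cong nn_integral_sampler coded_measure_pmf prob_space_measure_pmf) simp
  also have "\<dots> = (\<integral>\<^sup>+w. \<integral>\<^sup>+x'. ?G w x' \<partial>measure_pmf (jump_pmf L x) \<partial>expo (jump_rate L x))"
    by (rule nn_integral_sampler[OF coded_expo prob_space_expo]) measurable
  finally show ?thesis .
qed

lemma measurable_nn_integral_jump_law_at [measurable (raw)]:
  assumes [measurable]: "(\<lambda>(w, d). F w d) \<in> borel_measurable (M \<Otimes>\<^sub>M itinerary_space)"
  shows "(\<lambda>w. \<integral>\<^sup>+d. F w d \<partial>jump_law_at L x) \<in> borel_measurable M"
proof -
  interpret prob_space "jump_law_at L x" by (rule prob_space_jump_law_at)
  show ?thesis by measurable
qed

lemma AE_jump_law_iff:
  assumes "Measurable.pred itinerary_space P"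
  shows "(AE d in jump_law L p. P d) \<longleftrightarrow> (\<forall>x\<in>set_pmf p. AE d in jump_law_at L x. P d)"
  unfolding jump_law_def using assms
  by (subst AE_bind[OF measurable_jump_law_at]) (auto simp: AE_measure_pmf_iff)

lemma AE_jump_law_at_iff:
  assumes [measurable]: "Measurable.pred itinerary_space P"
  shows "(AE d in jump_law_at L x. P d) \<longleftrightarrow>
    (AE w in expo (jump_rate L x). \<forall>x'\<in>set_pmf (jump_pmf L x). AE d in jump_law_at L x'. P ((x, w) ## d))"
proof -
  have "(AE d in jump_law_at L x. P d) \<longleftrightarrow> (\<integral>\<^sup>+d. indicator {d. \<not> P d} d \<partial>jump_law_at L x) = 0"
    by (subst nn_integral_0_iff_AE) (auto simp: indicator_def)
  also have "\<dots> \<longleftrightarrow> (\<integral>\<^sup>+w. \<integral>\<^sup>+x'. \<integral>\<^sup>+d. indicator {d. \<not> P d} ((x, w) ## d) \<partial>jump_law_at L x'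
      \<partial>measure_pmf (jump_pmf L x) \<partial>expo (jump_rate L x)) = 0"
    by (subst nn_integral_jump_law_at) auto
  also have "\<dots> \<longleftrightarrow> (AE w in expo (jump_rate L x). \<forall>x'\<in>set_pmf (jump_pmf L x).
      (\<integral>\<^sup>+d. indicator {d. \<not> P d} ((x, w) ## d) \<partial>jump_law_at L x') = 0)"
    by (subst nn_integral_0_iff_AE, measurable)
      (subst nn_integral_0_iff_AE, simp, simp add: AE_measure_pmf_iff)
  also have "\<dots> \<longleftrightarrow> (AE w in expo (jump_rate L x). \<forall>x'\<in>set_pmf (jump_pmf L x).
      AE d in jump_law_at L x'. P ((x, w) ## d))"
    by (subst nn_integral_0_iff_AE) (auto simp: indicator_def)
  finally show ?thesis .
qed

lemma AE_jump_law_sdrop: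
  assumes [measurable]: "Measurable.pred itinerary_space P"
    and "\<And>x. AE d in jump_law_at L x. P d"
  shows "AE d in jump_law_at L x. P (sdrop n d)"
proof (induction n arbitrary: x)
  case (Suc n)
  then show ?case by (subst AE_jump_law_at_iff) auto
qed (use assms in simp)

text \<open>The events whose probabilities \<open>jump_hold\<close> prescribes.\<close>

definition cylinder :: "nat \<Rightarrow> (nat \<Rightarrow> 's) \<Rightarrow> (nat \<Rightarrow> real) \<Rightarrow> ('s \<times> ennreal) stream set" where
  "cylinder n y t = {d. \<forall>k\<le>n. fst (d !! k) = y k \<and> ennreal (t k) < snd (d !! k)}"

lemma sets_cylinder [measurable]: "cylinder n (y :: nat \<Rightarrow> 's::countable) t \<in> sets itinerary_space"
proof -
  have "{d \<in> space itinerary_space. \<forall>k\<le>n. fst (d !! k) = y k \<and> ennreal (t k) < snd (d !! k)} \<in> sets itinerary_space"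
    by measurable
  then show ?thesis by (simp add: cylinder_def)
qed

lemma Stream_in_cylinder_Suc:
  "(x, w) ## d \<in> cylinder (Suc n) y t \<longleftrightarrow>
    x = y 0 \<and> ennreal (t 0) < w \<and> d \<in> cylinder n (\<lambda>k. y (Suc k)) (\<lambda>k. t (Suc k))"
  unfolding cylinder_def by (auto simp: All_less_Suc2 less_Suc_eq_le[symmetric])

lemma emeasure_jump_law_at_cylinder:
  fixes L :: "'s::countable \<Rightarrow> 's \<Rightarrow> real"
  assumes L: "generator L" and "\<forall>k\<le>n. 0 \<le> t k"
  shows "emeasure (jump_law_at L x) (cylinder n y t) = ennreal (indicat_real {y 0} x *
    (\<Prod>k<n. jump_prob L (y k) (y (Suc k))) * (\<Prod>k\<le>n. exp (- (jump_rate L (y k) * t k))))"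
  using assms(2)
proof (induction n arbitrary: x y t)
  case 0
  have "emeasure (jump_law_at L x) (cylinder 0 y t) =
      (\<integral>\<^sup>+w. \<integral>\<^sup>+x'. \<integral>\<^sup>+d. indicator (cylinder 0 y t) ((x, w) ## d) \<partial>jump_law_at L x'
        \<partial>measure_pmf (jump_pmf L x) \<partial>expo (jump_rate L x))"
    by (subst nn_integral_jump_law_at[symmetric]) auto
  also have "\<dots> = (\<integral>\<^sup>+w. indicator {y 0} x * indicator {ennreal (t 0)<..} w \<partial>expo (jump_rate L x))"
  proof (intro nn_integral_cong)
    fix w
    have "(\<integral>\<^sup>+d. indicator (cylinder 0 y t) ((x, w) ## d) \<partial>jump_law_at L x')
      = indicator {y 0} x * indicator {ennreal (t 0)<..} w" for x'
    proof -
      have "indicator (cylinder 0 y t) ((x, w) ## d) = (indicator {y 0} x * indicator {ennreal (t 0)<..} w :: ennreal)" for d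
        by (auto simp: cylinder_def indicator_def)
      then show ?thesis
        using prob_space.emeasure_space_1[OF prob_space_jump_law_at, of L x'] by simp
    qed
    then show "(\<integral>\<^sup>+x'. \<integral>\<^sup>+d. indicator (cylinder 0 y t) ((x, w) ## d) \<partial>jump_law_at L x' \<partial>measure_pmf (jump_pmf L x))
      = indicator {y 0} x * indicator {ennreal (t 0)<..} w"
      using prob_space.emeasure_space_1[OF prob_space_measure_pmf, of "jump_pmf L x"] by simp
  qed
  also have "\<dots> = indicator {y 0} x * ennreal (exp (- (jump_rate L x * t 0)))"
    using 0 jump_rate_nonneg[OF L] by (simp add: nn_integral_cmult emeasure_expo_greater)
  finally show ?case by (auto simp: indicator_def)
next
  case (Suc n)
  let ?v = "(\<Prod>k<n. jump_prob L (y (Suc k)) (y (Suc (Suc k)))) * (\<Prod>k\<le>n. exp (- (jump_rate L (y (Suc k)) * t (Suc k))))"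
  have v: "0 \<le> ?v" by (intro mult_nonneg_nonneg prod_nonneg ballI jump_prob_nonneg L) auto
  have "emeasure (jump_law_at L x) (cylinder (Suc n) y t) =
      (\<integral>\<^sup>+w. \<integral>\<^sup>+x'. \<integral>\<^sup>+d. indicator (cylinder (Suc n) y t) ((x, w) ## d) \<partial>jump_law_at L x'
        \<partial>measure_pmf (jump_pmf L x) \<partial>expo (jump_rate L x))"
    by (subst nn_integral_jump_law_at[symmetric]) auto
  also have "\<dots> = (\<integral>\<^sup>+w. indicator {y 0} x * indicator {ennreal (t 0)<..} w *
      ennreal (jump_prob L x (y 1) * ?v) \<partial>expo (jump_rate L x))"
  proof (intro nn_integral_cong)
    fix w
    have "(\<integral>\<^sup>+d. indicator (cylinder (Suc n) y t) ((x, w) ## d) \<partial>jump_law_at L x')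
      = indicator {y 0} x * indicator {ennreal (t 0)<..} w * (ennreal ?v * indicator {y 1} x')" for x'
    proof -
      have "(\<integral>\<^sup>+d. indicator (cylinder (Suc n) y t) ((x, w) ## d) \<partial>jump_law_at L x')
        = (\<integral>\<^sup>+d. indicator {y 0} x * indicator {ennreal (t 0)<..} w *
            indicator (cylinder n (\<lambda>k. y (Suc k)) (\<lambda>k. t (Suc k))) d \<partial>jump_law_at L x')"
        by (intro nn_integral_cong) (auto simp: Stream_in_cylinder_Suc indicator_def)
      also have "\<dots> = indicator {y 0} x * indicator {ennreal (t 0)<..} w *
          emeasure (jump_law_at L x') (cylinder n (\<lambda>k. y (Suc k)) (\<lambda>k. t (Suc k)))"
        by (simp add: nn_integral_cmult)
      also have "emeasure (jump_law_at L x') (cylinder n (\<lambda>k. y (Suc k)) (\<lambda>k. t (Suc k)))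
          = ennreal ?v * indicator {y 1} x'"
        using Suc.prems by (subst Suc.IH) (auto simp: indicator_def)
      finally show ?thesis .
    qed
    then have "(\<integral>\<^sup>+x'. \<integral>\<^sup>+d. indicator (cylinder (Suc n) y t) ((x, w) ## d) \<partial>jump_law_at L x' \<partial>measure_pmf (jump_pmf L x))
      = indicator {y 0} x * indicator {ennreal (t 0)<..} w * (ennreal ?v * emeasure (measure_pmf (jump_pmf L x)) {y 1})"
      by (simp add: nn_integral_cmult)
    also have "emeasure (measure_pmf (jump_pmf L x)) {y 1} = ennreal (jump_prob L x (y 1))"
      by (simp add: emeasure_pmf_single pmf_jump_pmf[OF L])
    also have "ennreal ?v * ennreal (jump_prob L x (y 1)) = ennreal (jump_prob L x (y 1) * ?v)"
      using v jump_prob_nonneg[OF L] by (simp add: ennreal_mult mult.commute)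
    finally show "(\<integral>\<^sup>+x'. \<integral>\<^sup>+d. indicator (cylinder (Suc n) y t) ((x, w) ## d) \<partial>jump_law_at L x' \<partial>measure_pmf (jump_pmf L x))
      = indicator {y 0} x * indicator {ennreal (t 0)<..} w * ennreal (jump_prob L x (y 1) * ?v)" .
  qed
  also have "\<dots> = indicator {y 0} x * ennreal (exp (- (jump_rate L x * t 0))) * ennreal (jump_prob L x (y 1) * ?v)"
    using Suc.prems jump_rate_nonneg[OF L] by (simp add: nn_integral_cmult nn_integral_multc emeasure_expo_greater)
  also have "\<dots> = ennreal (indicat_real {y 0} x *
    (\<Prod>k<Suc n. jump_prob L (y k) (y (Suc k))) * (\<Prod>k\<le>Suc n. exp (- (jump_rate L (y k) * t k))))"
  proof (cases "x = y 0")
    case True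
    have "(\<Prod>k<Suc n. jump_prob L (y k) (y (Suc k))) * (\<Prod>k\<le>Suc n. exp (- (jump_rate L (y k) * t k)))
      = exp (- (jump_rate L x * t 0)) * (jump_prob L x (y 1) * ?v)"
      unfolding prod.lessThan_Suc_shift prod.atMost_Suc_shift using True by (simp add: mult_ac)
    then show ?thesis using True by (simp add: ennreal_mult'[symmetric] del: prod.lessThan_Suc prod.atMost_Suc)
  qed simp
  finally show ?case .
qed

lemma emeasure_jump_law_cylinder:
  fixes L :: "'s::countable \<Rightarrow> 's \<Rightarrow> real"
  assumes L: "generator L" and t: "\<forall>k\<le>n. 0 \<le> t k"
  shows "emeasure (jump_law L p) (cylinder n y t) = ennreal (pmf p (y 0) *
    (\<Prod>k<n. jump_prob L (y k) (y (Suc k))) * (\<Prod>k\<le>n. exp (- (jump_rate L (y k) * t k))))"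
proof -
  let ?v = "(\<Prod>k<n. jump_prob L (y k) (y (Suc k))) * (\<Prod>k\<le>n. exp (- (jump_rate L (y k) * t k)))"
  have v: "0 \<le> ?v" by (intro mult_nonneg_nonneg prod_nonneg ballI jump_prob_nonneg L) auto
  have "emeasure (jump_law L p) (cylinder n y t) = (\<integral>\<^sup>+x. emeasure (jump_law_at L x) (cylinder n y t) \<partial>measure_pmf p)"
    using nn_integral_jump_law[of "indicator (cylinder n y t)" L p] by simp
  also have "\<dots> = (\<integral>\<^sup>+x. ennreal ?v * indicator {y 0} x \<partial>measure_pmf p)"
    by (intro nn_integral_cong) (auto simp: emeasure_jump_law_at_cylinder[OF L t] indicator_def)
  also have "\<dots> = ennreal ?v * ennreal (pmf p (y 0))"
    by (simp add: nn_integral_cmult emeasure_pmf_single)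
  finally show ?thesis using v by (simp add: ennreal_mult[symmetric] mult_ac)
qed

text \<open>The almost sure properties that make an itinerary a function of its path: no visit has
  length 0, no jump leads back to the same state, and after an infinite holding time the same entry
  is repeated forever, since the path carries no information beyond it.\<close>

definition proper_step :: "('s \<times> ennreal) stream \<Rightarrow> bool" where
  "proper_step d \<longleftrightarrow> 0 < snd (shd d) \<and>
    (if snd (shd d) = \<infinity> then shd (stl d) = shd d else fst (shd (stl d)) \<noteq> fst (shd d))"

lemma measurable_proper_step [measurable]:
  "Measurable.pred (itinerary_space :: ('s::countable \<times> ennreal) stream measure) proper_step"
proof -
  have e: "proper_step = (\<lambda>d :: ('s \<times> ennreal) stream. 0 < snd (shd d) \<and>
    (if snd (shd d) = \<infinity> then fst (shd (stl d)) = fst (shd d) \<and> snd (shd (stl d)) = snd (shd d)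
     else fst (shd (stl d)) \<noteq> fst (shd d)))"
    by (auto simp: proper_step_def fun_eq_iff prod_eq_iff)
  show ?thesis by (subst e) measurable
qed

lemma AE_jump_law_at_shd:
  fixes L :: "'s::countable \<Rightarrow> 's \<Rightarrow> real"
  shows "AE d in jump_law_at L x. fst (shd d) = x"
  by (subst AE_jump_law_at_iff) auto

lemma set_pmf_jump_pmf:
  fixes L :: "'s::countable \<Rightarrow> 's \<Rightarrow> real"
  assumes "generator L" "x' \<in> set_pmf (jump_pmf L x)"
  shows "(x' = x) \<longleftrightarrow> jump_rate L x = 0"
  using assms by (auto simp: set_pmf_iff pmf_jump_pmf jump_prob_def split: if_splits)

lemma AE_jump_law_at_proper_step:
  fixes L :: "'s::countable \<Rightarrow> 's \<Rightarrow> real"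
  assumes "generator L"
  shows "AE d in jump_law_at L x. proper_step d"
proof (subst AE_jump_law_at_iff)
  show "AE w in expo (jump_rate L x). \<forall>x'\<in>set_pmf (jump_pmf L x). AE d in jump_law_at L x'. proper_step ((x, w) ## d)"
  proof (cases "jump_rate L x = 0")
    case True
    then have s: "set_pmf (jump_pmf L x) \<subseteq> {x}" using set_pmf_jump_pmf[OF assms] by auto
    have AE_inf: "AE w in expo (jump_rate L x). w = \<infinity>"
      unfolding True expo_0 by (subst AE_return) auto
    \<comment> \<open>The entry that follows is drawn from this same law, so it repeats the pair of
      \<open>x\<close> and \<open>\<infinity>\<close>, as \<open>proper_step\<close>
      demands.\<close>
    have "AE d in jump_law_at L x. shd d = (x, \<infinity>)"
    proof (subst AE_jump_law_at_iff)
      show "AE w in expo (jump_rate L x). \<forall>x'\<in>set_pmf (jump_pmf L x). AE d in jump_law_at L x'. shd ((x, w) ## d) = (x, \<infinity>)"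
        using AE_inf by eventually_elim simp
      have "Measurable.pred (itinerary_space :: ('s \<times> ennreal) stream measure) (\<lambda>d. fst (shd d) = x \<and> snd (shd d) = \<infinity>)"
        by measurable
      then show "Measurable.pred itinerary_space (\<lambda>d. shd d = (x, \<infinity>))"
        by (simp add: prod_eq_iff)
    qed
    then have "\<forall>x'\<in>set_pmf (jump_pmf L x). AE d in jump_law_at L x'. proper_step ((x, \<infinity>) ## d)"
      using s by (auto simp: proper_step_def elim!: eventually_mono)
    then show ?thesis using AE_inf by (auto elim!: eventually_mono)
  next
    case False
    then have "0 < jump_rate L x" using jump_rate_nonneg[OF assms, of x] by simp
    from AE_expo_finite[OF this] AE_expo_pos show ?thesis
    proof eventually_elim
      case (elim w)
      show ?case
      proof
        fix x' assume "x' \<in> set_pmf (jump_pmf L x)"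
        then have "x' \<noteq> x" using set_pmf_jump_pmf[OF assms] False by auto
        then show "AE d in jump_law_at L x'. proper_step ((x, w) ## d)"
          using AE_jump_law_at_shd[where x = x' and L = L] elim by (auto simp: proper_step_def elim!: eventually_mono)
      qed
    qed
  qed
qed measurable

lemma AE_jump_law_proper_step:
  fixes L :: "'s::countable \<Rightarrow> 's \<Rightarrow> real"
  assumes "generator L"
  shows "AE d in jump_law L p. \<forall>n. proper_step (sdrop n d)"
  using AE_jump_law_sdrop[OF _ AE_jump_law_at_proper_step[OF assms]]
  by (subst AE_jump_law_iff) (auto simp: AE_all_countable)

section \<open>Uniqueness of the law with given cylinder probabilities\<close>

text \<open>A threshold \<open>t k < 0\<close> imposes no condition on the \<open>k\<close>-th holding time, not even positivity;
  unlike \<^const>\<open>cylinder\<close>, these sets generate the \<open>\<sigma>\<close>-algebra.\<close>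

definition weak_cylinder :: "nat \<Rightarrow> (nat \<Rightarrow> 's) \<Rightarrow> (nat \<Rightarrow> real) \<Rightarrow> ('s \<times> ennreal) stream set" where
  "weak_cylinder n y t = {d. \<forall>k\<le>n. fst (d !! k) = y k \<and> (t k < 0 \<or> ennreal (t k) < snd (d !! k))}"

text \<open>Intersection stability, for the uniqueness theorem on generators. Either two prescribed
  states conflict, or the longer list of conditions takes over beyond the common indices and
  thresholds combine by \<open>max\<close>, a negative threshold being neutral.\<close>

lemma weak_cylinder_Int:
  "weak_cylinder n y t \<inter> weak_cylinder m z s = {} \<or>
   weak_cylinder n y t \<inter> weak_cylinder m z s = weak_cylinder (max n m) (\<lambda>k. if k \<le> n then y k else z k)
     (\<lambda>k. if k \<le> n \<and> k \<le> m then max (t k) (s k) else if k \<le> n then t k else s k)"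
proof (cases "\<forall>k\<le>min n m. y k = z k")
  case True
  define ok where "ok a w \<longleftrightarrow> a < 0 \<or> ennreal a < w" for a w
  have W: "d \<in> weak_cylinder n y t \<longleftrightarrow> (\<forall>k\<le>n. fst (d !! k) = y k \<and> ok (t k) (snd (d !! k)))"
    for d n t and y :: "nat \<Rightarrow> 'a"
    by (simp add: weak_cylinder_def ok_def)
  have "ok (max a b) w \<longleftrightarrow> ok a w \<and> ok b w" for a b w
  proof (cases "a \<le> b")
    case True
    then have "max a b = b" "ennreal a \<le> ennreal b" by (auto intro: ennreal_leI)
    then show ?thesis using True by (auto simp: ok_def dest: le_less_trans)
  next
    case False
    then have "max a b = a" "ennreal b \<le> ennreal a" by (auto intro: ennreal_leI)
    then show ?thesis using False by (auto simp: ok_def dest: le_less_trans)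
  qed
  then show ?thesis using True
    by (intro disjI2 set_eqI) (auto simp: W le_max_iff_disj)
next
  case False
  then obtain k where "k \<le> n" "k \<le> m" "y k \<noteq> z k" by auto
  then show ?thesis by (intro disjI1) (force simp: weak_cylinder_def)
qed

lemma sets_weak_cylinder [measurable]:
  "weak_cylinder n (y :: nat \<Rightarrow> 's::countable) t \<in> sets itinerary_space"
proof -
  have "{d \<in> space itinerary_space. \<forall>k\<le>n. fst (d !! k) = y k \<and> (t k < 0 \<or> ennreal (t k) < snd (d !! k))} \<in> sets itinerary_space"
    by measurable
  then show ?thesis by (simp add: weak_cylinder_def)
qed

lemma UN_weak_cylinder:
  "{d :: ('s \<times> ennreal) stream. P (fst (d !! n)) \<and> (\<forall>k\<le>n. t k < 0 \<or> ennreal (t k) < snd (d !! k))}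
    = (\<Union>ys\<in>{ys. length ys = Suc n \<and> P (ys ! n)}. weak_cylinder n (\<lambda>k. ys ! k) t)"
proof (intro set_eqI iffI)
  fix d :: "('s \<times> ennreal) stream"
  assume "d \<in> {d. P (fst (d !! n)) \<and> (\<forall>k\<le>n. t k < 0 \<or> ennreal (t k) < snd (d !! k))}"
  then show "d \<in> (\<Union>ys\<in>{ys. length ys = Suc n \<and> P (ys ! n)}. weak_cylinder n (\<lambda>k. ys ! k) t)"
    by (intro UN_I[of "map fst (stake (Suc n) d)"]) (auto simp: weak_cylinder_def less_Suc_eq_le simp del: stake.simps)
qed (auto simp: weak_cylinder_def)

lemma sets_itinerary_space_weak_cylinder:
  "sets (itinerary_space :: ('s::countable \<times> ennreal) stream measure)
    = sigma_sets UNIV (insert {} (range (\<lambda>(n, y, t). weak_cylinder n y t)))" (is "_ = sigma_sets UNIV ?G")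
proof (rule antisym)
  let ?S = "sigma UNIV ?G :: ('s \<times> ennreal) stream measure"
  have W: "weak_cylinder n y t \<in> sets ?S" for n t and y :: "nat \<Rightarrow> 's"
    by (auto intro!: image_eqI[of _ _ "(n, y, t)"])
  have C: "{d. P (fst (d !! n)) \<and> (\<forall>k\<le>n. t k < 0 \<or> ennreal (t k) < snd (d !! k))} \<in> sets ?S" for P n t
    unfolding UN_weak_cylinder by (intro sets.countable_UN' W) auto
  have "sets itinerary_space \<subseteq> sets ?S"
  proof (rule sets_stream_space_in_sets)
    fix i
    have "(\<lambda>d. fst (d !! i)) \<in> ?S \<rightarrow>\<^sub>M count_space UNIV"
    proof (rule measurable_count_space_eq2_countable[THEN iffD2], safe)
      fix a
      show "(\<lambda>d. fst (d !! i)) -` {a} \<inter> space ?S \<in> sets ?S"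
        using C[of "\<lambda>b. b = a" i "\<lambda>_. -1"] by (simp add: vimage_def)
    qed auto
    moreover have "(\<lambda>d. snd (d !! i)) \<in> borel_measurable ?S"
    proof (rule borel_measurableI_greater)
      fix c :: ennreal
      show "{d \<in> space ?S. c < snd (d !! i)} \<in> sets ?S"
      proof (cases c)
        case (real r)
        have "{d :: ('s \<times> ennreal) stream. c < snd (d !! i)} =
          {d. True \<and> (\<forall>k\<le>i. (if k = i then r else -1) < 0 \<or> ennreal (if k = i then r else -1) < snd (d !! k))}"
          using real by auto
        then show ?thesis using C[of "\<lambda>_. True" i "\<lambda>k. if k = i then r else -1"] by simp
      qed simp
    qed
    ultimately show "(\<lambda>d. d !! i) \<in> ?S \<rightarrow>\<^sub>M count_space UNIV \<Otimes>\<^sub>M borel"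
      by (subst measurable_pair_iff) (simp add: comp_def)
  qed (simp add: space_pair_measure)
  then show "sets itinerary_space \<subseteq> sigma_sets UNIV ?G" by simp
  show "sigma_sets UNIV ?G \<subseteq> sets itinerary_space"
  proof -
    have "?G \<subseteq> sets itinerary_space" by (auto intro: sets_weak_cylinder)
    from sets.sigma_sets_subset[OF this] show ?thesis by simp
  qed
qed

text \<open>Strict cylinders do not see itineraries with a vanishing holding time. Summing those
  with thresholds 0 over all lists of states shows that \<open>P\<close>, like \<open>Q\<close>,
  gives mass 1 to positive holding times; on these, weak and strict cylinders coincide and the
  \<pi>-system argument applies.\<close>

lemma itinerary_measure_eqI:
  fixes P Q :: "('s::countable \<times> ennreal) stream measure"
  assumes "prob_space P" and [measurable_cong]: "sets P = sets itinerary_space"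
    and "prob_space Q" and [measurable_cong]: "sets Q = sets itinerary_space"
    and pos: "AE d in Q. \<forall>k. 0 < snd (d !! k)"
    and eq: "\<And>n y t. (\<And>k. 0 \<le> t k) \<Longrightarrow> emeasure P (cylinder n y t) = emeasure Q (cylinder n y t)"
  shows "P = Q"
proof -
  interpret P: prob_space P by fact
  interpret Q: prob_space Q by fact
  have sp: "space P = UNIV" "space Q = UNIV"
    using sets_eq_imp_space_eq[OF assms(2)] sets_eq_imp_space_eq[OF assms(4)] by auto
  have "AE d in P. \<forall>k\<le>n. 0 < snd (d !! k)" for n
  proof -
    let ?I = "{ys :: 's list. length ys = Suc n}" and ?C = "\<lambda>ys :: 's list. cylinder n (\<lambda>k. ys ! k) (\<lambda>_. 0)"
    have U: "{d. \<forall>k\<le>n. 0 < snd (d !! k)} = (\<Union>ys\<in>?I. ?C ys)"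
    proof (intro set_eqI iffI)
      fix d :: "('s \<times> ennreal) stream" assume "d \<in> {d. \<forall>k\<le>n. 0 < snd (d !! k)}"
      then show "d \<in> (\<Union>ys\<in>?I. ?C ys)"
        by (intro UN_I[of "map fst (stake (Suc n) d)"]) (auto simp: cylinder_def less_Suc_eq_le simp del: stake.simps)
    qed (auto simp: cylinder_def)
    have disj: "disjoint_family_on ?C ?I"
      by (auto simp: disjoint_family_on_def cylinder_def list_eq_iff_nth_eq less_Suc_eq_le)
    have "emeasure P {d. \<forall>k\<le>n. 0 < snd (d !! k)} = (\<integral>\<^sup>+ys. emeasure P (?C ys) \<partial>count_space ?I)"
      unfolding U by (rule emeasure_UN_countable) (auto simp: disj)
    also have "\<dots> = (\<integral>\<^sup>+ys. emeasure Q (?C ys) \<partial>count_space ?I)"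
      by (intro nn_integral_cong eq) simp
    also have "\<dots> = emeasure Q {d. \<forall>k\<le>n. 0 < snd (d !! k)}"
      unfolding U by (rule emeasure_UN_countable[symmetric]) (auto simp: disj)
    also have "\<dots> = 1"
    proof (rule Q.emeasure_eq_1_AE)
      show "AE d in Q. d \<in> {d. \<forall>k\<le>n. 0 < snd (d !! k)}" using pos by (auto elim!: eventually_mono)
      have "{d \<in> space itinerary_space. \<forall>k\<le>n. 0 < snd (d !! k)} \<in> sets (itinerary_space :: ('s \<times> ennreal) stream measure)" by measurable
      then show "{d. \<forall>k\<le>n. 0 < snd (d !! k)} \<in> Q.events" by (simp add: assms(4))
    qed
    finally have "P.prob {d. \<forall>k\<le>n. 0 < snd (d !! k)} = 1" by (simp add: measure_def)
    then have "AE d in P. d \<in> {d. \<forall>k\<le>n. 0 < snd (d !! k)}" by (rule P.AE_prob_1)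
    then show ?thesis by simp
  qed
  then have "AE d in P. \<forall>n. \<forall>k\<le>n. 0 < snd (d !! k)" by (simp add: AE_all_countable)
  then have posP: "AE d in P. \<forall>k. 0 < snd (d !! k)" by eventually_elim blast
  have G: "weak_cylinder n y t \<in> insert {} (range (\<lambda>(n, y, t). weak_cylinder n y t))" for n t and y :: "nat \<Rightarrow> 's"
    by (rule insertI2, rule image_eqI[of _ _ "(n, y, t)"]) auto
  show ?thesis
  proof (rule measure_eqI_generator_eq)
    let ?G = "insert {} (range (\<lambda>(n, y, t). weak_cylinder n y t)) :: ('s \<times> ennreal) stream set set"
    show "Int_stable ?G"
    proof (rule Int_stableI)
      fix a b assume "a \<in> ?G" "b \<in> ?G"
      then consider "a \<inter> b = {}" | n y t m z s where "a = weak_cylinder n y t" "b = weak_cylinder m z s"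
        by auto
      then show "a \<inter> b \<in> ?G"
      proof cases
        case 2
        show ?thesis
          using weak_cylinder_Int[of n y t m z s] unfolding 2
          by (elim disjE) (simp, simp only: G)
      qed simp
    qed
    show "?G \<subseteq> Pow UNIV" by simp
    show "emeasure P X = emeasure Q X" if "X \<in> ?G" for X
    proof -
      from that consider "X = {}" | n y t where "X = weak_cylinder n y t" by auto
      then show ?thesis
      proof cases
        case 2
        have e: "d \<in> weak_cylinder n y t \<longleftrightarrow> d \<in> cylinder n y (\<lambda>k. max 0 (t k))"
          if "\<forall>k. 0 < snd (d !! k)" for d :: "('s \<times> ennreal) stream"
          using that by (auto simp: weak_cylinder_def cylinder_def max_def)
        have "emeasure P X = emeasure P (cylinder n y (\<lambda>k. max 0 (t k)))"
          unfolding 2 using posP e by (intro emeasure_eq_AE) (auto elim!: eventually_mono)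
        also have "\<dots> = emeasure Q (cylinder n y (\<lambda>k. max 0 (t k)))" by (rule eq) simp
        also have "\<dots> = emeasure Q X"
          unfolding 2 using pos e by (intro emeasure_eq_AE) (auto elim!: eventually_mono)
        finally show ?thesis .
      qed simp
    qed
    show "sets P = sigma_sets UNIV ?G" "sets Q = sigma_sets UNIV ?G"
      using assms(2,4) sets_itinerary_space_weak_cylinder by simp_all
    show "range (\<lambda>i. weak_cylinder 0 (\<lambda>_. from_nat i :: 's) (\<lambda>_. -1)) \<subseteq> ?G"
      using G by blast
    show "(\<Union>i. weak_cylinder 0 (\<lambda>_. from_nat i :: 's) (\<lambda>_. -1)) = UNIV"
    proof (rule UNIV_eq_I[symmetric], rule UN_I)
      fix d :: "('s \<times> ennreal) stream"
      show "d \<in> weak_cylinder 0 (\<lambda>_. from_nat (to_nat (fst (shd d)))) (\<lambda>_. -1)"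
        by (simp add: weak_cylinder_def)
    qed simp
  qed simp
qed

lemma distr_jump_hold:
  fixes L :: "'s::countable \<Rightarrow> 's \<Rightarrow> real"
  assumes "generator L" "prob_space M" "jump_hold M L \<mu> Y W"
  shows "(\<lambda>\<omega>. smap (\<lambda>n. (Y n \<omega>, W n \<omega>)) nats) \<in> M \<rightarrow>\<^sub>M itinerary_space"
    and "distr M itinerary_space (\<lambda>\<omega>. smap (\<lambda>n. (Y n \<omega>, W n \<omega>)) nats) = jump_law L \<mu>"
proof -
  let ?D = "\<lambda>\<omega>. smap (\<lambda>n. (Y n \<omega>, W n \<omega>)) nats"
  have [measurable]: "\<And>n. Y n \<in> M \<rightarrow>\<^sub>M count_space UNIV" "\<And>n. W n \<in> borel_measurable M"
    using assms(3) unfolding jump_hold_def by auto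
  show D [measurable]: "?D \<in> M \<rightarrow>\<^sub>M itinerary_space"
    by (rule measurable_stream_space2) simp
  interpret M: prob_space M by fact
  show "distr M itinerary_space ?D = jump_law L \<mu>"
  proof (rule itinerary_measure_eqI)
    show "prob_space (distr M itinerary_space ?D)" by (rule M.prob_space_distr) measurable
    show "prob_space (jump_law L \<mu>)" by (rule prob_space_jump_law)
    show "AE d in jump_law L \<mu>. \<forall>k. 0 < snd (d !! k)"
      using AE_jump_law_proper_step[OF assms(1), of \<mu>]
      by eventually_elim (metis proper_step_def sdrop_simps(1))
    fix n and y :: "nat \<Rightarrow> 's" and t :: "nat \<Rightarrow> real" assume t: "\<And>k. 0 \<le> t k"
    have "emeasure (distr M itinerary_space ?D) (cylinder n y t)
      = emeasure M {\<omega> \<in> space M. \<forall>k\<le>n. Y k \<omega> = y k \<and> ennreal (t k) < W k \<omega>}"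
      unfolding emeasure_distr[OF D sets_cylinder]
      by (auto simp: cylinder_def intro!: arg_cong2[where f = emeasure])
    also have "\<dots> = emeasure (jump_law L \<mu>) (cylinder n y t)"
      using assms(3) t unfolding jump_hold_def
      by (simp add: M.emeasure_eq_measure emeasure_jump_law_cylinder[OF assms(1)])
    finally show "emeasure (distr M itinerary_space ?D) (cylinder n y t) = emeasure (jump_law L \<mu>) (cylinder n y t)" .
  qed auto
qed

lemma jump_holdI:
  fixes L :: "'s::countable \<Rightarrow> 's \<Rightarrow> real"
  assumes "generator L" "prob_space M" and [measurable]: "D \<in> M \<rightarrow>\<^sub>M itinerary_space"
    and "\<And>n y t. (\<forall>k\<le>n. 0 \<le> t k) \<Longrightarrow>
      emeasure M (D -` cylinder n y t \<inter> space M) = emeasure (jump_law L \<mu>) (cylinder n y t)"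
  shows "jump_hold M L \<mu> (\<lambda>n \<omega>. fst (D \<omega> !! n)) (\<lambda>n \<omega>. snd (D \<omega> !! n))"
  unfolding jump_hold_def
proof (intro conjI allI impI)
  fix n and y :: "nat \<Rightarrow> 's" and t :: "nat \<Rightarrow> real" assume t: "\<forall>k\<le>n. 0 \<le> t k"
  interpret M: prob_space M by fact
  have "D -` cylinder n y t \<inter> space M
    = {\<omega> \<in> space M. \<forall>k\<le>n. fst (D \<omega> !! k) = y k \<and> ennreal (t k) < snd (D \<omega> !! k)}"
    by (auto simp: cylinder_def)
  then have "ennreal (M.prob {\<omega> \<in> space M. \<forall>k\<le>n. fst (D \<omega> !! k) = y k \<and> ennreal (t k) < snd (D \<omega> !! k)})
    = ennreal (pmf \<mu> (y 0) * (\<Prod>k<n. jump_prob L (y k) (y (Suc k))) *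
        (\<Prod>k\<le>n. exp (- (jump_rate L (y k) * t k))))"
    using assms(4)[OF t, of y] emeasure_jump_law_cylinder[OF assms(1) t, of \<mu> y]
    by (simp add: M.emeasure_eq_measure)
  then show "M.prob {\<omega> \<in> space M. \<forall>k\<le>n. fst (D \<omega> !! k) = y k \<and> ennreal (t k) < snd (D \<omega> !! k)}
    = pmf \<mu> (y 0) * (\<Prod>k<n. jump_prob L (y k) (y (Suc k))) * (\<Prod>k\<le>n. exp (- (jump_rate L (y k) * t k)))"
    by (subst (asm) ennreal_inj)
      (auto intro!: mult_nonneg_nonneg prod_nonneg jump_prob_nonneg assms(1))
qed measurable

lemma measurable_jump_path [measurable]:
  fixes Y :: "nat \<Rightarrow> 'w \<Rightarrow> 's::countable"
  assumes [measurable]: "\<And>n. Y n \<in> M \<rightarrow>\<^sub>M count_space UNIV" "\<And>n. W n \<in> borel_measurable M"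
  shows "explosion_time W \<in> borel_measurable M" "jump_path Y W t \<in> M \<rightarrow>\<^sub>M count_space UNIV"
proof -
  have [measurable]: "jump_time W n \<in> borel_measurable M" for n
    unfolding jump_time_def[abs_def] by measurable
  show [measurable]: "explosion_time W \<in> borel_measurable M"
    unfolding explosion_time_def[abs_def] by measurable
  have [measurable]: "(\<lambda>\<omega>. LEAST n. ennreal t < jump_time W (Suc n) \<omega>) \<in> M \<rightarrow>\<^sub>M count_space UNIV"
    by measurable
  have [measurable]: "(\<lambda>\<omega>. Y (LEAST n. ennreal t < jump_time W (Suc n) \<omega>) \<omega>) \<in> M \<rightarrow>\<^sub>M count_space UNIV"
    by (rule measurable_compose_countable) measurable
  show "jump_path Y W t \<in> M \<rightarrow>\<^sub>M count_space UNIV"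
    unfolding jump_path_def[abs_def] by measurable
qed

lemma minimal_processI:
  fixes Y :: "nat \<Rightarrow> 'w \<Rightarrow> 's::countable"
  assumes "jump_hold M L \<mu> Y W"
  shows "minimal_process M L \<mu> (jump_path Y W) (explosion_time W)"
proof -
  have YW: "\<And>n. Y n \<in> M \<rightarrow>\<^sub>M count_space UNIV" "\<And>n. W n \<in> borel_measurable M"
    using assms unfolding jump_hold_def by blast+
  note m = measurable_jump_path[of Y M W, OF YW]
  show ?thesis unfolding minimal_process_def
    by (intro conjI allI impI m exI[of _ Y] exI[of _ W] assms) simp
qed

text \<open>\<open>nonexplosive\<close> speaks of processes on spaces of sequences, while
  \<open>jump_law\<close> lives on streams. The indexing map carries the law over, and the
  coordinates there form a minimal process to which the hypothesis applies.\<close>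

lemma AE_jump_law_nonexplosive:
  fixes L :: "'s::countable \<Rightarrow> 's \<Rightarrow> real"
  assumes "generator L" "nonexplosive L"
  shows "AE d in jump_law L p. explosion_time (\<lambda>n d. snd (d !! n)) d = \<infinity>"
proof -
  let ?P = "PiM UNIV (\<lambda>_::nat. count_space (UNIV :: 's set) \<Otimes>\<^sub>M (borel :: ennreal measure))"
  let ?M = "distr (jump_law L p) ?P (\<lambda>d n. d !! n)"
  interpret J: prob_space "jump_law L p" by (rule prob_space_jump_law)
  have m: "(\<lambda>d n. d !! n) \<in> jump_law L p \<rightarrow>\<^sub>M ?P"
    using measurable_snth_PiM by (simp cong: measurable_cong_sets)
  have M: "prob_space ?M" by (rule J.prob_space_distr[OF m])
  let ?D = "\<lambda>\<omega> :: nat \<Rightarrow> 's \<times> ennreal. to_stream \<omega>"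
  have D: "?D \<in> ?M \<rightarrow>\<^sub>M itinerary_space" by simp
  have "jump_hold ?M L p (\<lambda>n \<omega>. fst (?D \<omega> !! n)) (\<lambda>n \<omega>. snd (?D \<omega> !! n))"
  proof (rule jump_holdI[OF assms(1) M D])
    fix n and y :: "nat \<Rightarrow> 's" and t :: "nat \<Rightarrow> real"
    have "to_stream (\<lambda>n. d !! n) = d" for d :: "('s \<times> ennreal) stream"
      by (simp add: to_stream_def stream_smap_nats[symmetric])
    then have "(\<lambda>d n. d !! n) -` (?D -` cylinder n y t \<inter> space ?M) \<inter> space (jump_law L p) = cylinder n y t"
      by (auto simp: space_PiM space_pair_measure)
    moreover have "?D -` cylinder n y t \<inter> space ?M \<in> sets ?P"
      using measurable_sets[OF D sets_cylinder[of n y t]] by simp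
    ultimately show "emeasure ?M (?D -` cylinder n y t \<inter> space ?M) = emeasure (jump_law L p) (cylinder n y t)"
      by (simp only: emeasure_distr[OF m])
  qed
  then have J: "jump_hold ?M L p (\<lambda>n \<omega>. fst (\<omega> n)) (\<lambda>n \<omega>. snd (\<omega> n))"
    by (simp add: to_stream_def)
  have "minimal_process ?M L p (jump_path (\<lambda>n \<omega>. fst (\<omega> n)) (\<lambda>n \<omega>. snd (\<omega> n))) (explosion_time (\<lambda>n \<omega>. snd (\<omega> n)))"
    by (rule minimal_processI[OF J])
  then have "AE \<omega> in ?M. explosion_time (\<lambda>n \<omega>. snd (\<omega> n)) \<omega> = \<infinity>"
    using assms(2) M unfolding nonexplosive_def by blast
  from AE_distrD[OF m this] show ?thesis
    by (simp add: explosion_time_def jump_time_def)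
qed

section \<open>Paths of a jump process\<close>

definition elapsed :: "nat \<Rightarrow> ('s \<times> ennreal) stream \<Rightarrow> ennreal" where
  "elapsed n d = (\<Sum>k<n. snd (d !! k))"

definition lifetime :: "('s \<times> ennreal) stream \<Rightarrow> ennreal" where
  "lifetime d = (SUP n. elapsed n d)"

definition index_at :: "('s \<times> ennreal) stream \<Rightarrow> ennreal \<Rightarrow> nat" where
  "index_at d t = (LEAST n. t < elapsed (Suc n) d)"

definition state_at :: "('s \<times> ennreal) stream \<Rightarrow> ennreal \<Rightarrow> 's" where
  "state_at d t = fst (d !! index_at d t)"

text \<open>The path frozen at its \<open>n\<close>-th state. It serves twice: for X stopped at a
  fixed time, and for the past of the dual process during its \<open>n\<close>-th sojourn.\<close>

definition halted :: "nat \<Rightarrow> ('s \<times> ennreal) stream \<Rightarrow> ('s \<times> ennreal) stream" where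
  "halted n d = stake n d @- sconst (fst (d !! n), \<infinity>)"

definition regular :: "('s \<times> ennreal) stream \<Rightarrow> bool" where
  "regular d \<longleftrightarrow> lifetime d = \<infinity> \<and> (\<forall>n. proper_step (sdrop n d))"

lemma ennreal_less_add_right: "a \<noteq> \<infinity> \<Longrightarrow> 0 < b \<Longrightarrow> a < a + (b :: ennreal)"
  using ennreal_add_left_cancel_less[of a 0 b] by (simp add: less_top)

lemma elapsed_0 [simp]: "elapsed 0 d = 0"
  by (simp add: elapsed_def)

lemma elapsed_Suc: "elapsed (Suc n) d = elapsed n d + snd (d !! n)"
  by (simp add: elapsed_def)

lemma elapsed_Suc_shift: "elapsed (Suc n) d = snd (shd d) + elapsed n (stl d)"
  unfolding elapsed_def by (subst sum.lessThan_Suc_shift) simp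

lemma elapsed_mono: "m \<le> n \<Longrightarrow> elapsed m d \<le> elapsed n d"
  unfolding elapsed_def by (rule sum_mono2) auto

lemma elapsed_le_lifetime: "elapsed n d \<le> lifetime d"
  unfolding lifetime_def by (rule SUP_upper) simp

lemma elapsed_add: "elapsed (m + n) d = elapsed m d + elapsed n (sdrop m d)"
  by (induction n) (simp_all add: elapsed_Suc sdrop_snth add.assoc)

lemma lifetime_sdrop: "elapsed n d < \<infinity> \<Longrightarrow> lifetime d = \<infinity> \<Longrightarrow> lifetime (sdrop n d) = \<infinity>"
proof (rule ccontr)
  assume n: "elapsed n d < \<infinity>" "lifetime d = \<infinity>" and "lifetime (sdrop n d) \<noteq> \<infinity>"
  then have f: "elapsed n d + lifetime (sdrop n d) < \<infinity>" by (simp add: less_top)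
  have "elapsed m d \<le> elapsed n d + lifetime (sdrop n d)" for m
  proof -
    have "elapsed m d \<le> elapsed (n + m) d" by (rule elapsed_mono) simp
    also have "\<dots> \<le> elapsed n d + lifetime (sdrop n d)"
      unfolding elapsed_add by (intro add_left_mono elapsed_le_lifetime)
    finally show ?thesis .
  qed
  then have "lifetime d \<le> elapsed n d + lifetime (sdrop n d)" unfolding lifetime_def by (intro SUP_least)
  with f n(2) show False by (metis leD)
qed

lemma index_at_eqI:
  assumes "elapsed n d \<le> t" "t < elapsed (Suc n) d"
  shows "index_at d t = n"
  unfolding index_at_def
proof (rule Least_equality)
  fix m assume "t < elapsed (Suc m) d"
  then show "n \<le> m" using assms(1) elapsed_mono[of "Suc m" n d]
    by (metis leD le_less_trans not_less_eq_eq order_trans)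
qed fact

lemma index_at:
  assumes "t < lifetime d"
  shows "elapsed (index_at d t) d \<le> t" "t < elapsed (Suc (index_at d t)) d"
proof -
  obtain n where n: "t < elapsed n d" using assms unfolding lifetime_def less_SUP_iff by blast
  then obtain m where "t < elapsed (Suc m) d" by (cases n) auto
  then show "t < elapsed (Suc (index_at d t)) d" unfolding index_at_def by (rule LeastI)
  show "elapsed (index_at d t) d \<le> t"
  proof (cases "index_at d t")
    case (Suc k)
    then have "\<not> t < elapsed (Suc k) d" unfolding index_at_def by (metis lessI not_less_Least)
    then show ?thesis using Suc by simp
  qed simp
qed

lemma index_at_ge:
  assumes "t < lifetime d" "elapsed n d \<le> t" shows "n \<le> index_at d t"
proof (rule ccontr)
  assume "\<not> n \<le> index_at d t"
  then have "elapsed (Suc (index_at d t)) d \<le> elapsed n d" by (intro elapsed_mono) simp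
  with index_at(2)[OF assms(1)] assms(2) show False by (metis le_less_trans less_irrefl order_trans leD)
qed

lemma state_at_eqI:
  "elapsed n d \<le> t \<Longrightarrow> t < elapsed (Suc n) d \<Longrightarrow> state_at d t = fst (d !! n)"
  by (simp add: state_at_def index_at_eqI)

lemma state_at_less_shd: "t < snd (shd d) \<Longrightarrow> state_at d t = fst (shd d)"
  using state_at_eqI[of 0 d t] by (simp add: elapsed_Suc)

lemma state_at_shift:
  assumes "elapsed n d < \<infinity>" "elapsed n d + t < lifetime d"
  shows "state_at d (elapsed n d + t) = state_at (sdrop n d) t"
proof -
  let ?m = "index_at d (elapsed n d + t)"
  have "n \<le> ?m" using assms by (intro index_at_ge) auto
  then obtain k where k: "?m = n + k" using le_Suc_ex by blast
  have "elapsed n d + elapsed k (sdrop n d) \<le> elapsed n d + t"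
    using index_at(1)[OF assms(2)] unfolding k elapsed_add .
  then have 1: "elapsed k (sdrop n d) \<le> t" using assms(1) by (auto simp: ennreal_add_left_cancel_le)
  have "elapsed n d + t < elapsed n d + elapsed (Suc k) (sdrop n d)"
    using index_at(2)[OF assms(2)] unfolding k elapsed_add[symmetric] by simp
  then have 2: "t < elapsed (Suc k) (sdrop n d)"
    by (metis add_left_mono leD not_le)
  show ?thesis using state_at_eqI[OF 1 2] by (simp add: state_at_def k sdrop_snth)
qed

lemma measurable_elapsed [measurable]: "elapsed n \<in> borel_measurable (stream_space (count_space UNIV \<Otimes>\<^sub>M borel))"
  unfolding elapsed_def[abs_def] by measurable

lemma measurable_lifetime [measurable]: "lifetime \<in> borel_measurable (stream_space (count_space UNIV \<Otimes>\<^sub>M borel))"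
  unfolding lifetime_def[abs_def] by measurable

lemma measurable_index_at [measurable (raw)]:
  assumes [measurable]: "d \<in> M \<rightarrow>\<^sub>M itinerary_space" "t \<in> borel_measurable M"
  shows "(\<lambda>\<omega>. index_at (d \<omega>) (t \<omega>)) \<in> M \<rightarrow>\<^sub>M count_space UNIV"
  unfolding index_at_def by measurable

lemma measurable_state_at [measurable (raw)]:
  assumes [measurable]: "d \<in> M \<rightarrow>\<^sub>M itinerary_space" "t \<in> borel_measurable M"
  shows "(\<lambda>\<omega>. state_at (d \<omega>) (t \<omega>)) \<in> M \<rightarrow>\<^sub>M count_space UNIV"
proof -
  have "(\<lambda>\<omega>. fst (d \<omega> !! index_at (d \<omega>) (t \<omega>))) \<in> M \<rightarrow>\<^sub>M count_space UNIV"
    by (rule measurable_compose_countable[of "\<lambda>n \<omega>. fst (d \<omega> !! n)"]) measurable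
  then show ?thesis by (simp add: state_at_def)
qed

lemma jump_path_stream:
  "jump_path (\<lambda>n \<omega>. fst (D \<omega> !! n)) (\<lambda>n \<omega>. snd (D \<omega> !! n)) t \<omega>
    = (if ennreal t < lifetime (D \<omega>) then Some (state_at (D \<omega>) (ennreal t)) else None)"
  "explosion_time (\<lambda>n \<omega>. snd (D \<omega> !! n)) \<omega> = lifetime (D \<omega>)"
  by (simp_all add: jump_path_def explosion_time_def jump_time_def lifetime_def state_at_def index_at_def elapsed_def)

lemma halted_snth: "halted n d !! k = (if k < n then d !! k else (fst (d !! n), \<infinity>))"
  by (simp add: halted_def shift_snth)

lemma halted_0: "halted 0 d = sconst (fst (shd d), \<infinity>)"
  by (simp add: halted_def)

lemma halted_Suc: "halted (Suc n) d = shd d ## halted n (stl d)"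
  by (simp add: halted_def)

lemma measurable_halted [measurable]:
  "halted n \<in> itinerary_space \<rightarrow>\<^sub>M (itinerary_space :: ('s::countable \<times> ennreal) stream measure)"
proof (rule measurable_stream_space2)
  fix k show "(\<lambda>d :: ('s \<times> ennreal) stream. halted n d !! k) \<in> itinerary_space \<rightarrow>\<^sub>M count_space UNIV \<Otimes>\<^sub>M borel"
    unfolding halted_snth by (cases "k < n") simp_all
qed

lemma elapsed_halted: "elapsed k (halted n d) = (if k \<le> n then elapsed k d else \<infinity>)"
proof (cases "k \<le> n")
  case True
  then show ?thesis unfolding elapsed_def by (auto simp: halted_snth intro!: sum.cong)
next
  case False
  then have "elapsed (Suc n) (halted n d) \<le> elapsed k (halted n d)" by (intro elapsed_mono) simp
  moreover have "elapsed (Suc n) (halted n d) = \<infinity>" by (simp add: elapsed_Suc halted_snth)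
  ultimately show ?thesis using False by (simp add: top_unique)
qed

text \<open>The path is constant between the entry into the \<open>n\<close>-th state and
  \<open>t\<close>, so freezing the itinerary in the sojourn that contains \<open>t\<close> amounts
  to stopping the path at \<open>t\<close>.\<close>

lemma state_at_halted:
  assumes "elapsed n d \<le> t" "t < elapsed (Suc n) d" "s < \<infinity>"
  shows "state_at (halted n d) s = state_at d (min s t)"
proof (cases "s < elapsed n d")
  case True
  then have "s < lifetime d" using elapsed_le_lifetime less_le_trans by blast
  note i = index_at[OF this]
  have "index_at d s < n"
    using True i(1) by (metis elapsed_mono leD leI order_trans le_less_trans)
  then have "state_at (halted n d) s = fst (halted n d !! index_at d s)"
    using i by (intro state_at_eqI) (auto simp: elapsed_halted)
  moreover have "s \<le> t" using True assms(1) by (rule less_imp_le[OF less_le_trans])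
  then have "min s t = s" by (rule min_absorb1)
  ultimately show ?thesis using \<open>index_at d s < n\<close> by (simp only: halted_snth if_True state_at_def)
next
  case False
  then have "state_at (halted n d) s = fst (halted n d !! n)"
    using assms(3) by (intro state_at_eqI) (auto simp: elapsed_halted)
  moreover have "state_at d (min s t) = fst (d !! n)"
    using assms False by (intro state_at_eqI) (auto simp: min_def)
  ultimately show ?thesis by (simp add: halted_snth)
qed

lemma lifetime_halted: "lifetime (halted n d) = \<infinity>"
  using elapsed_le_lifetime[of "Suc n" "halted n d"] by (simp add: elapsed_halted top_unique)

lemma proper_step_sdrop: "proper_step (sdrop k d) \<longleftrightarrow> 0 < snd (d !! k) \<and>
    (if snd (d !! k) = \<infinity> then d !! Suc k = d !! k else fst (d !! Suc k) \<noteq> fst (d !! k))"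
  by (simp add: proper_step_def sdrop_simps)

lemma regular_absorbed:
  assumes "regular d" "snd (d !! k) = \<infinity>" "k \<le> n" shows "d !! n = d !! k"
  using assms(3)
proof (induction n rule: dec_induct)
  case (step n)
  have "proper_step (sdrop n d)" using assms(1) by (simp add: regular_def)
  then show ?case using step assms(2) by (simp add: proper_step_def)
qed simp

lemma regular_step:
  assumes "regular d"
  shows "0 < snd (d !! n)" "snd (d !! n) \<noteq> \<infinity> \<Longrightarrow> fst (d !! Suc n) \<noteq> fst (d !! n)"
proof -
  have "proper_step (sdrop n d)" using assms(1) by (simp add: regular_def)
  then show "0 < snd (d !! n)" "snd (d !! n) \<noteq> \<infinity> \<Longrightarrow> fst (d !! Suc n) \<noteq> fst (d !! n)"
    by (auto simp: proper_step_def)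
qed

lemma regular_halted:
  assumes "regular d" "elapsed n d < \<infinity>" shows "regular (halted n d)"
  unfolding regular_def
proof (intro conjI allI)
  fix k
  have f: "snd (d !! j) < \<infinity>" if "j < n" for j
    using assms(2) member_le_sum[of j "{..<n}" "\<lambda>k. snd (d !! k)"] that
    by (auto simp: elapsed_def intro: le_less_trans)
  show "proper_step (sdrop k (halted n d))"
  proof (cases "k < n")
    case True
    then have "fst (halted n d !! Suc k) = fst (d !! Suc k)"
      unfolding halted_snth by (cases "Suc k = n") auto
    then show ?thesis unfolding proper_step_sdrop
      using True f[OF True] regular_step[OF assms(1), of k] by (auto simp: halted_snth simp del: snth.simps)
  next
    case False
    then show ?thesis unfolding proper_step_sdrop by (simp add: halted_snth del: snth.simps)
  qed
qed (rule lifetime_halted)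

section \<open>Recovering an itinerary from its path at rational times\<close>

text \<open>Only rational times are used, so that the recovered itinerary is measurable with respect to the
  \<open>\<sigma>\<close>-algebra generated by the process.\<close>

definition right_state :: "(real \<Rightarrow> 's::countable) \<Rightarrow> ennreal \<Rightarrow> 's" where
  "right_state p T = from_nat (LEAST n. \<exists>q::rat. 0 \<le> q \<and> T < ennreal (of_rat q) \<and>
     (\<forall>q'::rat. 0 \<le> q' \<and> T < ennreal (of_rat q') \<and> q' < q \<longrightarrow> p (of_rat q') = from_nat n))"

definition exit_time :: "(real \<Rightarrow> 's) \<Rightarrow> 's \<Rightarrow> ennreal \<Rightarrow> ennreal" where
  "exit_time p x T = (INF q::rat. if 0 \<le> q \<and> T < ennreal (of_rat q) \<and> p (of_rat q) \<noteq> x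
     then ennreal (of_rat q) else \<infinity>)"

text \<open>Pairs of a state and its entry time. If the state is never left, it is repeated with
  entry time \<open>\<infinity>\<close>, in accordance with the last clause of
  \<open>proper_step\<close>.\<close>

fun observed :: "(real \<Rightarrow> 's::countable) \<Rightarrow> nat \<Rightarrow> 's \<times> ennreal" where
  "observed p 0 = (right_state p 0, 0)"
| "observed p (Suc n) = (let (x, T) = observed p n; T' = exit_time p x T
     in (if T' = \<infinity> then x else right_state p T', T'))"

definition itinerary_of :: "(real \<Rightarrow> 's::countable) \<Rightarrow> ('s \<times> ennreal) stream" where
  "itinerary_of p = smap (\<lambda>n. (fst (observed p n), snd (observed p (Suc n)) - snd (observed p n))) nats"

lemma rat_between:
  fixes a b :: ennreal assumes "a < b"
  shows "\<exists>q::rat. 0 \<le> q \<and> a < ennreal (of_rat q) \<and> ennreal (of_rat q) < b"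
proof -
  obtain q :: rat where q: "a < ennreal (of_rat q)" "ennreal (of_rat q) < b"
    using ennreal_rat_dense[OF assms] by auto
  moreover have "0 \<le> q"
  proof (rule ccontr)
    assume "\<not> 0 \<le> q"
    then have "ennreal (real_of_rat q) = 0" by (simp add: ennreal_neg)
    with q(1) show False by simp
  qed
  ultimately show ?thesis by blast
qed

lemma right_state_eqI:
  fixes p :: "real \<Rightarrow> 's::countable"
  assumes "T < R" and p: "\<And>q::rat. 0 \<le> q \<Longrightarrow> T < ennreal (of_rat q) \<Longrightarrow> ennreal (of_rat q) < R \<Longrightarrow> p (of_rat q) = b"
  shows "right_state p T = b"
proof -
  let ?P = "\<lambda>n. \<exists>q::rat. 0 \<le> q \<and> T < ennreal (of_rat q) \<and>
     (\<forall>q'::rat. 0 \<le> q' \<and> T < ennreal (of_rat q') \<and> q' < q \<longrightarrow> p (of_rat q') = from_nat n)"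
  obtain r :: rat where r: "0 \<le> r" "T < ennreal (of_rat r)" "ennreal (of_rat r) < R"
    using rat_between[OF assms(1)] by blast
  have "?P (to_nat b)"
  proof (intro exI[of _ r] conjI allI impI)
    fix q' :: rat assume q': "0 \<le> q' \<and> T < ennreal (of_rat q') \<and> q' < r"
    then have "ennreal (of_rat q') \<le> ennreal (of_rat r)" by (intro ennreal_leI) (simp add: of_rat_less_eq)
    then have "ennreal (of_rat q') < R" using r(3) by (rule le_less_trans)
    then show "p (of_rat q') = from_nat (to_nat b)" using q' by (simp add: p)
  qed (use r in auto)
  then have "?P (LEAST n. ?P n)" by (rule LeastI)
  then obtain q :: rat where q: "0 \<le> q" "T < ennreal (of_rat q)"
    and eq: "\<And>q'::rat. 0 \<le> q' \<Longrightarrow> T < ennreal (of_rat q') \<Longrightarrow> q' < q \<Longrightarrow> p (of_rat q') = right_state p T"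
    unfolding right_state_def by blast
  obtain s :: rat where s: "0 \<le> s" "T < ennreal (of_rat s)" "ennreal (of_rat s) < min R (ennreal (of_rat q))"
    using rat_between[of T "min R (ennreal (of_rat q))"] assms(1) q by auto
  then have "s < q" using q by (simp add: ennreal_less_iff of_rat_less)
  then show ?thesis using eq[of s] p[of s] s by simp
qed

text \<open>A sojourn of positive length contains rational times arbitrarily close to its beginning,
  which reveal its state; as consecutive states differ, the first rational times with another value
  reveal its end.\<close>

lemma observed_eq:
  fixes d :: "('s::countable \<times> ennreal) stream"
  assumes "regular d" and p: "\<And>q::rat. 0 \<le> q \<Longrightarrow> p (of_rat q) = state_at d (ennreal (of_rat q))"
  shows "observed p n = (fst (d !! n), elapsed n d)"
proof (induction n)
  case 0
  have "right_state p 0 = fst (d !! 0)"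
    using regular_step(1)[OF assms(1), of 0]
    by (intro right_state_eqI[of 0 "snd (d !! 0)"]) (auto simp: p state_at_less_shd)
  then show ?case by simp
next
  case (Suc n)
  let ?x = "fst (d !! n)" and ?T = "elapsed n d" and ?T' = "elapsed (Suc n) d"
  have stay: "p (of_rat q) = ?x" if "0 \<le> q" "?T < ennreal (of_rat q)" "ennreal (of_rat q) < ?T'" for q :: rat
    using that by (simp add: p state_at_eqI less_imp_le)
  have exit: "exit_time p ?x ?T = ?T'"
  proof (rule antisym)
    show "?T' \<le> exit_time p ?x ?T"
      unfolding exit_time_def using stay by (intro INF_greatest) (auto simp: not_less[symmetric])
    show "exit_time p ?x ?T \<le> ?T'"
    proof (cases "?T' = \<infinity>")
      case False
      then have w: "snd (d !! n) \<noteq> \<infinity>" by (auto simp: elapsed_Suc)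
      have pos: "0 < snd (d !! Suc n)" by (rule regular_step[OF assms(1)])
      have less: "?T' < elapsed (Suc (Suc n)) d"
        using False pos by (simp add: elapsed_Suc[of "Suc n"] ennreal_less_add_right)
      show ?thesis
      \<comment> \<open>Between \<open>?T'\<close> and \<open>y\<close> there is a rational time
        within the next sojourn, where the path has already left \<open>?x\<close>.\<close>
      proof (rule dense_ge)
        fix y assume "?T' < y"
        then obtain q :: rat where q: "0 \<le> q" "?T' < ennreal (of_rat q)"
            "ennreal (of_rat q) < min y (elapsed (Suc (Suc n)) d)"
          using rat_between[of ?T' "min y (elapsed (Suc (Suc n)) d)"] less by auto
        have "p (of_rat q) = fst (d !! Suc n)"
          using q by (simp add: p state_at_eqI[of "Suc n"] less_imp_le)
        then have "p (of_rat q) \<noteq> ?x" using regular_step(2)[OF assms(1) w] by simp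
        moreover have "?T < ennreal (of_rat q)"
          using q(2) elapsed_mono[of n "Suc n" d] by (simp add: le_less_trans)
        ultimately have "exit_time p ?x ?T \<le> ennreal (of_rat q)"
          unfolding exit_time_def using q(1) by (intro INF_lower2[of q]) auto
        then show "exit_time p ?x ?T \<le> y" by (rule order_trans) (use q(3) in \<open>simp add: less_imp_le\<close>)
      qed
    qed simp
  qed
  have "(if ?T' = \<infinity> then ?x else right_state p ?T') = fst (d !! Suc n)"
  proof (cases "?T' = \<infinity>")
    case True
    then have "\<exists>k\<in>{..<Suc n}. snd (d !! k) = \<infinity>"
      unfolding elapsed_def infinity_ennreal_def by (subst (asm) ennreal_sum_eq_top) auto
    then obtain k where k: "k < Suc n" "snd (d !! k) = \<infinity>" by auto
    then have "d !! n = d !! k" "d !! Suc n = d !! k"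
      using regular_absorbed[OF assms(1) k(2), of n] regular_absorbed[OF assms(1) k(2), of "Suc n"] k(1) by simp_all
    then show ?thesis using True by simp
  next
    case False
    have pos: "0 < snd (d !! Suc n)" by (rule regular_step[OF assms(1)])
    have less: "?T' < elapsed (Suc (Suc n)) d"
      using False pos by (simp add: elapsed_Suc[of "Suc n"] ennreal_less_add_right)
    have "right_state p ?T' = fst (d !! Suc n)"
      using less by (rule right_state_eqI) (simp add: p state_at_eqI[of "Suc n"] less_imp_le)
    then show ?thesis using False by simp
  qed
  then show ?case using Suc exit by simp
qed

lemma itinerary_of_eq:
  fixes d :: "('s::countable \<times> ennreal) stream"
  assumes "regular d" "\<And>q::rat. 0 \<le> q \<Longrightarrow> p (of_rat q) = state_at d (ennreal (of_rat q))"
  shows "itinerary_of p = d"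
proof -
  have "elapsed (Suc n) d - elapsed n d = snd (d !! n)" for n
  \<comment> \<open>In \<open>ennreal\<close>,
    \<open>\<infinity> - \<infinity> = \<infinity>\<close>, which is the holding time repeated after
    absorption.\<close>
  proof (cases "elapsed n d = \<infinity>")
    case True
    then obtain k where "k < n" "snd (d !! k) = \<infinity>"
      by (auto simp: elapsed_def)
    then have "d !! n = d !! k" using regular_absorbed[OF assms(1), of k n] by simp
    then show ?thesis using True \<open>snd (d !! k) = \<infinity>\<close> by (simp add: elapsed_Suc)
  qed (simp add: elapsed_Suc)
  then have "itinerary_of p = smap (\<lambda>n. d !! n) nats"
    unfolding itinerary_of_def by (simp add: observed_eq[OF assms] del: observed.simps)
  then show ?thesis by (simp add: stream_smap_nats[symmetric])
qed

lemma measurable_itinerary_of: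
  fixes p :: "'m \<Rightarrow> real \<Rightarrow> 's::countable"
  assumes [measurable]: "\<And>q::rat. 0 \<le> q \<Longrightarrow> (\<lambda>\<omega>. p \<omega> (of_rat q)) \<in> M \<rightarrow>\<^sub>M count_space UNIV"
  shows "(\<lambda>\<omega>. itinerary_of (p \<omega>)) \<in> M \<rightarrow>\<^sub>M itinerary_space"
proof -
  \<comment> \<open>Nothing is known about \<open>p\<close> at negative times, so the sign condition
    stays inside the predicate.\<close>
  have p: "Measurable.pred M (\<lambda>\<omega>. 0 \<le> q \<and> p \<omega> (of_rat q) \<in> A)" for q :: rat and A
    using assms[of q] by (cases "0 \<le> q") (simp_all add: pred_sets1[OF _ assms])
  have right: "(\<lambda>\<omega>. right_state (p \<omega>) (T \<omega>)) \<in> M \<rightarrow>\<^sub>M count_space UNIV"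
    if [measurable]: "T \<in> borel_measurable M" for T
  proof -
    have "Measurable.pred M (\<lambda>\<omega>. \<exists>q::rat. 0 \<le> q \<and> T \<omega> < ennreal (of_rat q) \<and>
      (\<forall>q'::rat. 0 \<le> q' \<and> T \<omega> < ennreal (of_rat q') \<and> q' < q \<longrightarrow> p \<omega> (of_rat q') = from_nat n))" for n
    proof -
      have [measurable]: "Measurable.pred M (\<lambda>\<omega>. 0 \<le> q' \<and> p \<omega> (of_rat q') \<in> - {from_nat n})" for q' :: rat
        by (rule p)
      have "Measurable.pred M (\<lambda>\<omega>. \<exists>q::rat. 0 \<le> q \<and> T \<omega> < ennreal (of_rat q) \<and>
        (\<forall>q'::rat. \<not> (T \<omega> < ennreal (of_rat q') \<and> q' < q \<and> (0 \<le> q' \<and> p \<omega> (of_rat q') \<in> - {from_nat n}))))"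
        by measurable
      then show ?thesis by (rule measurable_cong[THEN iffD1, rotated]) auto
    qed
    then show ?thesis unfolding right_state_def by measurable
  qed
  have exit: "(\<lambda>\<omega>. exit_time (p \<omega>) x (T \<omega>)) \<in> borel_measurable M"
    if [measurable]: "T \<in> borel_measurable M" for T x
  proof -
    have [measurable]: "Measurable.pred M (\<lambda>\<omega>. 0 \<le> q \<and> p \<omega> (of_rat q) \<in> - {x})" for q :: rat
      by (rule p)
    have "(\<lambda>\<omega>. INF q::rat. if T \<omega> < ennreal (of_rat q) \<and> (0 \<le> q \<and> p \<omega> (of_rat q) \<in> - {x})
      then ennreal (of_rat q) else \<infinity>) \<in> borel_measurable M" by measurable
    then show ?thesis unfolding exit_time_def
      by (rule measurable_cong[THEN iffD1, rotated], intro INF_cong refl) auto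
  qed
  have obs: "(\<lambda>\<omega>. fst (observed (p \<omega>) n)) \<in> M \<rightarrow>\<^sub>M count_space UNIV \<and> (\<lambda>\<omega>. snd (observed (p \<omega>) n)) \<in> borel_measurable M" for n
  proof (induction n)
    case 0
    show ?case using right[of "\<lambda>_. 0"] by simp
  next
    case (Suc n)
    then have [measurable]: "(\<lambda>\<omega>. fst (observed (p \<omega>) n)) \<in> M \<rightarrow>\<^sub>M count_space UNIV" "(\<lambda>\<omega>. snd (observed (p \<omega>) n)) \<in> borel_measurable M"
      by auto
    have [measurable]: "(\<lambda>\<omega>. exit_time (p \<omega>) (fst (observed (p \<omega>) n)) (snd (observed (p \<omega>) n))) \<in> borel_measurable M"
      by (rule measurable_compose_countable[of "\<lambda>x \<omega>. exit_time (p \<omega>) x (snd (observed (p \<omega>) n))"]) (auto intro: exit)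
    note [measurable] = right[OF this]
    show ?case by (simp add: case_prod_beta' Let_def)
  qed
  then have [measurable]: "\<And>n. (\<lambda>\<omega>. fst (observed (p \<omega>) n)) \<in> M \<rightarrow>\<^sub>M count_space UNIV" "\<And>n. (\<lambda>\<omega>. snd (observed (p \<omega>) n)) \<in> borel_measurable M"
    by auto
  show ?thesis unfolding itinerary_of_def
    by (rule measurable_stream_space2) (simp del: observed.simps)
qed

section \<open>The rates of the coupling\<close>

definition off :: "('a \<Rightarrow> 'a \<Rightarrow> real) \<Rightarrow> 'a \<Rightarrow> 'a \<Rightarrow> real" where
  "off A x y = (if x = y then 0 else A x y)"

lemma off_nonneg: "generator L \<Longrightarrow> 0 \<le> off L x y"
  by (simp add: off_def generator_def)

lemma nn_integral_off:
  fixes L :: "'s::countable \<Rightarrow> 's \<Rightarrow> real"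
  assumes "generator L"
  shows "(\<integral>\<^sup>+y. ennreal (off L x y) \<partial>count_space UNIV) = ennreal (jump_rate L x)"
  unfolding nn_integral_generator_row[OF assms, of x, symmetric]
  by (intro nn_integral_cong) (auto simp: off_def)

lemma off_le_jump_rate:
  fixes L :: "'s::countable \<Rightarrow> 's \<Rightarrow> real"
  assumes "generator L" shows "off L x y \<le> jump_rate L x"
  using nn_integral_ge_point[of y UNIV "\<lambda>y. ennreal (off L x y)"] nn_integral_off[OF assms, of x]
    jump_rate_nonneg[OF assms, of x] by simp

lemma jump_rate_times_jump_prob:
  fixes L :: "'s::countable \<Rightarrow> 's \<Rightarrow> real"
  assumes "generator L" shows "jump_rate L x * jump_prob L x y = off L x y"
  using off_nonneg[OF assms, of x y] off_le_jump_rate[OF assms, of x y]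
  by (auto simp: off_def jump_prob_def)

lemma infsum_diagonal_split:
  fixes f :: "'a \<Rightarrow> real"
  assumes "g summable_on UNIV" "\<And>x. f x = g x + (if x = a then c else 0)"
  shows "infsum f UNIV = infsum g UNIV + c"
proof -
  have "((\<lambda>x. if x = a then c else 0) has_sum c) UNIV"
    by (rule has_sum_finite_neutralI[of "{a}"]) auto
  from has_sum_add[OF has_sum_infsum[OF assms(1)] this] show ?thesis
    by (subst assms(2)[THEN ext]) (rule infsumI)
qed

locale intertwining =
  fixes \<Lambda> :: "'t::countable \<Rightarrow> 's::countable \<Rightarrow> real"
    and L :: "'s \<Rightarrow> 's \<Rightarrow> real" and Ls :: "'t \<Rightarrow> 't \<Rightarrow> real"
  assumes kernel: "transition_kernel \<Lambda>"
    and gen: "generator L" and nonexpl: "nonexplosive L"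
    and gen_s: "generator Ls"
    and rate_sum: "\<And>y. (\<lambda>x. \<Lambda> y x * jump_rate L x) summable_on UNIV"
    and intertwine: "mat_prod Ls \<Lambda> = mat_prod \<Lambda> L"
begin

definition kernel_pmf :: "'t \<Rightarrow> 's pmf" where "kernel_pmf y = embed_pmf (\<Lambda> y)"

lemma kernel_nonneg: "0 \<le> \<Lambda> y x"
  using kernel by (simp add: transition_kernel_def)

lemma nn_integral_kernel: "(\<integral>\<^sup>+x. ennreal (\<Lambda> y x) \<partial>count_space UNIV) = 1"
  using nn_integral_has_sum[of "\<Lambda> y" UNIV 1] kernel kernel_nonneg by (simp add: transition_kernel_def)

lemma pmf_kernel_pmf: "pmf (kernel_pmf y) x = \<Lambda> y x"
  unfolding kernel_pmf_def by (intro pmf_embed_pmf kernel_nonneg nn_integral_kernel)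

lemma kernel_le_1: "\<Lambda> y x \<le> 1"
  by (metis pmf_kernel_pmf pmf_le_1)

abbreviation rate :: "'s \<Rightarrow> real" where "rate \<equiv> jump_rate L"
abbreviation dual_rate :: "'t \<Rightarrow> real" where "dual_rate \<equiv> jump_rate Ls"

lemma rate_nonneg: "0 \<le> rate x" "0 \<le> dual_rate y"
  by (simp_all add: jump_rate_nonneg gen gen_s)

text \<open>The rate at which X jumps into \<open>x'\<close> while it is distributed according to
  \<open>\<Lambda> y\<close>.\<close>

definition inflow :: "'t \<Rightarrow> 's \<Rightarrow> real" where
  "inflow y x' = (\<Sum>\<^sub>\<infinity>x. \<Lambda> y x * off L x x')"

text \<open>The rate at which mass of X at \<open>x'\<close> has to leave a stay at
  \<open>y\<close>: after a jump to \<open>z\<close>, which happens at rate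
  \<open>off Ls y z\<close>, X must have law \<open>\<Lambda> z\<close>.\<close>

definition outflow :: "'t \<Rightarrow> 's \<Rightarrow> real" where
  "outflow y x' = (\<Sum>\<^sub>\<infinity>z. off Ls y z * \<Lambda> z x')"

text \<open>Here the summability of the averaged rates enters, since a single transition rate out of
  \<open>x\<close> is at most \<open>rate x\<close>.\<close>

lemma summable_inflow: "(\<lambda>x. \<Lambda> y x * off L x x') summable_on UNIV"
  by (rule summable_on_comparison_test[OF rate_sum[of y]])
    (auto intro!: mult_left_mono mult_nonneg_nonneg off_le_jump_rate off_nonneg gen kernel_nonneg)

lemma summable_off_Ls: "(\<lambda>z. off Ls y z) summable_on UNIV"
proof -
  have "(Ls y has_sum dual_rate y) (- {y})" using gen_s by (simp add: generator_def)
  then have "(off Ls y has_sum dual_rate y) UNIV"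
    by (rule has_sum_cong_neutral[THEN iffD1, rotated 3]) (auto simp: off_def)
  then show ?thesis by (rule has_sum_imp_summable)
qed

lemma summable_outflow: "(\<lambda>z. off Ls y z * \<Lambda> z x') summable_on UNIV"
  by (rule summable_on_comparison_test[OF summable_off_Ls[of y]])
    (auto intro!: mult_left_le mult_nonneg_nonneg off_nonneg gen_s kernel_nonneg kernel_le_1)

lemma inflow_nonneg: "0 \<le> inflow y x" and outflow_nonneg: "0 \<le> outflow y x"
  unfolding inflow_def outflow_def
  by (auto intro!: infsum_nonneg mult_nonneg_nonneg off_nonneg gen gen_s kernel_nonneg)

lemma nn_integral_inflow:
  "(\<integral>\<^sup>+x. ennreal (\<Lambda> y x) * ennreal (off L x x') \<partial>count_space UNIV) = ennreal (inflow y x')"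
  unfolding inflow_def ennreal_mult[OF kernel_nonneg off_nonneg[OF gen], symmetric]
  by (intro nn_integral_has_sum has_sum_infsum summable_inflow)
    (auto intro!: mult_nonneg_nonneg off_nonneg gen kernel_nonneg)

lemma nn_integral_outflow:
  "(\<integral>\<^sup>+z. ennreal (off Ls y z) * ennreal (\<Lambda> z x') \<partial>count_space UNIV) = ennreal (outflow y x')"
  unfolding outflow_def ennreal_mult[OF off_nonneg[OF gen_s] kernel_nonneg, symmetric]
  by (intro nn_integral_has_sum has_sum_infsum summable_outflow)
    (auto intro!: mult_nonneg_nonneg off_nonneg gen_s kernel_nonneg)

text \<open>An entry of the intertwining relation, with the diagonal terms of both matrices moved to
  the opposite sides.\<close>

lemma balance: "inflow y x' + dual_rate y * \<Lambda> y x' = outflow y x' + \<Lambda> y x' * rate x'"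
proof -
  have "mat_prod \<Lambda> L y x' = inflow y x' + - (\<Lambda> y x' * rate x')"
    unfolding mat_prod_def inflow_def
    by (rule infsum_diagonal_split[OF summable_inflow, where a = x']) (auto simp: off_def jump_rate_def)
  moreover have "mat_prod Ls \<Lambda> y x' = outflow y x' + - (dual_rate y * \<Lambda> y x')"
    unfolding mat_prod_def outflow_def
    by (rule infsum_diagonal_split[OF summable_outflow, where a = y]) (auto simp: off_def jump_rate_def)
  ultimately show ?thesis using intertwine by simp
qed

text \<open>While the dual process is at \<open>y\<close> and \<open>X\<close> is at \<open>x\<close>, an alarm rings at rate
  \<open>alarm_rate y x\<close> and makes the dual process jump. If \<open>X\<close> jumps to \<open>x'\<close> before, then the dual process
  jumps simultaneously with probability \<open>joint_prob y x'\<close>. The target is in both cases drawn from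
  \<open>target y\<close> at the current position of \<open>X\<close>.\<close>

definition alarm_rate :: "'t \<Rightarrow> 's \<Rightarrow> real" where
  "alarm_rate y x = max 0 (dual_rate y - rate x)"

definition joint_prob :: "'t \<Rightarrow> 's \<Rightarrow> real" where
  "joint_prob y x' = outflow y x' / max (inflow y x') (outflow y x')"

definition target :: "'t \<Rightarrow> 's \<Rightarrow> 't pmf" where
  "target y x = (if outflow y x = 0 then return_pmf y
     else embed_pmf (\<lambda>z. off Ls y z * \<Lambda> z x / outflow y x))"

text \<open>\<open>None\<close> means that the stay goes on. The decision and the target are a
  single draw, which needs only one uniform variable.\<close>

definition coin :: "'t \<Rightarrow> 's \<Rightarrow> 't option pmf" where
  "coin y x' = bind_pmf (bernoulli_pmf (joint_prob y x'))
     (\<lambda>b. if b then map_pmf Some (target y x') else return_pmf None)"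

lemma alarm_rate_nonneg: "0 \<le> alarm_rate y x"
  by (simp add: alarm_rate_def)

lemma rate_plus_alarm_rate: "rate x + alarm_rate y x = max (rate x) (dual_rate y)"
  by (simp add: alarm_rate_def)

lemma joint_prob_bounds: "0 \<le> joint_prob y x" "joint_prob y x \<le> 1"
  using inflow_nonneg[of y x] outflow_nonneg[of y x]
  by (auto simp: joint_prob_def divide_le_eq_1 le_max_iff_disj)

text \<open>Multiplied by \<open>outflow\<close>, Bayes' formula also covers the arbitrary default
  of \<open>target\<close>: if the sum \<open>outflow\<close> vanishes, so does each of its
  terms.\<close>

lemma pmf_target: "outflow y x * pmf (target y x) z = off Ls y z * \<Lambda> z x"
proof (cases "outflow y x = 0")
  case True
  have "ennreal (off Ls y z) * ennreal (\<Lambda> z x) \<le> ennreal (outflow y x)"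
    unfolding nn_integral_outflow[symmetric]
    by (rule nn_integral_ge_point[of z UNIV "\<lambda>z. ennreal (off Ls y z) * ennreal (\<Lambda> z x)"]) simp
  then show ?thesis using True off_nonneg[OF gen_s] kernel_nonneg
    by (simp add: ennreal_mult[symmetric] antisym)
next
  case False
  then have o: "0 < outflow y x" using outflow_nonneg[of y x] by simp
  have "(\<integral>\<^sup>+z. ennreal (off Ls y z * \<Lambda> z x / outflow y x) \<partial>count_space UNIV)
    = (\<integral>\<^sup>+z. ennreal (1 / outflow y x) * (ennreal (off Ls y z) * ennreal (\<Lambda> z x)) \<partial>count_space UNIV)"
    using o off_nonneg[OF gen_s] kernel_nonneg
    by (intro nn_integral_cong) (simp add: ennreal_mult[symmetric])
  also have "\<dots> = 1"
    using o by (simp add: nn_integral_cmult nn_integral_outflow ennreal_mult[symmetric])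
  finally have "pmf (target y x) z = off Ls y z * \<Lambda> z x / outflow y x"
    unfolding target_def using False o off_nonneg[OF gen_s] kernel_nonneg
    by (simp add: pmf_embed_pmf)
  then show ?thesis using False by simp
qed

text \<open>By \<open>balance\<close>, \<open>outflow - inflow\<close> equals
  \<open>\<Lambda> y x * (dual_rate y - rate x)\<close>. If this is at most 0, the alarm has no
  effective rate and a fraction of the jumps into \<open>x\<close> carries the whole outflow.
  Otherwise all these jumps end the stay, and the alarm supplies exactly the deficit.\<close>

lemma halting_flow: "\<Lambda> y x * alarm_rate y x + inflow y x * joint_prob y x = outflow y x"
proof (cases "outflow y x \<le> inflow y x")
  case True
  then have "inflow y x * joint_prob y x = outflow y x"
    using outflow_nonneg[of y x] by (auto simp: joint_prob_def max_def)
  moreover have "\<Lambda> y x * dual_rate y \<le> \<Lambda> y x * rate x"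
    using True balance[of y x] by (simp add: mult.commute)
  then have "\<Lambda> y x * alarm_rate y x = 0"
    using kernel_nonneg[of y x] by (cases "\<Lambda> y x = 0") (auto simp: alarm_rate_def max_def)
  ultimately show ?thesis by simp
next
  case False
  then have "joint_prob y x = 1" using inflow_nonneg[of y x] by (simp add: joint_prob_def max_def)
  moreover have "\<Lambda> y x * rate x < \<Lambda> y x * dual_rate y"
    using False balance[of y x] by (simp add: mult.commute)
  then have "alarm_rate y x = dual_rate y - rate x"
    using kernel_nonneg[of y x] by (auto simp: alarm_rate_def max_def mult_less_cancel_left)
  then have "\<Lambda> y x * alarm_rate y x = dual_rate y * \<Lambda> y x - \<Lambda> y x * rate x"
    by (simp only: right_diff_distrib mult.commute[of "dual_rate y"])
  ultimately show ?thesis using balance[of y x] by simp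
qed

text \<open>The equation that preserves \<open>\<Lambda> y\<close> during a stay: mass at
  \<open>x\<close> is lost at total rate \<open>max (rate x) (dual_rate y)\<close>, and the jumps of
  X that do not end the stay return all but a loss at rate \<open>dual_rate y\<close>.\<close>

lemma staying_flow: "inflow y x * (1 - joint_prob y x) = \<Lambda> y x * (max (rate x) (dual_rate y) - dual_rate y)"
proof -
  have "\<Lambda> y x * (max (rate x) (dual_rate y) - dual_rate y) = \<Lambda> y x * rate x + \<Lambda> y x * alarm_rate y x - dual_rate y * \<Lambda> y x"
    by (simp add: rate_plus_alarm_rate[of x y, symmetric] algebra_simps)
  then show ?thesis using halting_flow[of y x] balance[of y x] by (simp add: algebra_simps)
qed

lemma nn_integral_coin:
  "(\<integral>\<^sup>+b. f b \<partial>measure_pmf (coin y x)) = ennreal (joint_prob y x) * (\<integral>\<^sup>+z. f (Some z) \<partial>measure_pmf (target y x))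
    + ennreal (1 - joint_prob y x) * f None"
  unfolding coin_def using joint_prob_bounds[of y x]
  by (simp add: mult.commute)

end

section \<open>One step of a stay of the dual process\<close>

abbreviation noise :: "(real \<times> real) stream measure" where
  "noise \<equiv> stream_space step_noise"

lemma prob_space_noise: "prob_space noise"
  by (rule prob_space.prob_space_stream_space[OF prob_space_step_noise])

lemma measurable_nn_integral_noise [measurable (raw)]:
  assumes [measurable]: "(\<lambda>(w, \<omega>). F w \<omega>) \<in> borel_measurable (M \<Otimes>\<^sub>M noise)"
  shows "(\<lambda>w. \<integral>\<^sup>+\<omega>. F w \<omega> \<partial>noise) \<in> borel_measurable M"
proof -
  interpret prob_space noise by (rule prob_space_noise)
  show ?thesis by measurable
qed

lemma measurable_nn_integral_jump_law [measurable (raw)]: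
  assumes [measurable]: "(\<lambda>(w, d). F w d) \<in> borel_measurable (M \<Otimes>\<^sub>M itinerary_space)"
  shows "(\<lambda>w. \<integral>\<^sup>+d. F w d \<partial>jump_law L p) \<in> borel_measurable M"
proof -
  interpret prob_space "jump_law L p" by (rule prob_space_jump_law)
  show ?thesis by measurable
qed

lemma nn_integral_noise:
  assumes [measurable]: "f \<in> borel_measurable noise"
  shows "(\<integral>\<^sup>+\<omega>. f \<omega> \<partial>noise) = (\<integral>\<^sup>+u. \<integral>\<^sup>+v. \<integral>\<^sup>+\<omega>. f ((u, v) ## \<omega>) \<partial>noise \<partial>unit_uniform \<partial>unit_uniform)"
proof -
  interpret step_noise: prob_space step_noise by (rule prob_space_step_noise)
  interpret unit_uniform: prob_space unit_uniform by (rule prob_space_unit_uniform)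
  have "(\<integral>\<^sup>+\<omega>. f \<omega> \<partial>noise) = (\<integral>\<^sup>+u. \<integral>\<^sup>+\<omega>. f (u ## \<omega>) \<partial>noise \<partial>step_noise)"
    by (rule step_noise.nn_integral_stream_space) measurable
  also have "\<dots> = (\<integral>\<^sup>+u. \<integral>\<^sup>+v. \<integral>\<^sup>+\<omega>. f ((u, v) ## \<omega>) \<partial>noise \<partial>unit_uniform \<partial>unit_uniform)"
    unfolding step_noise_def by (subst unit_uniform.nn_integral_fst[symmetric]) (simp_all add: step_noise_def[symmetric])
  finally show ?thesis .
qed

text \<open>With the measurability hypothesis on a variable function inserted, this and its
  analogues become rules for \<open>measurable\<close> that apply to curried functions under
  integrals.\<close>

lemma measurable_app2:
  assumes A: "(\<lambda>(s, z). A s z) \<in> S \<Otimes>\<^sub>M C \<rightarrow>\<^sub>M R"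
    and [measurable]: "f \<in> N \<rightarrow>\<^sub>M S" "g \<in> N \<rightarrow>\<^sub>M C"
  shows "(\<lambda>x. A (f x) (g x)) \<in> N \<rightarrow>\<^sub>M R"
proof -
  have "(\<lambda>x. (f x, g x)) \<in> N \<rightarrow>\<^sub>M S \<Otimes>\<^sub>M C" by measurable
  from measurable_compose[OF this A] show ?thesis by simp
qed

lemma measurable_app3:
  assumes A: "(\<lambda>(s, z, d). A s z d) \<in> S \<Otimes>\<^sub>M C \<Otimes>\<^sub>M D \<rightarrow>\<^sub>M R"
    and [measurable]: "f \<in> N \<rightarrow>\<^sub>M S" "g \<in> N \<rightarrow>\<^sub>M C" "h \<in> N \<rightarrow>\<^sub>M D"
  shows "(\<lambda>x. A (f x) (g x) (h x)) \<in> N \<rightarrow>\<^sub>M R"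
proof -
  have "(\<lambda>x. (f x, g x, h x)) \<in> N \<rightarrow>\<^sub>M S \<Otimes>\<^sub>M C \<Otimes>\<^sub>M D" by measurable
  from measurable_compose[OF this A] show ?thesis by simp
qed

lemma measurable_app4:
  assumes A: "(\<lambda>(s, z, d, e). A s z d e) \<in> S \<Otimes>\<^sub>M C \<Otimes>\<^sub>M D \<Otimes>\<^sub>M E \<rightarrow>\<^sub>M R"
    and [measurable]: "f \<in> N \<rightarrow>\<^sub>M S" "g \<in> N \<rightarrow>\<^sub>M C" "h \<in> N \<rightarrow>\<^sub>M D" "i \<in> N \<rightarrow>\<^sub>M E"
  shows "(\<lambda>x. A (f x) (g x) (h x) (i x)) \<in> N \<rightarrow>\<^sub>M R"
proof -
  have "(\<lambda>x. (f x, g x, h x, i x)) \<in> N \<rightarrow>\<^sub>M S \<Otimes>\<^sub>M C \<Otimes>\<^sub>M D \<Otimes>\<^sub>M E" by measurable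
  from measurable_compose[OF this A] show ?thesis by simp
qed

context intertwining
begin

definition alarm :: "'t \<Rightarrow> ('s \<times> ennreal) stream \<Rightarrow> (real \<times> real) stream \<Rightarrow> ennreal" where
  "alarm y d \<omega> = sampler (expo (alarm_rate y (fst (shd d)))) (fst (shd \<omega>))"

definition alarm_target :: "'t \<Rightarrow> ('s \<times> ennreal) stream \<Rightarrow> (real \<times> real) stream \<Rightarrow> 't" where
  "alarm_target y d \<omega> = sampler (measure_pmf (target y (fst (shd d)))) (snd (shd \<omega>))"

text \<open>It looks at the state that X enters next, so it may be consulted only once the current
  holding time is over. Sharing a uniform variable with \<open>alarm_target\<close> is harmless: a
  step uses one of the two at most.\<close>

definition coin_toss :: "'t \<Rightarrow> ('s \<times> ennreal) stream \<Rightarrow> (real \<times> real) stream \<Rightarrow> 't option" where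
  "coin_toss y d \<omega> = sampler (measure_pmf (coin y (fst (shd (stl d))))) (snd (shd \<omega>))"

definition advance :: "ennreal \<Rightarrow> ('s \<times> ennreal) stream \<Rightarrow> ('s \<times> ennreal) stream" where
  "advance s d = (fst (shd d), snd (shd d) - s) ## stl d"

lemma measurable_advance [measurable (raw)]:
  assumes [measurable]: "s \<in> borel_measurable M" "d \<in> M \<rightarrow>\<^sub>M itinerary_space"
  shows "(\<lambda>x. advance (s x) (d x)) \<in> M \<rightarrow>\<^sub>M itinerary_space"
  unfolding advance_def by measurable

lemma measurable_alarm [measurable (raw)]:
  assumes [measurable]: "d \<in> M \<rightarrow>\<^sub>M itinerary_space" "\<omega> \<in> M \<rightarrow>\<^sub>M noise"
  shows "(\<lambda>x. alarm y (d x) (\<omega> x)) \<in> borel_measurable M"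
    and "(\<lambda>x. alarm_target y (d x) (\<omega> x)) \<in> M \<rightarrow>\<^sub>M count_space UNIV"
    and "(\<lambda>x. coin_toss y (d x) (\<omega> x)) \<in> M \<rightarrow>\<^sub>M count_space UNIV"
  unfolding alarm_def alarm_target_def coin_toss_def
  by (intro measurable_sampler_expo measurable_sampler_pmf; measurable)+

text \<open>The total rate in the race between the jump of X and the alarm, by
  \<open>rate_plus_alarm_rate\<close>. That it is at least \<open>dual_rate y\<close> makes the
  resolvent equation applicable.\<close>

definition tilted_rate :: "'t \<Rightarrow> 's \<Rightarrow> real" where
  "tilted_rate y x = max (rate x) (dual_rate y)"

text \<open>\<open>expo_race\<close> with the holding time of X and the alarm. After an alarm the
  advanced itinerary is again one of X started at \<open>x\<close>, by memorylessness; after a jump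
  it is one started at \<open>x'\<close>. \<open>A\<close> and \<open>B\<close> are the rewards in
  the two cases, and a step in which neither happens earns nothing.\<close>

lemma nn_integral_step:
  assumes A: "(\<lambda>(s, z, d). A s z d) \<in> borel_measurable (borel \<Otimes>\<^sub>M count_space UNIV \<Otimes>\<^sub>M itinerary_space)"
    and B: "(\<lambda>(s, b, d, \<omega>). B s b d \<omega>) \<in> borel_measurable (borel \<Otimes>\<^sub>M count_space UNIV \<Otimes>\<^sub>M itinerary_space \<Otimes>\<^sub>M noise)"
  shows "(\<integral>\<^sup>+d. \<integral>\<^sup>+\<omega>. (if alarm y d \<omega> < snd (shd d) then A (alarm y d \<omega>) (alarm_target y d \<omega>) (advance (alarm y d \<omega>) d)
      else if snd (shd d) < \<infinity> then B (snd (shd d)) (coin_toss y d \<omega>) (stl d) (stl \<omega>) else 0) \<partial>noise \<partial>jump_law_at L x)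
    = ennreal (alarm_rate y x) * laplace (tilted_rate y x) (\<lambda>s. \<integral>\<^sup>+d. \<integral>\<^sup>+z. A s z d \<partial>measure_pmf (target y x) \<partial>jump_law_at L x)
      + (\<integral>\<^sup>+x'. ennreal (off L x x') * laplace (tilted_rate y x)
          (\<lambda>s. \<integral>\<^sup>+d. \<integral>\<^sup>+b. \<integral>\<^sup>+\<omega>. B s b d \<omega> \<partial>noise \<partial>measure_pmf (coin y x') \<partial>jump_law_at L x') \<partial>count_space UNIV)"
    (is "(\<integral>\<^sup>+d. \<integral>\<^sup>+\<omega>. ?\<Phi> d \<omega> \<partial>noise \<partial>_) = _")
proof -
  note [measurable (raw)] = measurable_app3[OF A] measurable_app4[OF B]
  let ?J = "jump_law L (jump_pmf L x)" and ?e = "alarm_rate y x"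
  interpret J: prob_space ?J by (rule prob_space_jump_law)
  interpret e: prob_space "expo ?e" by (rule prob_space_expo)
  interpret eJ: pair_sigma_finite "expo ?e" ?J ..
  interpret unit_uniform: prob_space unit_uniform by (rule prob_space_unit_uniform)
  define GA where "GA s r d = (\<integral>\<^sup>+z. A s z ((x, r) ## d) \<partial>measure_pmf (target y x))" for s r d
  define H where "H w d = (if w < \<infinity> then \<integral>\<^sup>+v. \<integral>\<^sup>+\<omega>. B w (sampler (measure_pmf (coin y (fst (shd d)))) v) d \<omega> \<partial>noise \<partial>unit_uniform else 0)" for w d
  have GA: "(\<lambda>(s, r, d). GA s r d) \<in> borel_measurable (borel \<Otimes>\<^sub>M borel \<Otimes>\<^sub>M itinerary_space)"
    unfolding GA_def by measurable
  have H: "(\<lambda>(w, d). H w d) \<in> borel_measurable (borel \<Otimes>\<^sub>M itinerary_space)"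
    unfolding H_def by measurable
  note [measurable (raw)] = measurable_app3[OF GA] measurable_app2[OF H]
  have [measurable]: "(\<lambda>(d, \<omega>). ?\<Phi> d \<omega>) \<in> borel_measurable (itinerary_space \<Otimes>\<^sub>M noise)"
    by measurable
  have inner: "(\<integral>\<^sup>+\<omega>. ?\<Phi> ((x, w) ## d) \<omega> \<partial>noise) = (\<integral>\<^sup>+s. (if s < w then GA s (w - s) d else H w d) \<partial>expo ?e)" for w d
  proof -
    have "(\<integral>\<^sup>+\<omega>. ?\<Phi> ((x, w) ## d) \<omega> \<partial>noise)
      = (\<integral>\<^sup>+u. \<integral>\<^sup>+v. \<integral>\<^sup>+\<omega>. ?\<Phi> ((x, w) ## d) ((u, v) ## \<omega>) \<partial>noise \<partial>unit_uniform \<partial>unit_uniform)"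
      by (rule nn_integral_noise) measurable
    also have "\<dots> = (\<integral>\<^sup>+u. (if sampler (expo ?e) u < w then GA (sampler (expo ?e) u) (w - sampler (expo ?e) u) d else H w d) \<partial>unit_uniform)"
    proof (intro nn_integral_cong)
      fix u
      let ?s = "sampler (expo ?e) u"
      interpret noise: prob_space noise by (rule prob_space_noise)
      show "(\<integral>\<^sup>+v. \<integral>\<^sup>+\<omega>. ?\<Phi> ((x, w) ## d) ((u, v) ## \<omega>) \<partial>noise \<partial>unit_uniform) = (if ?s < w then GA ?s (w - ?s) d else H w d)"
      proof (cases "?s < w")
        case True
        have "(\<integral>\<^sup>+v. \<integral>\<^sup>+\<omega>. ?\<Phi> ((x, w) ## d) ((u, v) ## \<omega>) \<partial>noise \<partial>unit_uniform)
          = (\<integral>\<^sup>+v. A ?s (sampler (measure_pmf (target y x)) v) ((x, w - ?s) ## d) \<partial>unit_uniform)"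
          using True by (simp add: alarm_def alarm_target_def advance_def noise.emeasure_space_1)
        also have "\<dots> = GA ?s (w - ?s) d"
          unfolding GA_def by (rule nn_integral_sampler[OF coded_measure_pmf prob_space_measure_pmf]) simp
        finally show ?thesis using True by simp
      next
        case False
        then show ?thesis
          by (simp add: alarm_def coin_toss_def H_def)
      qed
    qed
    also have "\<dots> = (\<integral>\<^sup>+s. (if s < w then GA s (w - s) d else H w d) \<partial>expo ?e)"
      by (rule nn_integral_sampler[OF coded_expo prob_space_expo]) measurable
    finally show ?thesis .
  qed
  have "(\<integral>\<^sup>+d. \<integral>\<^sup>+\<omega>. ?\<Phi> d \<omega> \<partial>noise \<partial>jump_law_at L x)
    = (\<integral>\<^sup>+w. \<integral>\<^sup>+x'. \<integral>\<^sup>+d. (\<integral>\<^sup>+s. (if s < w then GA s (w - s) d else H w d) \<partial>expo ?e) \<partial>jump_law_at L x'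
         \<partial>measure_pmf (jump_pmf L x) \<partial>expo (rate x))"
    unfolding inner[symmetric] by (rule nn_integral_jump_law_at) measurable
  also have "\<dots> = (\<integral>\<^sup>+w. \<integral>\<^sup>+d. \<integral>\<^sup>+s. (if s < w then GA s (w - s) d else H w d) \<partial>expo ?e \<partial>?J \<partial>expo (rate x))"
    by (intro nn_integral_cong nn_integral_jump_law[symmetric]) measurable
  also have "\<dots> = (\<integral>\<^sup>+w. \<integral>\<^sup>+s. \<integral>\<^sup>+d. (if s < w then GA s (w - s) d else H w d) \<partial>?J \<partial>expo ?e \<partial>expo (rate x))"
    by (intro nn_integral_cong eJ.Fubini') measurable
  also have "\<dots> = (\<integral>\<^sup>+w. \<integral>\<^sup>+s. (if s < w then (\<integral>\<^sup>+d. GA s (w - s) d \<partial>?J) else (\<integral>\<^sup>+d. H w d \<partial>?J)) \<partial>expo ?e \<partial>expo (rate x))"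
    by (intro nn_integral_cong) simp
  also have "\<dots> = ennreal ?e * laplace (rate x + ?e) (\<lambda>s. \<integral>\<^sup>+w. (\<integral>\<^sup>+d. GA s w d \<partial>?J) \<partial>expo (rate x))
      + ennreal (rate x) * laplace (rate x + ?e) (\<lambda>w. \<integral>\<^sup>+d. H w d \<partial>?J)"
    by (rule expo_race) (auto simp: rate_nonneg alarm_rate_nonneg H_def)
  \<comment> \<open>The fresh residual holding time and the unchanged law of the next state
    reassemble the law of X started at \<open>x\<close>.\<close>
  also have "(\<lambda>s. \<integral>\<^sup>+w. (\<integral>\<^sup>+d. GA s w d \<partial>?J) \<partial>expo (rate x))
      = (\<lambda>s. \<integral>\<^sup>+d. \<integral>\<^sup>+z. A s z d \<partial>measure_pmf (target y x) \<partial>jump_law_at L x)"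
    unfolding GA_def
    by (intro ext, subst nn_integral_jump_law_at, measurable, intro nn_integral_cong nn_integral_jump_law) measurable
  also have "ennreal (rate x) * laplace (rate x + ?e) (\<lambda>w. \<integral>\<^sup>+d. H w d \<partial>?J)
    = (\<integral>\<^sup>+x'. ennreal (off L x x') * laplace (rate x + ?e)
          (\<lambda>s. \<integral>\<^sup>+d. \<integral>\<^sup>+b. \<integral>\<^sup>+\<omega>. B s b d \<omega> \<partial>noise \<partial>measure_pmf (coin y x') \<partial>jump_law_at L x') \<partial>count_space UNIV)"
    (is "_ = (\<integral>\<^sup>+x'. _ * laplace _ (?K x') \<partial>_)")
  proof -
    have K [measurable]: "?K x' \<in> borel_measurable borel" for x' by measurable
    have "laplace (rate x + ?e) (\<lambda>w. \<integral>\<^sup>+d. H w d \<partial>?J)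
      = laplace (rate x + ?e) (\<lambda>w. \<integral>\<^sup>+x'. ennreal (jump_prob L x x') * ?K x' w \<partial>count_space UNIV)"
    proof (rule laplace_cong)
      fix s :: real assume "0 \<le> s"
      have "(\<integral>\<^sup>+d. H (ennreal s) d \<partial>?J) = (\<integral>\<^sup>+x'. \<integral>\<^sup>+d. H (ennreal s) d \<partial>jump_law_at L x' \<partial>measure_pmf (jump_pmf L x))"
        by (rule nn_integral_jump_law) measurable
      also have "\<dots> = (\<integral>\<^sup>+x'. ?K x' (ennreal s) \<partial>measure_pmf (jump_pmf L x))"
      proof (rule nn_integral_cong, rule nn_integral_cong_AE)
        fix x'
        have "(\<integral>\<^sup>+v. \<integral>\<^sup>+\<omega>. B (ennreal s) (sampler (measure_pmf (coin y x')) v) d \<omega> \<partial>noise \<partial>unit_uniform)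
          = (\<integral>\<^sup>+b. \<integral>\<^sup>+\<omega>. B (ennreal s) b d \<omega> \<partial>noise \<partial>measure_pmf (coin y x'))" for d
          by (rule nn_integral_sampler[OF coded_measure_pmf prob_space_measure_pmf]) simp
        then show "AE d in jump_law_at L x'. H (ennreal s) d = (\<integral>\<^sup>+b. \<integral>\<^sup>+\<omega>. B (ennreal s) b d \<omega> \<partial>noise \<partial>measure_pmf (coin y x'))"
          using AE_jump_law_at_shd[where x = x' and L = L] by (auto simp: H_def elim!: eventually_mono)
      qed
      also have "\<dots> = (\<integral>\<^sup>+x'. ennreal (jump_prob L x x') * ?K x' (ennreal s) \<partial>count_space UNIV)"
        by (simp add: nn_integral_measure_pmf pmf_jump_pmf[OF gen])
      finally show "(\<integral>\<^sup>+d. H (ennreal s) d \<partial>?J) = \<dots>" .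
    qed
    also have "\<dots> = (\<integral>\<^sup>+x'. ennreal (jump_prob L x x') * laplace (rate x + ?e) (?K x') \<partial>count_space UNIV)"
      by (subst laplace_sum_count_space) (simp_all add: laplace_cmult)
    finally have "ennreal (rate x) * laplace (rate x + ?e) (\<lambda>w. \<integral>\<^sup>+d. H w d \<partial>?J)
      = (\<integral>\<^sup>+x'. ennreal (rate x) * (ennreal (jump_prob L x x') * laplace (rate x + ?e) (?K x')) \<partial>count_space UNIV)"
      by (simp add: nn_integral_cmult)
    also have "\<dots> = (\<integral>\<^sup>+x'. ennreal (off L x x') * laplace (rate x + ?e) (?K x') \<partial>count_space UNIV)"
    proof (intro nn_integral_cong)
      fix x'
      have "ennreal (rate x) * ennreal (jump_prob L x x') = ennreal (off L x x')"
        using jump_rate_times_jump_prob[OF gen, of x x'] rate_nonneg jump_prob_nonneg[OF gen]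
        by (simp add: ennreal_mult[symmetric])
      then show "ennreal (rate x) * (ennreal (jump_prob L x x') * laplace (rate x + ?e) (?K x'))
        = ennreal (off L x x') * laplace (rate x + ?e) (?K x')" by (simp add: mult.assoc[symmetric])
    qed
    finally show ?thesis .
  qed
  finally show ?thesis unfolding tilted_rate_def rate_plus_alarm_rate .
qed

section \<open>The reward operator and its conservation law\<close>

definition stay_flow :: "'t \<Rightarrow> (ennreal \<Rightarrow> 's \<Rightarrow> ennreal) \<Rightarrow> ennreal \<Rightarrow> 's \<Rightarrow> ennreal" where
  "stay_flow y k r x = (\<integral>\<^sup>+x'. ennreal (off L x x') * ennreal (1 - joint_prob y x') * k r x' \<partial>count_space UNIV)"

text \<open>Here \<open>k r x\<close> is the reward for arriving at \<open>x\<close> at age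
  \<open>r\<close> of the stay. The operator gives the expected reward at the next arrival if the
  stay survives until then; \<open>stay_flow\<close> weights the jumps of X by the probability of
  not ending the stay.\<close>

definition step_operator :: "'t \<Rightarrow> (ennreal \<Rightarrow> 's \<Rightarrow> ennreal) \<Rightarrow> ennreal \<Rightarrow> 's \<Rightarrow> ennreal" where
  "step_operator y k r x = laplace (tilted_rate y x) (\<lambda>s. stay_flow y k (r + s) x)"

definition initial_value :: "'t \<Rightarrow> (ennreal \<Rightarrow> 's \<Rightarrow> ennreal) \<Rightarrow> ennreal" where
  "initial_value y k = (\<integral>\<^sup>+x. ennreal (\<Lambda> y x) * k 0 x \<partial>count_space UNIV)"

text \<open>What \<open>k\<close> would collect in total at the arrivals after the first one if at
  age \<open>s\<close> the mass of X at \<open>x\<close> were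
  \<open>exp (- (dual_rate y * s)) * \<Lambda> y x\<close>: by \<open>staying_flow\<close>, such
  arrivals would occur at \<open>x\<close> with the weight used here.\<close>

definition excess :: "'t \<Rightarrow> (ennreal \<Rightarrow> 's \<Rightarrow> ennreal) \<Rightarrow> ennreal" where
  "excess y k = (\<integral>\<^sup>+x. ennreal (\<Lambda> y x) * (ennreal (tilted_rate y x - dual_rate y) * laplace (dual_rate y) (\<lambda>s. k s x)) \<partial>count_space UNIV)"

lemma dual_rate_le_tilted_rate: "dual_rate y \<le> tilted_rate y x"
  by (simp add: tilted_rate_def)

text \<open>The resolvent equation from \<open>tilted_rate y x\<close> down to
  \<open>dual_rate y\<close>: summed over all steps, clocks with rates depending on \<open>x\<close>
  amount to a single clock of the dual process.\<close>

lemma initial_plus_excess_laplace: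
  assumes [measurable]: "\<And>x. (\<lambda>s. h s x) \<in> borel_measurable borel"
  shows "initial_value y (\<lambda>r x. laplace (tilted_rate y x) (\<lambda>s. h (r + s) x)) + excess y (\<lambda>r x. laplace (tilted_rate y x) (\<lambda>s. h (r + s) x))
    = (\<integral>\<^sup>+x. ennreal (\<Lambda> y x) * laplace (dual_rate y) (\<lambda>s. h s x) \<partial>count_space UNIV)"
  unfolding initial_value_def excess_def
proof (subst nn_integral_add[symmetric])
  show "(\<integral>\<^sup>+x. ennreal (\<Lambda> y x) * laplace (tilted_rate y x) (\<lambda>s. h (0 + s) x)
       + ennreal (\<Lambda> y x) * (ennreal (tilted_rate y x - dual_rate y) * laplace (dual_rate y) (\<lambda>r. laplace (tilted_rate y x) (\<lambda>s. h (r + s) x))) \<partial>count_space UNIV)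
    = (\<integral>\<^sup>+x. ennreal (\<Lambda> y x) * laplace (dual_rate y) (\<lambda>s. h s x) \<partial>count_space UNIV)"
    using laplace_resolvent[OF dual_rate_le_tilted_rate assms]
    by (intro nn_integral_cong) (simp only: distrib_left[symmetric] add_0_left)
qed auto

lemma measurable_stay_flow [measurable]:
  assumes [measurable]: "\<And>x. (\<lambda>r. k r x) \<in> borel_measurable borel"
  shows "(\<lambda>r. stay_flow y k r x) \<in> borel_measurable borel"
  unfolding stay_flow_def by measurable

lemma measurable_step_operator:
  assumes [measurable]: "\<And>x. (\<lambda>r. k r x) \<in> borel_measurable borel"
  shows "(\<lambda>r. step_operator y k r x) \<in> borel_measurable borel"
  unfolding step_operator_def by measurable

lemma nn_integral_inflow_stay:
  assumes [measurable]: "\<And>x. (\<lambda>r. k r x) \<in> borel_measurable borel"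
  shows "(\<integral>\<^sup>+x. ennreal (\<Lambda> y x) * laplace a (\<lambda>s. stay_flow y k s x) \<partial>count_space UNIV)
    = (\<integral>\<^sup>+x'. ennreal (inflow y x' * (1 - joint_prob y x')) * laplace a (\<lambda>s. k s x') \<partial>count_space UNIV)"
proof -
  have "(\<integral>\<^sup>+x. ennreal (\<Lambda> y x) * laplace a (\<lambda>s. stay_flow y k s x) \<partial>count_space UNIV)
    = (\<integral>\<^sup>+x. \<integral>\<^sup>+x'. (ennreal (\<Lambda> y x) * ennreal (off L x x')) * (ennreal (1 - joint_prob y x') * laplace a (\<lambda>s. k s x')) \<partial>count_space UNIV \<partial>count_space UNIV)"
  proof (intro nn_integral_cong)
    fix x
    have "laplace a (\<lambda>s. stay_flow y k s x)
      = (\<integral>\<^sup>+x'. ennreal (off L x x') * ennreal (1 - joint_prob y x') * laplace a (\<lambda>s. k s x') \<partial>count_space UNIV)"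
      unfolding stay_flow_def by (subst laplace_sum_count_space) (simp_all add: laplace_cmult)
    then show "ennreal (\<Lambda> y x) * laplace a (\<lambda>s. stay_flow y k s x)
      = (\<integral>\<^sup>+x'. (ennreal (\<Lambda> y x) * ennreal (off L x x')) * (ennreal (1 - joint_prob y x') * laplace a (\<lambda>s. k s x')) \<partial>count_space UNIV)"
      by (simp add: nn_integral_cmult[symmetric] mult.assoc)
  qed
  also have "\<dots> = (\<integral>\<^sup>+x'. \<integral>\<^sup>+x. (ennreal (\<Lambda> y x) * ennreal (off L x x')) * (ennreal (1 - joint_prob y x') * laplace a (\<lambda>s. k s x')) \<partial>count_space UNIV \<partial>count_space UNIV)"
    by (rule nn_integral_count_space_nn_integral) auto
  also have "\<dots> = (\<integral>\<^sup>+x'. ennreal (inflow y x' * (1 - joint_prob y x')) * laplace a (\<lambda>s. k s x') \<partial>count_space UNIV)"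
    using joint_prob_bounds inflow_nonneg
    by (intro nn_integral_cong, subst nn_integral_multc, simp) (simp add: nn_integral_inflow ennreal_mult mult.assoc)
  finally show ?thesis .
qed

text \<open>The resolvent equation merges the two terms on the left. Tonelli then collects the jumps
  by their endpoint, which turns the kernel into \<open>inflow\<close>, and
  \<open>staying_flow\<close> recognizes the weight in \<open>excess y k\<close>.\<close>

lemma step_operator_balance:
  assumes [measurable]: "\<And>x. (\<lambda>r. k r x) \<in> borel_measurable borel"
  shows "initial_value y (step_operator y k) + excess y (step_operator y k) = excess y k"
proof -
  have "initial_value y (step_operator y k) + excess y (step_operator y k)
    = (\<integral>\<^sup>+x. ennreal (\<Lambda> y x) * laplace (dual_rate y) (\<lambda>s. stay_flow y k s x) \<partial>count_space UNIV)"
    unfolding step_operator_def[abs_def] by (rule initial_plus_excess_laplace) measurable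
  also have "\<dots> = (\<integral>\<^sup>+x. ennreal (inflow y x * (1 - joint_prob y x)) * laplace (dual_rate y) (\<lambda>s. k s x) \<partial>count_space UNIV)"
    by (rule nn_integral_inflow_stay) measurable
  also have "\<dots> = excess y k"
    unfolding excess_def using kernel_nonneg
    by (intro nn_integral_cong) (simp add: staying_flow tilted_rate_def ennreal_mult' mult.assoc)
  finally show ?thesis .
qed

text \<open>By \<open>step_operator_balance\<close>, the sum of the initial values of the iterates telescopes.\<close>

lemma suminf_step_operator_le:
  assumes "\<And>x. (\<lambda>r. k r x) \<in> borel_measurable borel"
  shows "(\<Sum>n. initial_value y ((step_operator y ^^ n) k)) \<le> initial_value y k + excess y k"
proof (rule suminf_le_const)
  have meas: "(\<lambda>r. (step_operator y ^^ n) k r x) \<in> borel_measurable borel" for n x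
    by (induction n arbitrary: x) (auto intro: assms measurable_step_operator)
  have "(\<Sum>n<N. initial_value y ((step_operator y ^^ Suc n) k)) + excess y ((step_operator y ^^ N) k) = excess y k" for N
  proof (induction N)
    case (Suc N)
    then show ?case using step_operator_balance[of "(step_operator y ^^ N) k" y, OF meas] by (simp add: add.assoc)
  qed simp
  \<comment> \<open>The remainder, the excess of the \<open>N\<close>-th iterate, is dropped. It
    would be lost mass if the construction failed to exhaust an exponential stay, so only an
    inequality is available at this point.\<close>
  then have "(\<Sum>n<N. initial_value y ((step_operator y ^^ Suc n) k)) \<le> excess y k" for N
    by (metis le_iff_add)
  then have le: "initial_value y k + (\<Sum>n<N. initial_value y ((step_operator y ^^ Suc n) k)) \<le> initial_value y k + excess y k" for N
    by (rule add_left_mono)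
  show "(\<Sum>n<N. initial_value y ((step_operator y ^^ n) k)) \<le> initial_value y k + excess y k" for N
  proof (cases N)
    case (Suc M)
    then show ?thesis using le[of M] by (simp add: sum.lessThan_Suc_shift del: funpow.simps sum.lessThan_Suc)
  qed simp
qed simp

end

lemma nn_integral_pmf_swap:
  fixes f :: "'a \<Rightarrow> 'b::countable \<Rightarrow> ennreal"
  assumes [measurable]: "\<And>z. (\<lambda>d. f d z) \<in> borel_measurable M"
  shows "(\<integral>\<^sup>+d. \<integral>\<^sup>+z. f d z \<partial>measure_pmf p \<partial>M) = (\<integral>\<^sup>+z. \<integral>\<^sup>+d. f d z \<partial>M \<partial>measure_pmf p)"
  unfolding nn_integral_measure_pmf
  by (subst nn_integral_count_space_nn_integral) (simp_all add: nn_integral_cmult)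

lemma nn_integral_count_space_eq_termwise:
  fixes f g :: "'a::countable \<Rightarrow> ennreal"
  assumes le: "\<And>x. f x \<le> g x" and eq: "(\<integral>\<^sup>+x. f x \<partial>count_space UNIV) = (\<integral>\<^sup>+x. g x \<partial>count_space UNIV)"
    and fin: "(\<integral>\<^sup>+x. g x \<partial>count_space UNIV) < \<infinity>"
  shows "f x = g x"
proof -
  have "(\<integral>\<^sup>+x. (g x - f x) \<partial>count_space UNIV) = (\<integral>\<^sup>+x. g x \<partial>count_space UNIV) - (\<integral>\<^sup>+x. f x \<partial>count_space UNIV)"
    using eq fin le by (intro nn_integral_diff) (auto intro: AE_I2)
  also have "\<dots> = 0" using eq fin by simp
  finally have "g x - f x = 0"
    by (subst (asm) nn_integral_0_iff_AE) (auto simp: AE_count_space)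
  then have "g x \<le> f x"
    using nn_integral_ge_point[of x UNIV g] fin
    by (auto simp: ennreal_minus_eq_0)
  with le show ?thesis by (rule antisym)
qed

text \<open>A copy of \<^const>\<open>the\<close> that measurability proofs treat as an arbitrary function on a discrete space.\<close>

definition the_value :: "'a option \<Rightarrow> 'a" where
  "the_value = the"

lemma measurable_the_value [measurable]: "the_value \<in> count_space UNIV \<rightarrow>\<^sub>M count_space UNIV"
  by simp

section \<open>Episodes: single stays of the dual process\<close>

context intertwining
begin

definition start_law :: "'t \<Rightarrow> ('s \<times> ennreal) stream measure" where
  "start_law y = jump_law L (kernel_pmf y)"

lemma sets_start_law [simp, measurable_cong]: "sets (start_law y) = sets itinerary_space"
  by (simp add: start_law_def)

lemma space_start_law [simp]: "space (start_law y) = UNIV"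
  by (simp add: start_law_def)

lemma prob_space_start_law: "prob_space (start_law y)"
  by (simp add: start_law_def prob_space_jump_law)

lemma measurable_nn_integral_start_law [measurable (raw)]:
  assumes "(\<lambda>(w, d). F w d) \<in> borel_measurable (M \<Otimes>\<^sub>M itinerary_space)"
  shows "(\<lambda>w. \<integral>\<^sup>+d. F w d \<partial>start_law y) \<in> borel_measurable M"
  unfolding start_law_def by (rule measurable_nn_integral_jump_law[OF assms])

lemma nn_integral_start_law:
  assumes "f \<in> borel_measurable itinerary_space"
  shows "(\<integral>\<^sup>+d. f d \<partial>start_law y) = (\<integral>\<^sup>+x. ennreal (\<Lambda> y x) * (\<integral>\<^sup>+d. f d \<partial>jump_law_at L x) \<partial>count_space UNIV)"
  unfolding start_law_def by (simp add: nn_integral_jump_law[OF assms] nn_integral_measure_pmf pmf_kernel_pmf)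

text \<open>An episode is a stay of the dual process at \<open>y\<close>, while \<open>X\<close> follows the itinerary \<open>d\<close>. Every
  step of it uses one sojourn of \<open>X\<close> and one element of the noise \<open>\<omega>\<close>. The values \<open>\<infinity>\<close>, \<open>y\<close>, \<open>d\<close> for an
  episode that never ends are the right ones if \<open>y\<close> is absorbing; otherwise this is a null event.\<close>

definition rings :: "'t \<Rightarrow> ('s \<times> ennreal) stream \<Rightarrow> (real \<times> real) stream \<Rightarrow> bool" where
  "rings y d \<omega> \<longleftrightarrow> alarm y d \<omega> < snd (shd d)"

definition halts :: "'t \<Rightarrow> ('s \<times> ennreal) stream \<Rightarrow> (real \<times> real) stream \<Rightarrow> bool" where
  "halts y d \<omega> \<longleftrightarrow> rings y d \<omega> \<or> (snd (shd d) < \<infinity> \<and> coin_toss y d \<omega> \<noteq> None)"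

definition continues :: "'t \<Rightarrow> ('s \<times> ennreal) stream \<Rightarrow> (real \<times> real) stream \<Rightarrow> bool" where
  "continues y d \<omega> \<longleftrightarrow> \<not> rings y d \<omega> \<and> snd (shd d) < \<infinity> \<and> coin_toss y d \<omega> = None"

definition halt_time :: "'t \<Rightarrow> ('s \<times> ennreal) stream \<Rightarrow> (real \<times> real) stream \<Rightarrow> ennreal" where
  "halt_time y d \<omega> = (if rings y d \<omega> then alarm y d \<omega> else snd (shd d))"

definition halt_target :: "'t \<Rightarrow> ('s \<times> ennreal) stream \<Rightarrow> (real \<times> real) stream \<Rightarrow> 't" where
  "halt_target y d \<omega> = (if rings y d \<omega> then alarm_target y d \<omega> else the_value (coin_toss y d \<omega>))"

definition halt_rest :: "'t \<Rightarrow> ('s \<times> ennreal) stream \<Rightarrow> (real \<times> real) stream \<Rightarrow> ('s \<times> ennreal) stream" where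
  "halt_rest y d \<omega> = (if rings y d \<omega> then advance (alarm y d \<omega>) d else stl d)"

definition alive :: "nat \<Rightarrow> 't \<Rightarrow> ('s \<times> ennreal) stream \<Rightarrow> (real \<times> real) stream \<Rightarrow> bool" where
  "alive n y d \<omega> \<longleftrightarrow> (\<forall>k<n. continues y (sdrop k d) (sdrop k \<omega>))"

definition halts_at :: "nat \<Rightarrow> 't \<Rightarrow> ('s \<times> ennreal) stream \<Rightarrow> (real \<times> real) stream \<Rightarrow> bool" where
  "halts_at n y d \<omega> \<longleftrightarrow> alive n y d \<omega> \<and> halts y (sdrop n d) (sdrop n \<omega>)"

definition halt_index :: "'t \<Rightarrow> ('s \<times> ennreal) stream \<Rightarrow> (real \<times> real) stream \<Rightarrow> nat" where
  "halt_index y d \<omega> = (LEAST n. halts_at n y d \<omega>)"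

definition ended :: "'t \<Rightarrow> ('s \<times> ennreal) stream \<Rightarrow> (real \<times> real) stream \<Rightarrow> bool" where
  "ended y d \<omega> \<longleftrightarrow> (\<exists>n. halts_at n y d \<omega>)"

definition ep_time :: "'t \<Rightarrow> ('s \<times> ennreal) stream \<Rightarrow> (real \<times> real) stream \<Rightarrow> ennreal" where
  "ep_time y d \<omega> = (if ended y d \<omega> then let n = halt_index y d \<omega> in elapsed n d + halt_time y (sdrop n d) (sdrop n \<omega>) else \<infinity>)"

definition ep_target :: "'t \<Rightarrow> ('s \<times> ennreal) stream \<Rightarrow> (real \<times> real) stream \<Rightarrow> 't" where
  "ep_target y d \<omega> = (if ended y d \<omega> then let n = halt_index y d \<omega> in halt_target y (sdrop n d) (sdrop n \<omega>) else y)"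

definition ep_rest :: "'t \<Rightarrow> ('s \<times> ennreal) stream \<Rightarrow> (real \<times> real) stream \<Rightarrow> ('s \<times> ennreal) stream" where
  "ep_rest y d \<omega> = (if ended y d \<omega> then let n = halt_index y d \<omega> in halt_rest y (sdrop n d) (sdrop n \<omega>) else d)"

lemma measurable_halting [measurable (raw)]:
  assumes [measurable]: "d \<in> M \<rightarrow>\<^sub>M itinerary_space" "\<omega> \<in> M \<rightarrow>\<^sub>M noise"
  shows "Measurable.pred M (\<lambda>x. rings y (d x) (\<omega> x))"
    and "Measurable.pred M (\<lambda>x. halts y (d x) (\<omega> x))"
    and "Measurable.pred M (\<lambda>x. continues y (d x) (\<omega> x))"
    and "(\<lambda>x. halt_time y (d x) (\<omega> x)) \<in> borel_measurable M"
    and "(\<lambda>x. halt_target y (d x) (\<omega> x)) \<in> M \<rightarrow>\<^sub>M count_space UNIV"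
    and "(\<lambda>x. halt_rest y (d x) (\<omega> x)) \<in> M \<rightarrow>\<^sub>M itinerary_space"
proof -
  show r [measurable]: "Measurable.pred M (\<lambda>x. rings y (d x) (\<omega> x))"
    unfolding rings_def by measurable
  show "Measurable.pred M (\<lambda>x. halts y (d x) (\<omega> x))" "Measurable.pred M (\<lambda>x. continues y (d x) (\<omega> x))"
    unfolding halts_def continues_def by measurable
  show "(\<lambda>x. halt_time y (d x) (\<omega> x)) \<in> borel_measurable M" "(\<lambda>x. halt_target y (d x) (\<omega> x)) \<in> M \<rightarrow>\<^sub>M count_space UNIV"
    "(\<lambda>x. halt_rest y (d x) (\<omega> x)) \<in> M \<rightarrow>\<^sub>M itinerary_space"
    unfolding halt_time_def halt_target_def halt_rest_def by measurable
qed

lemma measurable_ended [measurable (raw)]: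
  assumes [measurable]: "d \<in> M \<rightarrow>\<^sub>M itinerary_space" "\<omega> \<in> M \<rightarrow>\<^sub>M noise"
  shows "Measurable.pred M (\<lambda>x. alive n y (d x) (\<omega> x))"
    and "Measurable.pred M (\<lambda>x. halts_at n y (d x) (\<omega> x))"
    and "Measurable.pred M (\<lambda>x. ended y (d x) (\<omega> x))"
    and "(\<lambda>x. halt_index y (d x) (\<omega> x)) \<in> M \<rightarrow>\<^sub>M count_space UNIV"
proof -
  show [measurable]: "Measurable.pred M (\<lambda>x. alive n y (d x) (\<omega> x))" for n
    unfolding alive_def by measurable
  show [measurable]: "Measurable.pred M (\<lambda>x. halts_at n y (d x) (\<omega> x))" for n
    unfolding halts_at_def by measurable
  show "Measurable.pred M (\<lambda>x. ended y (d x) (\<omega> x))" "(\<lambda>x. halt_index y (d x) (\<omega> x)) \<in> M \<rightarrow>\<^sub>M count_space UNIV"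
    unfolding ended_def halt_index_def by measurable
qed

lemma measurable_episode [measurable (raw)]:
  assumes [measurable]: "d \<in> M \<rightarrow>\<^sub>M itinerary_space" "\<omega> \<in> M \<rightarrow>\<^sub>M noise"
  shows "(\<lambda>x. ep_time y (d x) (\<omega> x)) \<in> borel_measurable M"
    and "(\<lambda>x. ep_target y (d x) (\<omega> x)) \<in> M \<rightarrow>\<^sub>M count_space UNIV"
    and "(\<lambda>x. ep_rest y (d x) (\<omega> x)) \<in> M \<rightarrow>\<^sub>M itinerary_space"
proof -
  have 1 [measurable]: "(\<lambda>x. elapsed (halt_index y (d x) (\<omega> x)) (d x) + halt_time y (sdrop (halt_index y (d x) (\<omega> x)) (d x)) (sdrop (halt_index y (d x) (\<omega> x)) (\<omega> x))) \<in> borel_measurable M"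
    by (rule measurable_compose_countable[of "\<lambda>n x. elapsed n (d x) + halt_time y (sdrop n (d x)) (sdrop n (\<omega> x))"]) measurable
  have 2 [measurable]: "(\<lambda>x. halt_target y (sdrop (halt_index y (d x) (\<omega> x)) (d x)) (sdrop (halt_index y (d x) (\<omega> x)) (\<omega> x))) \<in> M \<rightarrow>\<^sub>M count_space UNIV"
    by (rule measurable_compose_countable[of "\<lambda>n x. halt_target y (sdrop n (d x)) (sdrop n (\<omega> x))"]) measurable
  have 3 [measurable]: "(\<lambda>x. halt_rest y (sdrop (halt_index y (d x) (\<omega> x)) (d x)) (sdrop (halt_index y (d x) (\<omega> x)) (\<omega> x))) \<in> M \<rightarrow>\<^sub>M itinerary_space"
    by (rule measurable_compose_countable[of "\<lambda>n x. halt_rest y (sdrop n (d x)) (sdrop n (\<omega> x))"]) measurable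
  show "(\<lambda>x. ep_time y (d x) (\<omega> x)) \<in> borel_measurable M" "(\<lambda>x. ep_target y (d x) (\<omega> x)) \<in> M \<rightarrow>\<^sub>M count_space UNIV"
    "(\<lambda>x. ep_rest y (d x) (\<omega> x)) \<in> M \<rightarrow>\<^sub>M itinerary_space"
    unfolding ep_time_def ep_target_def ep_rest_def Let_def by measurable
qed

lemma continues_not_halts: "continues y d \<omega> \<Longrightarrow> \<not> halts y d \<omega>"
  by (auto simp: continues_def halts_def)

lemma halt_index_eqI: "halts_at n y d \<omega> \<Longrightarrow> halt_index y d \<omega> = n"
  unfolding halt_index_def halts_at_def alive_def
  by (rule Least_equality) (auto simp: not_less[symmetric] dest: continues_not_halts)

lemma halts_at_imp_ended: "halts_at n y d \<omega> \<Longrightarrow> ended y d \<omega>"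
  by (auto simp: ended_def)

text \<open>The reward \<open>R\<close> granted at the \<open>n\<close>-th step, provided that the
  stay survives the steps before it; \<open>r\<close> accumulates the age. The recursion mirrors the
  iterates of \<open>step_operator\<close>.\<close>

primrec later :: "'t \<Rightarrow> (ennreal \<Rightarrow> ('s \<times> ennreal) stream \<Rightarrow> (real \<times> real) stream \<Rightarrow> ennreal) \<Rightarrow> nat
    \<Rightarrow> ennreal \<Rightarrow> ('s \<times> ennreal) stream \<Rightarrow> (real \<times> real) stream \<Rightarrow> ennreal" where
  "later y R 0 r d \<omega> = R r d \<omega>"
| "later y R (Suc n) r d \<omega> = (if continues y d \<omega> then later y R n (r + snd (shd d)) (stl d) (stl \<omega>) else 0)"

lemma alive_Suc: "alive (Suc n) y d \<omega> \<longleftrightarrow> continues y d \<omega> \<and> alive n y (stl d) (stl \<omega>)"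
  unfolding alive_def All_less_Suc2 by simp

lemma later_eq: "later y R n r d \<omega> = (if alive n y d \<omega> then R (r + elapsed n d) (sdrop n d) (sdrop n \<omega>) else 0)"
proof (induction n arbitrary: r d \<omega>)
  case 0
  then show ?case by (simp add: alive_def)
next
  case (Suc n)
  then show ?case by (simp add: alive_Suc elapsed_Suc_shift add.assoc)
qed

lemma measurable_later:
  assumes "(\<lambda>(r, d, \<omega>). R r d \<omega>) \<in> borel_measurable (borel \<Otimes>\<^sub>M itinerary_space \<Otimes>\<^sub>M noise)"
  shows "(\<lambda>(r, d, \<omega>). later y R n r d \<omega>) \<in> borel_measurable (borel \<Otimes>\<^sub>M itinerary_space \<Otimes>\<^sub>M noise)"
proof -
  note [measurable (raw)] = measurable_app3[OF assms]
  show ?thesis unfolding later_eq by measurable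
qed

text \<open>\<open>nn_integral_step\<close> with no reward at an alarm and a reward only for the
  outcome \<open>None\<close> of the coin, whose probability \<open>1 - joint_prob y x'\<close> is
  the weight in \<open>stay_flow\<close>.\<close>

lemma nn_integral_later:
  assumes R: "(\<lambda>(r, d, \<omega>). R r d \<omega>) \<in> borel_measurable (borel \<Otimes>\<^sub>M itinerary_space \<Otimes>\<^sub>M noise)"
  shows "(\<integral>\<^sup>+d. \<integral>\<^sup>+\<omega>. later y R n r d \<omega> \<partial>noise \<partial>jump_law_at L x)
    = (step_operator y ^^ n) (\<lambda>r x. \<integral>\<^sup>+d. \<integral>\<^sup>+\<omega>. R r d \<omega> \<partial>noise \<partial>jump_law_at L x) r x"
proof (induction n arbitrary: r x)
  case (Suc n)
  note [measurable (raw)] = measurable_app3[OF measurable_later[OF R]]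
  define k where "k = (step_operator y ^^ n) (\<lambda>r x. \<integral>\<^sup>+d. \<integral>\<^sup>+\<omega>. R r d \<omega> \<partial>noise \<partial>jump_law_at L x)"
  note IH = Suc.IH[folded k_def]
  have k [measurable]: "(\<lambda>r. k r x) \<in> borel_measurable borel" for x
    unfolding IH[symmetric] by measurable
  have "(\<integral>\<^sup>+d. \<integral>\<^sup>+\<omega>. later y R (Suc n) r d \<omega> \<partial>noise \<partial>jump_law_at L x)
    = (\<integral>\<^sup>+d. \<integral>\<^sup>+\<omega>. (if alarm y d \<omega> < snd (shd d) then 0
        else if snd (shd d) < \<infinity> then (if coin_toss y d \<omega> = None then later y R n (r + snd (shd d)) (stl d) (stl \<omega>) else 0) else 0) \<partial>noise \<partial>jump_law_at L x)"
    by (intro nn_integral_cong) (auto simp: continues_def rings_def)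
  also have "\<dots> = ennreal (alarm_rate y x) * laplace (tilted_rate y x) (\<lambda>s. \<integral>\<^sup>+d. \<integral>\<^sup>+z. 0 \<partial>measure_pmf (target y x) \<partial>jump_law_at L x)
      + (\<integral>\<^sup>+x'. ennreal (off L x x') * laplace (tilted_rate y x)
          (\<lambda>s. \<integral>\<^sup>+d. \<integral>\<^sup>+b. \<integral>\<^sup>+\<omega>. (if b = None then later y R n (r + s) d \<omega> else 0) \<partial>noise \<partial>measure_pmf (coin y x') \<partial>jump_law_at L x') \<partial>count_space UNIV)"
    by (rule nn_integral_step[where A = "\<lambda>_ _ _. 0" and B = "\<lambda>s b d \<omega>. if b = None then later y R n (r + s) d \<omega> else 0"]) measurable
  also have "\<dots> = (\<integral>\<^sup>+x'. ennreal (off L x x') * laplace (tilted_rate y x) (\<lambda>s. ennreal (1 - joint_prob y x') * k (r + s) x') \<partial>count_space UNIV)"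
    by (simp add: laplace_def[of _ "\<lambda>_. 0"] nn_integral_coin nn_integral_cmult IH)
  also have "\<dots> = (\<integral>\<^sup>+x'. laplace (tilted_rate y x) (\<lambda>s. ennreal (off L x x') * ennreal (1 - joint_prob y x') * k (r + s) x') \<partial>count_space UNIV)"
    by (simp add: laplace_cmult mult.assoc)
  also have "\<dots> = step_operator y k r x"
    unfolding step_operator_def stay_flow_def by (subst laplace_sum_count_space) simp_all
  finally show ?case by (simp add: k_def)
next
  case 0
  show ?case unfolding later_eq alive_def by simp
qed

lemma nn_integral_start_law_later:
  assumes R: "(\<lambda>(r, d, \<omega>). R r d \<omega>) \<in> borel_measurable (borel \<Otimes>\<^sub>M itinerary_space \<Otimes>\<^sub>M noise)"
  shows "(\<Sum>n. \<integral>\<^sup>+d. \<integral>\<^sup>+\<omega>. later y R n 0 d \<omega> \<partial>noise \<partial>start_law y)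
    \<le> initial_value y (\<lambda>r x. \<integral>\<^sup>+d. \<integral>\<^sup>+\<omega>. R r d \<omega> \<partial>noise \<partial>jump_law_at L x)
      + excess y (\<lambda>r x. \<integral>\<^sup>+d. \<integral>\<^sup>+\<omega>. R r d \<omega> \<partial>noise \<partial>jump_law_at L x)"
proof -
  note [measurable (raw)] = measurable_app3[OF R] measurable_app3[OF measurable_later[OF R]]
  have "(\<integral>\<^sup>+d. \<integral>\<^sup>+\<omega>. later y R n 0 d \<omega> \<partial>noise \<partial>start_law y)
    = initial_value y ((step_operator y ^^ n) (\<lambda>r x. \<integral>\<^sup>+d. \<integral>\<^sup>+\<omega>. R r d \<omega> \<partial>noise \<partial>jump_law_at L x))" for n
    unfolding initial_value_def nn_integral_later[OF R, symmetric] by (rule nn_integral_start_law) measurable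
  then show ?thesis by (simp add: suminf_step_operator_le)
qed

text \<open>The mass that arrives at \<open>z\<close> when the dual process leaves \<open>y\<close>, by an alarm or by a simultaneous
  jump, is distributed over the states of \<open>X\<close> according to \<open>\<Lambda> z\<close>.\<close>

lemma nn_integral_halting_flow:
  fixes y :: 't and F :: "ennreal \<Rightarrow> 't \<Rightarrow> ('s \<times> ennreal) stream \<Rightarrow> ennreal"
  assumes F: "(\<lambda>(s, z, d). F s z d) \<in> borel_measurable (borel \<Otimes>\<^sub>M count_space UNIV \<Otimes>\<^sub>M itinerary_space)"
  defines "R \<equiv> \<lambda>r d \<omega>. if halts y d \<omega> then F (r + halt_time y d \<omega>) (halt_target y d \<omega>) (halt_rest y d \<omega>) else 0"
  shows "initial_value y (\<lambda>r x. \<integral>\<^sup>+d. \<integral>\<^sup>+\<omega>. R r d \<omega> \<partial>noise \<partial>jump_law_at L x)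
      + excess y (\<lambda>r x. \<integral>\<^sup>+d. \<integral>\<^sup>+\<omega>. R r d \<omega> \<partial>noise \<partial>jump_law_at L x)
    = (\<integral>\<^sup>+z. ennreal (off Ls y z) * laplace (dual_rate y) (\<lambda>s. \<integral>\<^sup>+d. F s z d \<partial>start_law z) \<partial>count_space UNIV)"
proof -
  note [measurable (raw)] = measurable_app3[OF F]
  define f where "f s z x = (\<integral>\<^sup>+d. F s z d \<partial>jump_law_at L x)" for s z x
  have f [measurable]: "(\<lambda>s. f s z x) \<in> borel_measurable borel" for z x unfolding f_def by measurable
  define g where "g s x = (\<integral>\<^sup>+z. f s z x \<partial>measure_pmf (target y x))" for s x
  have g [measurable]: "(\<lambda>s. g s x) \<in> borel_measurable borel" for x unfolding g_def by measurable
  \<comment> \<open>The rate of reward from ending the stay while X is at \<open>x\<close>: by an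
    alarm there, or by a jump to some \<open>x'\<close> that the coin declares simultaneous.\<close>
  define h where "h s x = ennreal (alarm_rate y x) * g s x
    + (\<integral>\<^sup>+x'. ennreal (off L x x') * (ennreal (joint_prob y x') * g s x') \<partial>count_space UNIV)" for s x
  have h [measurable]: "(\<lambda>s. h s x) \<in> borel_measurable borel" for x unfolding h_def by measurable
  interpret noise: prob_space noise by (rule prob_space_noise)
  have R: "(\<integral>\<^sup>+d. \<integral>\<^sup>+\<omega>. R r d \<omega> \<partial>noise \<partial>jump_law_at L x) = laplace (tilted_rate y x) (\<lambda>s. h (r + s) x)" for r x
  proof -
    have "(\<integral>\<^sup>+d. \<integral>\<^sup>+\<omega>. R r d \<omega> \<partial>noise \<partial>jump_law_at L x)
      = (\<integral>\<^sup>+d. \<integral>\<^sup>+\<omega>. (if alarm y d \<omega> < snd (shd d) then F (r + alarm y d \<omega>) (alarm_target y d \<omega>) (advance (alarm y d \<omega>) d)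
        else if snd (shd d) < \<infinity> then (if coin_toss y d \<omega> = None then 0 else F (r + snd (shd d)) (the_value (coin_toss y d \<omega>)) (stl d)) else 0) \<partial>noise \<partial>jump_law_at L x)"
      unfolding R_def by (intro nn_integral_cong) (auto simp: halts_def rings_def halt_time_def halt_target_def halt_rest_def)
    also have "\<dots> = ennreal (alarm_rate y x) * laplace (tilted_rate y x) (\<lambda>s. \<integral>\<^sup>+d. \<integral>\<^sup>+z. F (r + s) z d \<partial>measure_pmf (target y x) \<partial>jump_law_at L x)
      + (\<integral>\<^sup>+x'. ennreal (off L x x') * laplace (tilted_rate y x)
          (\<lambda>s. \<integral>\<^sup>+d. \<integral>\<^sup>+b. \<integral>\<^sup>+\<omega>. (if b = None then 0 else F (r + s) (the_value b) d) \<partial>noise \<partial>measure_pmf (coin y x') \<partial>jump_law_at L x') \<partial>count_space UNIV)"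
      by (rule nn_integral_step[where A = "\<lambda>s z d. F (r + s) z d" and B = "\<lambda>s b d \<omega>. if b = None then 0 else F (r + s) (the_value b) d"]) measurable
    also have "\<dots> = ennreal (alarm_rate y x) * laplace (tilted_rate y x) (\<lambda>s. g (r + s) x)
      + (\<integral>\<^sup>+x'. ennreal (off L x x') * laplace (tilted_rate y x) (\<lambda>s. ennreal (joint_prob y x') * g (r + s) x') \<partial>count_space UNIV)"
      unfolding g_def f_def
      by (simp add: nn_integral_coin nn_integral_cmult noise.emeasure_space_1 nn_integral_pmf_swap the_value_def)
    also have "\<dots> = laplace (tilted_rate y x) (\<lambda>s. ennreal (alarm_rate y x) * g (r + s) x)
      + laplace (tilted_rate y x) (\<lambda>s. \<integral>\<^sup>+x'. ennreal (off L x x') * (ennreal (joint_prob y x') * g (r + s) x') \<partial>count_space UNIV)"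
      by (subst laplace_sum_count_space) (simp_all add: laplace_cmult)
    also have "\<dots> = laplace (tilted_rate y x) (\<lambda>s. h (r + s) x)"
      unfolding h_def by (rule laplace_add[symmetric]) measurable
    finally show ?thesis .
  qed
  let ?a = "dual_rate y"
  have "initial_value y (\<lambda>r x. \<integral>\<^sup>+d. \<integral>\<^sup>+\<omega>. R r d \<omega> \<partial>noise \<partial>jump_law_at L x)
      + excess y (\<lambda>r x. \<integral>\<^sup>+d. \<integral>\<^sup>+\<omega>. R r d \<omega> \<partial>noise \<partial>jump_law_at L x)
    = (\<integral>\<^sup>+x. ennreal (\<Lambda> y x) * laplace ?a (\<lambda>s. h s x) \<partial>count_space UNIV)"
    unfolding R by (rule initial_plus_excess_laplace) measurable
  also have "\<dots> = (\<integral>\<^sup>+x. ennreal (\<Lambda> y x) * ennreal (alarm_rate y x) * laplace ?a (\<lambda>s. g s x)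
      + (\<integral>\<^sup>+x'. ennreal (\<Lambda> y x) * ennreal (off L x x') * (ennreal (joint_prob y x') * laplace ?a (\<lambda>s. g s x')) \<partial>count_space UNIV) \<partial>count_space UNIV)"
  proof (intro nn_integral_cong)
    fix x
    have "laplace ?a (\<lambda>s. h s x) = ennreal (alarm_rate y x) * laplace ?a (\<lambda>s. g s x)
      + (\<integral>\<^sup>+x'. ennreal (off L x x') * (ennreal (joint_prob y x') * laplace ?a (\<lambda>s. g s x')) \<partial>count_space UNIV)"
      unfolding h_def by (subst laplace_add) (simp_all add: laplace_sum_count_space laplace_cmult)
    then show "ennreal (\<Lambda> y x) * laplace ?a (\<lambda>s. h s x) = ennreal (\<Lambda> y x) * ennreal (alarm_rate y x) * laplace ?a (\<lambda>s. g s x)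
      + (\<integral>\<^sup>+x'. ennreal (\<Lambda> y x) * ennreal (off L x x') * (ennreal (joint_prob y x') * laplace ?a (\<lambda>s. g s x')) \<partial>count_space UNIV)"
      by (simp add: distrib_left nn_integral_cmult[symmetric] mult.assoc)
  qed
  also have "\<dots> = (\<integral>\<^sup>+x. ennreal (\<Lambda> y x) * ennreal (alarm_rate y x) * laplace ?a (\<lambda>s. g s x) \<partial>count_space UNIV)
      + (\<integral>\<^sup>+x. \<integral>\<^sup>+x'. ennreal (\<Lambda> y x) * ennreal (off L x x') * (ennreal (joint_prob y x') * laplace ?a (\<lambda>s. g s x')) \<partial>count_space UNIV \<partial>count_space UNIV)"
    by (rule nn_integral_add) auto
  also have "(\<integral>\<^sup>+x. \<integral>\<^sup>+x'. ennreal (\<Lambda> y x) * ennreal (off L x x') * (ennreal (joint_prob y x') * laplace ?a (\<lambda>s. g s x')) \<partial>count_space UNIV \<partial>count_space UNIV)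
    = (\<integral>\<^sup>+x'. \<integral>\<^sup>+x. ennreal (\<Lambda> y x) * ennreal (off L x x') * (ennreal (joint_prob y x') * laplace ?a (\<lambda>s. g s x')) \<partial>count_space UNIV \<partial>count_space UNIV)"
    by (rule nn_integral_count_space_nn_integral) auto
  also have "\<dots> = (\<integral>\<^sup>+x'. ennreal (inflow y x') * (ennreal (joint_prob y x') * laplace ?a (\<lambda>s. g s x')) \<partial>count_space UNIV)"
    by (intro nn_integral_cong, subst nn_integral_multc, simp) (simp add: nn_integral_inflow)
  also have "(\<integral>\<^sup>+x. ennreal (\<Lambda> y x) * ennreal (alarm_rate y x) * laplace ?a (\<lambda>s. g s x) \<partial>count_space UNIV) + \<dots>
    = (\<integral>\<^sup>+x. ennreal (\<Lambda> y x) * ennreal (alarm_rate y x) * laplace ?a (\<lambda>s. g s x)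
        + ennreal (inflow y x) * (ennreal (joint_prob y x) * laplace ?a (\<lambda>s. g s x)) \<partial>count_space UNIV)"
    by (rule nn_integral_add[symmetric]) auto
  also have "\<dots> = (\<integral>\<^sup>+x. \<integral>\<^sup>+z. ennreal (off Ls y z) * ennreal (\<Lambda> z x) * laplace ?a (\<lambda>s. f s z x) \<partial>count_space UNIV \<partial>count_space UNIV)"
  proof (intro nn_integral_cong)
    fix x
    have e: "laplace ?a (\<lambda>s. g s x) = (\<integral>\<^sup>+z. ennreal (pmf (target y x) z) * laplace ?a (\<lambda>s. f s z x) \<partial>count_space UNIV)"
      unfolding g_def nn_integral_measure_pmf by (subst laplace_sum_count_space) (simp_all add: laplace_cmult)
    have "ennreal (\<Lambda> y x) * ennreal (alarm_rate y x) * laplace ?a (\<lambda>s. g s x)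
        + ennreal (inflow y x) * (ennreal (joint_prob y x) * laplace ?a (\<lambda>s. g s x))
      = (ennreal (\<Lambda> y x) * ennreal (alarm_rate y x) + ennreal (inflow y x) * ennreal (joint_prob y x)) * laplace ?a (\<lambda>s. g s x)"
      by (simp add: distrib_right mult.assoc)
    \<comment> \<open>\<open>halting_flow\<close> adds the two ways of ending the stay at
      \<open>x\<close> up to \<open>outflow\<close>; below, \<open>pmf_target\<close> splits this
      among the targets so that the weight of \<open>z\<close> contains the factor
      \<open>\<Lambda> z x\<close>.\<close>
    also have "ennreal (\<Lambda> y x) * ennreal (alarm_rate y x) + ennreal (inflow y x) * ennreal (joint_prob y x) = ennreal (outflow y x)"
      using halting_flow[of y x] kernel_nonneg alarm_rate_nonneg inflow_nonneg joint_prob_bounds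
      by (simp add: ennreal_mult[symmetric] ennreal_plus[symmetric] del: ennreal_plus)
    also have "ennreal (outflow y x) * laplace ?a (\<lambda>s. g s x) = (\<integral>\<^sup>+z. ennreal (off Ls y z) * ennreal (\<Lambda> z x) * laplace ?a (\<lambda>s. f s z x) \<partial>count_space UNIV)"
    proof -
      have "ennreal (outflow y x) * ennreal (pmf (target y x) z) = ennreal (off Ls y z) * ennreal (\<Lambda> z x)" for z
        using pmf_target[of y x z] outflow_nonneg off_nonneg[OF gen_s] kernel_nonneg
        by (simp add: ennreal_mult[symmetric])
      then show ?thesis by (simp add: e nn_integral_cmult[symmetric] mult.assoc[symmetric])
    qed
    finally show "ennreal (\<Lambda> y x) * ennreal (alarm_rate y x) * laplace ?a (\<lambda>s. g s x)
        + ennreal (inflow y x) * (ennreal (joint_prob y x) * laplace ?a (\<lambda>s. g s x)) = \<dots>" .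
  qed
  also have "\<dots> = (\<integral>\<^sup>+z. \<integral>\<^sup>+x. ennreal (off Ls y z) * ennreal (\<Lambda> z x) * laplace ?a (\<lambda>s. f s z x) \<partial>count_space UNIV \<partial>count_space UNIV)"
    by (rule nn_integral_count_space_nn_integral) auto
  also have "\<dots> = (\<integral>\<^sup>+z. ennreal (off Ls y z) * laplace ?a (\<lambda>s. \<integral>\<^sup>+d. F s z d \<partial>start_law z) \<partial>count_space UNIV)"
  proof (intro nn_integral_cong)
    fix z
    have "laplace ?a (\<lambda>s. \<integral>\<^sup>+d. F s z d \<partial>start_law z) = laplace ?a (\<lambda>s. \<integral>\<^sup>+x. ennreal (\<Lambda> z x) * f s z x \<partial>count_space UNIV)"
      unfolding f_def by (intro laplace_cong nn_integral_start_law) measurable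
    also have "\<dots> = (\<integral>\<^sup>+x. ennreal (\<Lambda> z x) * laplace ?a (\<lambda>s. f s z x) \<partial>count_space UNIV)"
      by (subst laplace_sum_count_space) (simp_all add: laplace_cmult)
    finally show "(\<integral>\<^sup>+x. ennreal (off Ls y z) * ennreal (\<Lambda> z x) * laplace ?a (\<lambda>s. f s z x) \<partial>count_space UNIV)
      = ennreal (off Ls y z) * laplace ?a (\<lambda>s. \<integral>\<^sup>+d. F s z d \<partial>start_law z)"
      by (simp add: nn_integral_cmult mult.assoc)
  qed
  finally show ?thesis .
qed

end

section \<open>The law of an episode\<close>

lemma nn_integral_indicator_singleton_UNIV:
  "(\<integral>\<^sup>+x. f x * indicator {a} x \<partial>count_space UNIV) = (f a :: ennreal)"
  by simp

lemma ennreal_eq_of_sum_eq: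
  fixes a b c d :: ennreal
  assumes "a + b = 1" "c + d = 1" "a \<le> c" "b \<le> d" shows "a = c"
proof (rule antisym[OF assms(3)])
  have "c + d = a + b" using assms by simp
  also have "\<dots> \<le> a + d" using assms(4) by (rule add_left_mono)
  finally have "d + c \<le> d + a" by (simp add: add.commute)
  moreover have "d \<noteq> \<infinity>" using assms(2) by auto
  ultimately show "c \<le> a" by (auto simp: ennreal_add_left_cancel_le)
qed

context intertwining
begin

definition ep_mean :: "'t \<Rightarrow> (('s \<times> ennreal) stream \<Rightarrow> (real \<times> real) stream \<Rightarrow> ennreal) \<Rightarrow> ennreal" where
  "ep_mean y G = (\<integral>\<^sup>+d. \<integral>\<^sup>+\<omega>. G d \<omega> \<partial>noise \<partial>start_law y)"

text \<open>The law to be proved for an episode: one step of the dual chain, with X restarted from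
  the kernel row of the new state.\<close>

definition ep_target_mean :: "'t \<Rightarrow> (ennreal \<Rightarrow> 't \<Rightarrow> ('s \<times> ennreal) stream \<Rightarrow> ennreal) \<Rightarrow> ennreal" where
  "ep_target_mean y F = (\<integral>\<^sup>+w. \<integral>\<^sup>+z. \<integral>\<^sup>+d. F w z d \<partial>start_law z \<partial>measure_pmf (jump_pmf Ls y) \<partial>expo (dual_rate y))"

lemma ep_mean_const: "ep_mean y (\<lambda>_ _. c) = c"
proof -
  interpret noise: prob_space noise by (rule prob_space_noise)
  interpret start: prob_space "start_law y" by (rule prob_space_start_law)
  show ?thesis by (simp add: ep_mean_def noise.emeasure_space_1 start.emeasure_space_1[simplified])
qed

lemma ep_mean_add:
  assumes [measurable]: "(\<lambda>(d, \<omega>). G d \<omega>) \<in> borel_measurable (itinerary_space \<Otimes>\<^sub>M noise)"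
    "(\<lambda>(d, \<omega>). H d \<omega>) \<in> borel_measurable (itinerary_space \<Otimes>\<^sub>M noise)"
  shows "ep_mean y (\<lambda>d \<omega>. G d \<omega> + H d \<omega>) = ep_mean y G + ep_mean y H"
  unfolding ep_mean_def by (simp add: nn_integral_add)

lemma ep_mean_mono: "(\<And>d \<omega>. G d \<omega> \<le> H d \<omega>) \<Longrightarrow> ep_mean y G \<le> ep_mean y H"
  unfolding ep_mean_def by (intro nn_integral_mono)

lemma ep_mean_suminf:
  assumes [measurable]: "\<And>n. (\<lambda>(d, \<omega>). G n d \<omega>) \<in> borel_measurable (itinerary_space \<Otimes>\<^sub>M noise)"
  shows "ep_mean y (\<lambda>d \<omega>. \<Sum>n. G n d \<omega>) = (\<Sum>n. ep_mean y (G n))"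
  unfolding ep_mean_def by (simp add: nn_integral_suminf)

lemma later_le_suminf: "later y R n r d \<omega> \<le> (\<Sum>n. later y R n r d \<omega>)"
  using sum_le_suminf[of "\<lambda>n. later y R n r d \<omega>" "{n}"] by simp

text \<open>An ended episode has a halting step, so its reward is one term of the series over all
  steps. The conservation law bounds the series, and the flow computation evaluates the
  bound.\<close>

lemma ep_mean_ended_le:
  assumes F: "(\<lambda>(s, z, d). F s z d) \<in> borel_measurable (borel \<Otimes>\<^sub>M count_space UNIV \<Otimes>\<^sub>M itinerary_space)"
  shows "ep_mean y (\<lambda>d \<omega>. if ended y d \<omega> then F (ep_time y d \<omega>) (ep_target y d \<omega>) (ep_rest y d \<omega>) else 0)
    \<le> (\<integral>\<^sup>+z. ennreal (off Ls y z) * laplace (dual_rate y) (\<lambda>s. \<integral>\<^sup>+d. F s z d \<partial>start_law z) \<partial>count_space UNIV)"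
proof -
  note [measurable (raw)] = measurable_app3[OF F]
  define R where "R = (\<lambda>r d \<omega>. if halts y d \<omega> then F (r + halt_time y d \<omega>) (halt_target y d \<omega>) (halt_rest y d \<omega>) else 0)"
  have R: "(\<lambda>(r, d, \<omega>). R r d \<omega>) \<in> borel_measurable (borel \<Otimes>\<^sub>M itinerary_space \<Otimes>\<^sub>M noise)"
    unfolding R_def by measurable
  note [measurable (raw)] = measurable_app3[OF measurable_later[OF R]]
  have "(if ended y d \<omega> then F (ep_time y d \<omega>) (ep_target y d \<omega>) (ep_rest y d \<omega>) else 0) \<le> (\<Sum>n. later y R n 0 d \<omega>)" for d \<omega>
  proof (cases "ended y d \<omega>")
    case True
    then obtain n where n: "halts_at n y d \<omega>" unfolding ended_def by blast
    have "F (ep_time y d \<omega>) (ep_target y d \<omega>) (ep_rest y d \<omega>) = later y R n 0 d \<omega>"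
      using True n by (simp add: later_eq R_def ep_time_def ep_target_def ep_rest_def halt_index_eqI[OF n] halts_at_def)
    then show ?thesis using True later_le_suminf[of y R n 0 d \<omega>] by simp
  qed simp
  then have "ep_mean y (\<lambda>d \<omega>. if ended y d \<omega> then F (ep_time y d \<omega>) (ep_target y d \<omega>) (ep_rest y d \<omega>) else 0)
    \<le> ep_mean y (\<lambda>d \<omega>. \<Sum>n. later y R n 0 d \<omega>)" by (intro ep_mean_mono)
  also have "\<dots> = (\<Sum>n. ep_mean y (\<lambda>d \<omega>. later y R n 0 d \<omega>))"
    by (rule ep_mean_suminf) measurable
  also have "\<dots> \<le> initial_value y (\<lambda>r x. \<integral>\<^sup>+d. \<integral>\<^sup>+\<omega>. R r d \<omega> \<partial>noise \<partial>jump_law_at L x)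
      + excess y (\<lambda>r x. \<integral>\<^sup>+d. \<integral>\<^sup>+\<omega>. R r d \<omega> \<partial>noise \<partial>jump_law_at L x)"
    unfolding ep_mean_def by (rule nn_integral_start_law_later[OF R])
  also have "\<dots> = (\<integral>\<^sup>+z. ennreal (off Ls y z) * laplace (dual_rate y) (\<lambda>s. \<integral>\<^sup>+d. F s z d \<partial>start_law z) \<partial>count_space UNIV)"
    unfolding R_def by (rule nn_integral_halting_flow[OF F])
  finally show ?thesis .
qed

lemma AE_start_law_lifetime: "AE d in start_law y. lifetime d = \<infinity>"
proof -
  have "explosion_time (\<lambda>n d. snd (d !! n)) = (lifetime :: ('s \<times> ennreal) stream \<Rightarrow> ennreal)"
    by (rule ext) (simp add: explosion_time_def jump_time_def lifetime_def elapsed_def)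
  then show ?thesis
    using AE_jump_law_nonexplosive[OF gen nonexpl, of "kernel_pmf y"] by (simp only: start_law_def)
qed

text \<open>As the path does not explode, \<open>t\<close> lies in some sojourn of X. A halt at an
  earlier step would give an episode of length at most \<open>t\<close>, so all earlier steps
  continue. Survival until \<open>t\<close> thus becomes a reward earned at one particular
  step.\<close>

lemma survival_path:
  assumes l: "lifetime d = \<infinity>" and t: "ennreal t < ep_time y d \<omega>"
  defines "n \<equiv> index_at d (ennreal t)"
  shows "alive n y d \<omega>" "elapsed n d \<le> ennreal t" "ennreal t < elapsed n d + snd (d !! n)"
    "ennreal t < elapsed n d + alarm y (sdrop n d) (sdrop n \<omega>)"
proof -
  have "ennreal t < lifetime d" using l by simp
  note i = index_at[OF this, folded n_def]
  show i1: "elapsed n d \<le> ennreal t" and i2: "ennreal t < elapsed n d + snd (d !! n)"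
    using i by (simp_all add: elapsed_Suc)
  have halts_late: "n \<le> m \<and> (m = n \<longrightarrow> ennreal t < elapsed n d + halt_time y (sdrop n d) (sdrop n \<omega>))"
    if m: "halts_at m y d \<omega>" for m
  proof -
    have T: "ennreal t < elapsed m d + halt_time y (sdrop m d) (sdrop m \<omega>)"
      using t m halts_at_imp_ended[OF m] by (simp add: ep_time_def halt_index_eqI[OF m] Let_def)
    have "n \<le> m"
    proof (rule ccontr)
      assume "\<not> n \<le> m"
      have "halt_time y (sdrop m d) (sdrop m \<omega>) \<le> snd (d !! m)"
        by (auto simp: halt_time_def rings_def)
      then have "elapsed m d + halt_time y (sdrop m d) (sdrop m \<omega>) \<le> elapsed (Suc m) d"
        by (simp add: elapsed_Suc add_left_mono)
      also have "\<dots> \<le> elapsed n d" using \<open>\<not> n \<le> m\<close> by (intro elapsed_mono) simp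
      finally show False using T i1 by simp
    qed
    with T show ?thesis by auto
  qed
  have "alive k y d \<omega>" if "k \<le> n" for k
    using that
  proof (induction k)
    case (Suc k)
    then have a: "alive k y d \<omega>" by simp
    have "\<not> halts_at k y d \<omega>" using halts_late[of k] Suc.prems by auto
    then have "\<not> halts y (sdrop k d) (sdrop k \<omega>)" using a by (simp add: halts_at_def)
    moreover have "snd (d !! k) < \<infinity>"
    proof -
      have "elapsed (Suc k) d \<le> ennreal t"
        using elapsed_mono[OF Suc.prems, of d] i1 by (rule order_trans)
      then have "elapsed (Suc k) d < \<infinity>" by (rule le_less_trans) simp
      then show ?thesis by (simp add: elapsed_Suc)
    qed
    ultimately have "continues y (sdrop k d) (sdrop k \<omega>)" by (auto simp: halts_def continues_def)
    with a show ?case by (simp add: alive_def less_Suc_eq)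
  qed (simp add: alive_def)
  then show al: "alive n y d \<omega>" by simp
  show "ennreal t < elapsed n d + alarm y (sdrop n d) (sdrop n \<omega>)"
  proof (cases "rings y (sdrop n d) (sdrop n \<omega>)")
    case True
    then have "halts_at n y d \<omega>" using al by (simp add: halts_at_def halts_def)
    then show ?thesis using halts_late[of n] True by (simp add: halt_time_def)
  next
    case False
    then have "snd (d !! n) \<le> alarm y (sdrop n d) (sdrop n \<omega>)" by (simp add: rings_def not_less)
    then have "elapsed n d + snd (d !! n) \<le> elapsed n d + alarm y (sdrop n d) (sdrop n \<omega>)" by (rule add_left_mono)
    then show ?thesis by (rule less_le_trans[OF i2])
  qed
qed

lemma nn_integral_one_step_survival:
  assumes "0 \<le> t"
  shows "(\<integral>\<^sup>+d. \<integral>\<^sup>+\<omega>. (if ennreal t < snd (shd d) \<and> ennreal t < alarm y d \<omega> \<and> fst (shd d) = x0 then 1 else 0) \<partial>noise \<partial>jump_law_at L x)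
    = ennreal (exp (- (tilted_rate y x * t))) * indicator {x0} x"
proof -
  interpret noise: prob_space noise by (rule prob_space_noise)
  interpret unit_uniform: prob_space unit_uniform by (rule prob_space_unit_uniform)
  have tail: "(\<integral>\<^sup>+s. (if ennreal t < s then c else 0) \<partial>expo r) = ennreal (exp (- (r * t))) * c" if "0 \<le> r" for r c
    using expo_memoryless[OF that assms, of "\<lambda>_. c"] prob_space.emeasure_space_1[OF prob_space_expo, of r] by simp
  let ?c = "ennreal (exp (- (alarm_rate y x * t))) * indicator {x0} x"
  have inner: "(\<integral>\<^sup>+\<omega>. (if ennreal t < w \<and> ennreal t < alarm y ((x, w) ## d) \<omega> \<and> x = x0 then 1 else 0) \<partial>noise)
    = (if ennreal t < w then ?c else 0)" for w d
  proof -
    have "(\<integral>\<^sup>+\<omega>. (if ennreal t < w \<and> ennreal t < alarm y ((x, w) ## d) \<omega> \<and> x = x0 then 1 else 0) \<partial>noise)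
      = (\<integral>\<^sup>+u. (if ennreal t < sampler (expo (alarm_rate y x)) u then (if ennreal t < w \<and> x = x0 then 1 else 0) else 0) \<partial>unit_uniform)"
      by (subst nn_integral_noise, simp, intro nn_integral_cong)
        (simp add: alarm_def noise.emeasure_space_1 unit_uniform.emeasure_space_1[simplified])
    also have "\<dots> = (\<integral>\<^sup>+s. (if ennreal t < s then (if ennreal t < w \<and> x = x0 then 1 else 0) else 0) \<partial>expo (alarm_rate y x))"
      by (rule nn_integral_sampler[OF coded_expo prob_space_expo]) simp
    also have "\<dots> = (if ennreal t < w then ?c else 0)"
      by (subst tail[OF alarm_rate_nonneg]) (auto simp: indicator_def)
    finally show ?thesis .
  qed
  have "(\<integral>\<^sup>+d. \<integral>\<^sup>+\<omega>. (if ennreal t < snd (shd d) \<and> ennreal t < alarm y d \<omega> \<and> fst (shd d) = x0 then 1 else 0) \<partial>noise \<partial>jump_law_at L x)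
    = (\<integral>\<^sup>+w. \<integral>\<^sup>+x'. \<integral>\<^sup>+d. (if ennreal t < w then ?c else 0) \<partial>jump_law_at L x' \<partial>measure_pmf (jump_pmf L x) \<partial>expo (rate x))"
    by (subst nn_integral_jump_law_at) (simp_all add: inner)
  also have "\<dots> = (\<integral>\<^sup>+w. (if ennreal t < w then ?c else 0) \<partial>expo (rate x))"
    using prob_space.emeasure_space_1[OF prob_space_jump_law_at, of L]
      prob_space.emeasure_space_1[OF prob_space_measure_pmf, of "jump_pmf L x"] by simp
  also have "\<dots> = ennreal (exp (- (rate x * t))) * ?c" by (rule tail[OF rate_nonneg(1)])
  also have "\<dots> = ennreal (exp (- (tilted_rate y x * t))) * indicator {x0} x"
  proof -
    have "exp (- (tilted_rate y x * t)) = exp (- (rate x * t)) * exp (- (alarm_rate y x * t))"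
      by (simp add: tilted_rate_def rate_plus_alarm_rate[symmetric] exp_add[symmetric] algebra_simps)
    then show ?thesis by (simp add: ennreal_mult' mult.assoc)
  qed
  finally show ?thesis .
qed

text \<open>The reward \<open>R\<close> at a step says that its sojourn contains \<open>t\<close>,
  takes place at \<open>x0\<close>, and has no alarm until \<open>t\<close>. A step beginning at age
  \<open>s\<close> earns it with probability \<open>exp (- (tilted_rate y x0 * (t - s)))\<close> at
  \<open>x0\<close>; the initial value and the excess are then explicit.\<close>

lemma ep_survival_le:
  assumes "0 \<le> t"
  shows "ep_mean y (\<lambda>d \<omega>. if lifetime d = \<infinity> \<and> ennreal t < ep_time y d \<omega> \<and> state_at d (ennreal t) = x0 then 1 else 0)
    \<le> ennreal (exp (- (dual_rate y * t))) * ennreal (\<Lambda> y x0)"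
proof -
  define R where "R r d \<omega> = (if r \<le> ennreal t \<and> ennreal t < r + snd (shd d) \<and> ennreal t < r + alarm y d \<omega> \<and> fst (shd d) = x0 then 1 else 0 :: ennreal)" for r d \<omega>
  have R: "(\<lambda>(r, d, \<omega>). R r d \<omega>) \<in> borel_measurable (borel \<Otimes>\<^sub>M itinerary_space \<Otimes>\<^sub>M noise)"
    unfolding R_def by measurable
  note [measurable (raw)] = measurable_app3[OF measurable_later[OF R]]
  let ?k = "\<lambda>r x. \<integral>\<^sup>+d. \<integral>\<^sup>+\<omega>. R r d \<omega> \<partial>noise \<partial>jump_law_at L x"
  have k: "?k (ennreal s) x = (if s \<le> t then ennreal (exp (- (tilted_rate y x * (t - s)))) * indicator {x0} x else 0)" if "0 \<le> s" for s x
  proof (cases "s \<le> t")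
    case True
    have "ennreal t < ennreal s + w \<longleftrightarrow> ennreal (t - s) < w" for w
      using True that by (cases w) (auto simp: ennreal_plus[symmetric] ennreal_less_iff simp del: ennreal_plus)
    then have "?k (ennreal s) x = (\<integral>\<^sup>+d. \<integral>\<^sup>+\<omega>. (if ennreal (t - s) < snd (shd d) \<and> ennreal (t - s) < alarm y d \<omega> \<and> fst (shd d) = x0 then 1 else 0) \<partial>noise \<partial>jump_law_at L x)"
      using True that by (simp add: R_def ennreal_le_iff)
    then show ?thesis using True nn_integral_one_step_survival[of "t - s" x y x0] by simp
  next
    case False
    then show ?thesis using assms by (simp add: R_def ennreal_le_iff)
  qed
  have "(if lifetime d = \<infinity> \<and> ennreal t < ep_time y d \<omega> \<and> state_at d (ennreal t) = x0 then 1 else 0) \<le> (\<Sum>n. later y R n 0 d \<omega>)" for d \<omega>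
  proof (cases "lifetime d = \<infinity> \<and> ennreal t < ep_time y d \<omega> \<and> state_at d (ennreal t) = x0")
    case True
    let ?n = "index_at d (ennreal t)"
    have "later y R ?n 0 d \<omega> = 1"
      using survival_path[of d t y \<omega>] True by (simp add: later_eq R_def state_at_def)
    then show ?thesis using True later_le_suminf[of y R ?n 0 d \<omega>] by simp
  next
    case False
    then show ?thesis by (subst if_not_P) auto
  qed
  then have "ep_mean y (\<lambda>d \<omega>. if lifetime d = \<infinity> \<and> ennreal t < ep_time y d \<omega> \<and> state_at d (ennreal t) = x0 then 1 else 0)
    \<le> ep_mean y (\<lambda>d \<omega>. \<Sum>n. later y R n 0 d \<omega>)" by (intro ep_mean_mono)
  also have "\<dots> = (\<Sum>n. ep_mean y (\<lambda>d \<omega>. later y R n 0 d \<omega>))"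
    by (rule ep_mean_suminf) measurable
  also have "\<dots> \<le> initial_value y ?k + excess y ?k"
    unfolding ep_mean_def by (rule nn_integral_start_law_later[OF R])
  also have "initial_value y ?k = ennreal (\<Lambda> y x0) * ennreal (exp (- (tilted_rate y x0 * t)))"
  proof -
    have "initial_value y ?k = (\<integral>\<^sup>+x. ennreal (\<Lambda> y x) * ennreal (exp (- (tilted_rate y x * t))) * indicator {x0} x \<partial>count_space UNIV)"
      unfolding initial_value_def using k[of 0] assms by (simp add: mult.assoc)
    then show ?thesis by (simp add: nn_integral_indicator_singleton_UNIV)
  qed
  also have "excess y ?k = ennreal (\<Lambda> y x0) * (ennreal (tilted_rate y x0 - dual_rate y) *
      (\<integral>\<^sup>+s. ennreal (exp (- (dual_rate y * s))) * ennreal (exp (- (tilted_rate y x0 * (t - s)))) * indicator {0..t} s \<partial>lborel))"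
    (is "_ = _ * (_ * ?I x0)")
  proof -
    have "laplace (dual_rate y) (\<lambda>s. ?k s x) = ?I x * indicator {x0} x" for x
    proof -
      have "laplace (dual_rate y) (\<lambda>s. ?k s x) = (\<integral>\<^sup>+s. ennreal (exp (- (dual_rate y * s))) * ennreal (exp (- (tilted_rate y x * (t - s)))) * indicator {0..t} s * indicator {x0} x \<partial>lborel)"
        unfolding laplace_def by (intro nn_integral_cong) (auto simp: indicator_def k)
      then show ?thesis by (simp add: nn_integral_multc)
    qed
    then have "excess y ?k = (\<integral>\<^sup>+x. ennreal (\<Lambda> y x) * (ennreal (tilted_rate y x - dual_rate y) * ?I x) * indicator {x0} x \<partial>count_space UNIV)"
      unfolding excess_def by (simp add: mult.assoc)
    then show ?thesis by (simp add: nn_integral_indicator_singleton_UNIV)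
  qed
  \<comment> \<open>Again Duhamel's formula, now from \<open>tilted_rate y x0\<close> to
    \<open>dual_rate y\<close>.\<close>
  also have "ennreal (\<Lambda> y x0) * ennreal (exp (- (tilted_rate y x0 * t))) + ennreal (\<Lambda> y x0) * (ennreal (tilted_rate y x0 - dual_rate y) * ?I x0)
    = ennreal (exp (- (dual_rate y * t))) * ennreal (\<Lambda> y x0)"
    unfolding distrib_left[symmetric] exp_variation[OF dual_rate_le_tilted_rate assms] by (rule mult.commute)
  finally show ?thesis .
qed

text \<open>The condition on \<open>lifetime\<close> holds almost surely since X does not explode.
  It is the condition under which \<open>ep_survival_le\<close> bounds each summand.\<close>

lemma ep_mean_state:
  assumes G [measurable]: "(\<lambda>(d, \<omega>). G d \<omega>) \<in> borel_measurable (itinerary_space \<Otimes>\<^sub>M noise)"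
  shows "ep_mean y G = (\<integral>\<^sup>+x. ep_mean y (\<lambda>d \<omega>. if lifetime d = \<infinity> \<and> state_at d t = x then G d \<omega> else 0) \<partial>count_space UNIV)"
proof -
  have "(\<integral>\<^sup>+x. ep_mean y (\<lambda>d \<omega>. if lifetime d = \<infinity> \<and> state_at d t = x then G d \<omega> else 0) \<partial>count_space UNIV)
    = (\<integral>\<^sup>+d. \<integral>\<^sup>+\<omega>. \<integral>\<^sup>+x. (if lifetime d = \<infinity> \<and> state_at d t = x then G d \<omega> else 0) \<partial>count_space UNIV \<partial>noise \<partial>start_law y)"
    unfolding ep_mean_def by (simp add: nn_integral_count_space_nn_integral)
  also have "\<dots> = (\<integral>\<^sup>+d. \<integral>\<^sup>+\<omega>. (if lifetime d = \<infinity> then G d \<omega> else 0) \<partial>noise \<partial>start_law y)"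
  proof (intro nn_integral_cong)
    fix d :: "('s \<times> ennreal) stream" and \<omega>
    have "(\<integral>\<^sup>+x. (if lifetime d = \<infinity> \<and> state_at d t = x then G d \<omega> else 0) \<partial>count_space UNIV)
      = (\<integral>\<^sup>+x. (if lifetime d = \<infinity> then G d \<omega> else 0) * indicator {state_at d t} x \<partial>count_space UNIV)"
      by (intro nn_integral_cong) (auto simp: indicator_def)
    then show "(\<integral>\<^sup>+x. (if lifetime d = \<infinity> \<and> state_at d t = x then G d \<omega> else 0) \<partial>count_space UNIV) = (if lifetime d = \<infinity> then G d \<omega> else 0)"
      by (simp add: nn_integral_indicator_singleton_UNIV)
  qed
  also have "\<dots> = ep_mean y G"
    unfolding ep_mean_def
    by (rule nn_integral_cong_AE) (use AE_start_law_lifetime[of y] in \<open>auto elim!: eventually_mono\<close>)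
  finally show ?thesis by simp
qed

lemma ep_survival_total_le:
  assumes "0 \<le> t"
  shows "ep_mean y (\<lambda>d \<omega>. if ennreal t < ep_time y d \<omega> then 1 else 0) \<le> ennreal (exp (- (dual_rate y * t)))"
proof -
  have "ep_mean y (\<lambda>d \<omega>. if ennreal t < ep_time y d \<omega> then 1 else 0)
    = (\<integral>\<^sup>+x. ep_mean y (\<lambda>d \<omega>. if lifetime d = \<infinity> \<and> state_at d (ennreal t) = x then (if ennreal t < ep_time y d \<omega> then 1 else 0) else 0) \<partial>count_space UNIV)"
    by (rule ep_mean_state) measurable
  also have "\<dots> \<le> (\<integral>\<^sup>+x. ennreal (exp (- (dual_rate y * t))) * ennreal (\<Lambda> y x) \<partial>count_space UNIV)"
  proof (rule nn_integral_mono)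
    fix x
    have "ep_mean y (\<lambda>d \<omega>. if lifetime d = \<infinity> \<and> state_at d (ennreal t) = x then (if ennreal t < ep_time y d \<omega> then 1 else 0) else 0)
      = ep_mean y (\<lambda>d \<omega>. if lifetime d = \<infinity> \<and> ennreal t < ep_time y d \<omega> \<and> state_at d (ennreal t) = x then 1 else 0)"
      unfolding ep_mean_def by (intro nn_integral_cong) auto
    then show "ep_mean y (\<lambda>d \<omega>. if lifetime d = \<infinity> \<and> state_at d (ennreal t) = x then (if ennreal t < ep_time y d \<omega> then 1 else 0) else 0)
      \<le> ennreal (exp (- (dual_rate y * t))) * ennreal (\<Lambda> y x)"
      using ep_survival_le[OF assms, of y x] by simp
  qed
  also have "\<dots> = ennreal (exp (- (dual_rate y * t)))"
    by (simp add: nn_integral_cmult nn_integral_kernel)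
  finally show ?thesis .
qed

text \<open>At a positive rate, an episode that never ends survives every \<open>t\<close>, and the
  bound on survival tends to 0. At rate 0 the flow bound shows that almost no episode ends.\<close>

lemma ep_mean_not_ended:
  "ep_mean y (\<lambda>d \<omega>. if ended y d \<omega> then 0 else 1) = (if dual_rate y = 0 then 1 else 0)"
proof (cases "dual_rate y = 0")
  case True
  have "off Ls y z = 0" for z using off_le_jump_rate[OF gen_s, of y z] off_nonneg[OF gen_s, of y z] True by simp
  then have "ep_mean y (\<lambda>d \<omega>. if ended y d \<omega> then 1 else 0) = 0"
    using ep_mean_ended_le[of "\<lambda>_ _ _. 1" y] by simp
  moreover have "ep_mean y (\<lambda>d \<omega>. (if ended y d \<omega> then 1 else 0) + (if ended y d \<omega> then 0 else 1)) = 1"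
  proof -
    have "(if ended y d \<omega> then 1 else 0) + (if ended y d \<omega> then 0 else 1) = (1 :: ennreal)" for d \<omega> by simp
    then show ?thesis by (simp add: ep_mean_const)
  qed
  ultimately show ?thesis using True by (subst (asm) ep_mean_add) auto
next
  case False
  then have a: "0 < dual_rate y" using rate_nonneg(2)[of y] by simp
  have small: "ep_mean y (\<lambda>d \<omega>. if ended y d \<omega> then 0 else 1) \<le> 0 + ennreal e" if "0 < e" for e
  proof -
    \<comment> \<open>The solution of \<open>exp (- (dual_rate y * t)) = e\<close>, replaced by 0 if
      \<open>e\<close> exceeds 1.\<close>
    define t where "t = max 0 (- ln e / dual_rate y)"
    have "ep_mean y (\<lambda>d \<omega>. if ended y d \<omega> then 0 else 1) \<le> ep_mean y (\<lambda>d \<omega>. if ennreal t < ep_time y d \<omega> then 1 else 0)"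
      by (rule ep_mean_mono) (simp add: ep_time_def)
    also have "\<dots> \<le> ennreal (exp (- (dual_rate y * t)))" by (rule ep_survival_total_le) (simp add: t_def)
    also have "\<dots> \<le> ennreal e"
    proof (rule ennreal_leI)
      have "- ln e / dual_rate y \<le> t" by (simp add: t_def)
      then have "- ln e \<le> t * dual_rate y" by (simp only: pos_divide_le_eq[OF a])
      then have "exp (- (dual_rate y * t)) \<le> exp (ln e)" by (simp add: mult.commute)
      then show "exp (- (dual_rate y * t)) \<le> e" using that by simp
    qed
    finally show ?thesis by simp
  qed
  have "ep_mean y (\<lambda>d \<omega>. if ended y d \<omega> then 0 else 1) \<le> 0"
    by (rule ennreal_le_epsilon) (rule small)
  with False show ?thesis by simp
qed

lemma ep_target_mean_eq:
  assumes F: "(\<lambda>(s, z, d). F s z d) \<in> borel_measurable (borel \<Otimes>\<^sub>M count_space UNIV \<Otimes>\<^sub>M itinerary_space)"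
    and a: "0 < dual_rate y"
  shows "ep_target_mean y F = (\<integral>\<^sup>+z. ennreal (off Ls y z) * laplace (dual_rate y) (\<lambda>s. \<integral>\<^sup>+d. F s z d \<partial>start_law z) \<partial>count_space UNIV)"
proof -
  note [measurable (raw)] = measurable_app3[OF F]
  have "ep_target_mean y F = ennreal (dual_rate y) * laplace (dual_rate y)
      (\<lambda>w. \<integral>\<^sup>+z. ennreal (jump_prob Ls y z) * (\<integral>\<^sup>+d. F w z d \<partial>start_law z) \<partial>count_space UNIV)"
    unfolding ep_target_mean_def using a
    by (subst nn_integral_expo) (simp_all add: nn_integral_measure_pmf pmf_jump_pmf[OF gen_s])
  also have "\<dots> = (\<integral>\<^sup>+z. ennreal (dual_rate y) * (ennreal (jump_prob Ls y z) * laplace (dual_rate y) (\<lambda>w. \<integral>\<^sup>+d. F w z d \<partial>start_law z)) \<partial>count_space UNIV)"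
    by (subst laplace_sum_count_space) (simp_all add: laplace_cmult nn_integral_cmult)
  also have "\<dots> = (\<integral>\<^sup>+z. ennreal (off Ls y z) * laplace (dual_rate y) (\<lambda>s. \<integral>\<^sup>+d. F s z d \<partial>start_law z) \<partial>count_space UNIV)"
  proof (intro nn_integral_cong)
    fix z
    have "ennreal (dual_rate y) * ennreal (jump_prob Ls y z) = ennreal (off Ls y z)"
      using jump_rate_times_jump_prob[OF gen_s, of y z] rate_nonneg jump_prob_nonneg[OF gen_s]
      by (simp add: ennreal_mult[symmetric])
    then show "ennreal (dual_rate y) * (ennreal (jump_prob Ls y z) * laplace (dual_rate y) (\<lambda>w. \<integral>\<^sup>+d. F w z d \<partial>start_law z))
      = ennreal (off Ls y z) * laplace (dual_rate y) (\<lambda>s. \<integral>\<^sup>+d. F s z d \<partial>start_law z)"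
      by (simp add: mult.assoc[symmetric])
  qed
  finally show ?thesis .
qed

lemma ep_target_mean_const: "ep_target_mean y (\<lambda>_ _ _. c) = c"
  unfolding ep_target_mean_def
  using prob_space.emeasure_space_1[OF prob_space_start_law] prob_space.emeasure_space_1[OF prob_space_expo, of "dual_rate y"]
    prob_space.emeasure_space_1[OF prob_space_measure_pmf, of "jump_pmf Ls y"] by simp

lemma ep_target_mean_add:
  assumes "(\<lambda>(s, z, d). F s z d) \<in> borel_measurable (borel \<Otimes>\<^sub>M count_space UNIV \<Otimes>\<^sub>M itinerary_space)"
    "(\<lambda>(s, z, d). G s z d) \<in> borel_measurable (borel \<Otimes>\<^sub>M count_space UNIV \<Otimes>\<^sub>M itinerary_space)"
  shows "ep_target_mean y (\<lambda>s z d. F s z d + G s z d) = ep_target_mean y F + ep_target_mean y G"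
proof -
  note [measurable (raw)] = measurable_app3[OF assms(1)] measurable_app3[OF assms(2)]
  show ?thesis unfolding ep_target_mean_def by (simp add: nn_integral_add)
qed

text \<open>The inequality of the flow bound holds for \<open>F\<close> and for \<open>1 - F\<close>, and the two sides have the same
  total mass.\<close>

lemma episode_law:
  assumes F: "(\<lambda>(s, z, d). F s z d) \<in> borel_measurable (borel \<Otimes>\<^sub>M count_space UNIV \<Otimes>\<^sub>M itinerary_space)"
    and F1: "\<And>s z d. F s z d \<le> 1"
  shows "ep_mean y (\<lambda>d \<omega>. F (ep_time y d \<omega>) (ep_target y d \<omega>) (ep_rest y d \<omega>)) = ep_target_mean y F"
proof (cases "dual_rate y = 0")
  case True
  note [measurable (raw)] = measurable_app3[OF F]
  interpret noise: prob_space noise by (rule prob_space_noise)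
  \<comment> \<open>All rates out of \<open>y\<close> vanish, so episodes almost surely do not end.
    Their default values match \<open>expo 0\<close> and the jump law at an absorbing state.\<close>
  have "ep_mean y (\<lambda>d \<omega>. if ended y d \<omega> then 1 else 0) = 0"
  proof -
    have "off Ls y z = 0" for z using off_le_jump_rate[OF gen_s, of y z] off_nonneg[OF gen_s, of y z] True by simp
    then show ?thesis using ep_mean_ended_le[of "\<lambda>_ _ _. 1" y] by simp
  qed
  then have "AE d in start_law y. AE \<omega> in noise. \<not> ended y d \<omega>"
    unfolding ep_mean_def
    by (subst (asm) nn_integral_0_iff_AE, simp, subst (asm) nn_integral_0_iff_AE) (auto elim!: eventually_mono split: if_splits)
  then have "ep_mean y (\<lambda>d \<omega>. F (ep_time y d \<omega>) (ep_target y d \<omega>) (ep_rest y d \<omega>)) = ep_mean y (\<lambda>d \<omega>. F \<infinity> y d)"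
    unfolding ep_mean_def
  proof (intro nn_integral_cong_AE, eventually_elim)
    case (elim d)
    then show ?case
      by (intro nn_integral_cong_AE) (auto elim!: eventually_mono simp: ep_time_def ep_target_def ep_rest_def)
  qed
  also have "\<dots> = (\<integral>\<^sup>+d. F \<infinity> y d \<partial>start_law y)"
    by (simp add: ep_mean_def noise.emeasure_space_1)
  also have "\<dots> = ep_target_mean y F"
  proof -
    have "(\<lambda>z. ennreal (jump_prob Ls y z) * (\<integral>\<^sup>+d. F \<infinity> z d \<partial>start_law z)) = (\<lambda>z. (\<integral>\<^sup>+d. F \<infinity> y d \<partial>start_law y) * indicator {y} z)"
      using True by (auto simp: jump_prob_def indicator_def fun_eq_iff)
    then show ?thesis unfolding ep_target_mean_def True expo_0
      by (subst nn_integral_return) (simp_all add: nn_integral_measure_pmf pmf_jump_pmf[OF gen_s] nn_integral_indicator_singleton_UNIV)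
  qed
  finally show ?thesis .
next
  case False
  then have a: "0 < dual_rate y" using rate_nonneg(2)[of y] by simp
  have le: "ep_mean y (\<lambda>d \<omega>. G (ep_time y d \<omega>) (ep_target y d \<omega>) (ep_rest y d \<omega>)) \<le> ep_target_mean y G"
    if G: "(\<lambda>(s, z, d). G s z d) \<in> borel_measurable (borel \<Otimes>\<^sub>M count_space UNIV \<Otimes>\<^sub>M itinerary_space)"
      and G1: "\<And>s z d. G s z d \<le> 1" for G
  proof -
    note [measurable (raw)] = measurable_app3[OF G]
    \<comment> \<open>Episodes that never end are counted with weight 1, which costs nothing by
      \<open>ep_mean_not_ended\<close>.\<close>
    have "ep_mean y (\<lambda>d \<omega>. G (ep_time y d \<omega>) (ep_target y d \<omega>) (ep_rest y d \<omega>))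
      \<le> ep_mean y (\<lambda>d \<omega>. (if ended y d \<omega> then G (ep_time y d \<omega>) (ep_target y d \<omega>) (ep_rest y d \<omega>) else 0) + (if ended y d \<omega> then 0 else 1))"
      by (rule ep_mean_mono) (auto simp: G1)
    also have "\<dots> = ep_mean y (\<lambda>d \<omega>. if ended y d \<omega> then G (ep_time y d \<omega>) (ep_target y d \<omega>) (ep_rest y d \<omega>) else 0)"
      by (subst ep_mean_add) (auto simp: ep_mean_not_ended False)
    also have "\<dots> \<le> ep_target_mean y G"
      unfolding ep_target_mean_eq[OF G a] by (rule ep_mean_ended_le[OF G])
    finally show ?thesis .
  qed
  note [measurable (raw)] = measurable_app3[OF F]
  have one: "F s z d + (1 - F s z d) = 1" for s z d
    using F1[of s z d] by (simp add: add_diff_inverse_ennreal)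
  let ?E = "\<lambda>G. ep_mean y (\<lambda>d \<omega>. G (ep_time y d \<omega>) (ep_target y d \<omega>) (ep_rest y d \<omega>))"
  have m: "(\<lambda>(s, z, d). 1 - F s z d) \<in> borel_measurable (borel \<Otimes>\<^sub>M count_space UNIV \<Otimes>\<^sub>M itinerary_space)" by measurable
  have le1: "?E F \<le> ep_target_mean y F" by (rule le[OF F F1])
  have le2: "?E (\<lambda>s z d. 1 - F s z d) \<le> ep_target_mean y (\<lambda>s z d. 1 - F s z d)"
    by (rule le[OF m]) (simp add: diff_le_self_ennreal)
  have e1: "?E F + ?E (\<lambda>s z d. 1 - F s z d) = 1"
    by (subst ep_mean_add[symmetric]) (simp_all add: one ep_mean_const)
  have e2: "ep_target_mean y F + ep_target_mean y (\<lambda>s z d. 1 - F s z d) = 1"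
    by (subst ep_target_mean_add[OF F m, symmetric]) (simp add: one ep_target_mean_const)
  show ?thesis by (rule ennreal_eq_of_sum_eq[OF e1 e2 le1 le2])
qed

text \<open>The exit time is exponential by \<open>episode_law\<close>. This exact total mass is
  what \<open>ep_survival_le\<close> alone does not give.\<close>

lemma ep_survival_total:
  assumes "0 \<le> t"
  shows "ep_mean y (\<lambda>d \<omega>. if ennreal t < ep_time y d \<omega> then 1 else 0) = ennreal (exp (- (dual_rate y * t)))"
proof -
  have "ep_mean y (\<lambda>d \<omega>. if ennreal t < ep_time y d \<omega> then 1 else 0) = ep_target_mean y (\<lambda>w z d. if ennreal t < w then 1 else 0)"
    by (rule episode_law) auto
  also have "\<dots> = (\<integral>\<^sup>+w. (if ennreal t < w then 1 else 0) \<partial>expo (dual_rate y))"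
    unfolding ep_target_mean_def
    using prob_space.emeasure_space_1[OF prob_space_start_law]
      prob_space.emeasure_space_1[OF prob_space_measure_pmf, of "jump_pmf Ls y"] by simp
  also have "\<dots> = ennreal (exp (- (dual_rate y * t)))"
    using expo_memoryless[OF rate_nonneg(2) assms, of "\<lambda>_. 1"] prob_space.emeasure_space_1[OF prob_space_expo, of "dual_rate y"] by simp
  finally show ?thesis .
qed

text \<open>The upper bounds of \<open>ep_survival_le\<close> for the individual states sum to the
  exact survival probability, which is finite, so each of them is an equality: given survival, X has
  law \<open>\<Lambda> y\<close>.\<close>

lemma ep_survival:
  assumes "0 \<le> t"
  shows "ep_mean y (\<lambda>d \<omega>. if ennreal t < ep_time y d \<omega> then f (state_at d (ennreal t)) else 0)
    = ennreal (exp (- (dual_rate y * t))) * (\<integral>\<^sup>+x. f x \<partial>measure_pmf (kernel_pmf y))"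
proof -
  let ?p = "\<lambda>x. ep_mean y (\<lambda>d \<omega>. if lifetime d = \<infinity> \<and> state_at d (ennreal t) = x then (if ennreal t < ep_time y d \<omega> then 1 else 0) else 0)"
  let ?q = "\<lambda>x. ennreal (exp (- (dual_rate y * t))) * ennreal (\<Lambda> y x)"
  have p: "?p x = ep_mean y (\<lambda>d \<omega>. if lifetime d = \<infinity> \<and> ennreal t < ep_time y d \<omega> \<and> state_at d (ennreal t) = x then 1 else 0)" for x
    unfolding ep_mean_def by (intro nn_integral_cong) auto
  have q: "(\<integral>\<^sup>+x. ?q x \<partial>count_space UNIV) = ennreal (exp (- (dual_rate y * t)))"
    by (simp add: nn_integral_cmult nn_integral_kernel)
  have eq: "?p x = ?q x" for x
  proof (rule nn_integral_count_space_eq_termwise)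
    show "?p x \<le> ?q x" for x unfolding p by (rule ep_survival_le[OF assms])
    have "(\<integral>\<^sup>+x. ?p x \<partial>count_space UNIV) = ep_mean y (\<lambda>d \<omega>. if ennreal t < ep_time y d \<omega> then 1 else 0)"
      by (rule ep_mean_state[symmetric]) measurable
    then show "(\<integral>\<^sup>+x. ?p x \<partial>count_space UNIV) = (\<integral>\<^sup>+x. ?q x \<partial>count_space UNIV)"
      unfolding q by (simp add: ep_survival_total[OF assms])
    show "(\<integral>\<^sup>+x. ?q x \<partial>count_space UNIV) < \<infinity>" unfolding q by simp
  qed
  have "ep_mean y (\<lambda>d \<omega>. if ennreal t < ep_time y d \<omega> then f (state_at d (ennreal t)) else 0)
    = (\<integral>\<^sup>+x. ep_mean y (\<lambda>d \<omega>. if lifetime d = \<infinity> \<and> state_at d (ennreal t) = x then (if ennreal t < ep_time y d \<omega> then f (state_at d (ennreal t)) else 0) else 0) \<partial>count_space UNIV)"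
    by (rule ep_mean_state) measurable
  also have "\<dots> = (\<integral>\<^sup>+x. f x * ?p x \<partial>count_space UNIV)"
  proof (intro nn_integral_cong)
    fix x
    have "f x * ?p x = (\<integral>\<^sup>+d. \<integral>\<^sup>+\<omega>. f x * (if lifetime d = \<infinity> \<and> state_at d (ennreal t) = x then (if ennreal t < ep_time y d \<omega> then 1 else 0) else 0) \<partial>noise \<partial>start_law y)"
      unfolding ep_mean_def by (simp add: nn_integral_cmult)
    then show "ep_mean y (\<lambda>d \<omega>. if lifetime d = \<infinity> \<and> state_at d (ennreal t) = x then (if ennreal t < ep_time y d \<omega> then f (state_at d (ennreal t)) else 0) else 0) = f x * ?p x"
      unfolding ep_mean_def by (auto intro!: nn_integral_cong)
  qed
  also have "\<dots> = ennreal (exp (- (dual_rate y * t))) * (\<integral>\<^sup>+x. f x \<partial>measure_pmf (kernel_pmf y))"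
    unfolding eq nn_integral_measure_pmf pmf_kernel_pmf
    by (subst nn_integral_cmult[symmetric]) (auto intro!: nn_integral_cong simp: mult_ac)
  finally show ?thesis .
qed

end

section \<open>The dual process\<close>

definition path_at :: "('s \<times> ennreal) stream \<Rightarrow> ennreal \<Rightarrow> 's option" where
  "path_at d t = (if t < lifetime d then Some (state_at d t) else None)"

text \<open>\<open>d\<close> and \<open>d'\<close> describe the same path up to time \<open>t\<close>.\<close>

inductive agree :: "ennreal \<Rightarrow> ('s \<times> ennreal) stream \<Rightarrow> ('s \<times> ennreal) stream \<Rightarrow> bool" where
  last: "fst (shd d) = fst (shd d') \<Longrightarrow> t < snd (shd d) \<Longrightarrow> t < snd (shd d') \<Longrightarrow> agree t d d'"
| jump: "shd d = shd d' \<Longrightarrow> agree t (stl d) (stl d') \<Longrightarrow> agree (snd (shd d) + t) d d'"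

lemma agree_fst: "agree t d d' \<Longrightarrow> fst (shd d) = fst (shd d')"
  by (induction rule: agree.induct) auto

lemma ennreal_minus_less_minus:
  fixes a t w :: ennreal
  assumes "a \<le> t" "a < \<infinity>" "t < w" shows "t - a < w - a"
proof -
  have "a + (t - a) = t" "a + (w - a) = w"
    using assms by (auto intro: add_diff_inverse_ennreal)
  then have "a + (t - a) < a + (w - a)" by (simp only: assms(3))
  then show ?thesis by (simp only: ennreal_add_left_cancel_less)
qed

lemma agree_halted:
  assumes "elapsed n d \<le> t" "t < elapsed (Suc n) d" "t < \<infinity>"
  shows "agree t d (halted n d)"
  using assms
proof (induction n arbitrary: t d)
  case 0
  then show ?case by (intro agree.last) (auto simp: halted_0 elapsed_Suc)
next
  case (Suc n)
  let ?w = "snd (shd d)"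
  have "?w \<le> t" using Suc.prems(1) unfolding elapsed_Suc_shift by (metis le_iff_add order_trans)
  then have t: "t = ?w + (t - ?w)" by (rule add_diff_inverse_ennreal[symmetric])
  have w: "?w \<noteq> \<infinity>" using \<open>?w \<le> t\<close> Suc.prems(3) by (auto simp: top_unique)
  have "agree (t - ?w) (stl d) (halted n (stl d))"
  proof (rule Suc.IH)
    show "elapsed n (stl d) \<le> t - ?w"
      using Suc.prems(1) t w unfolding elapsed_Suc_shift
      by (metis ennreal_add_left_cancel_le)
    show "t - ?w < elapsed (Suc n) (stl d)"
      using Suc.prems(2) t w unfolding elapsed_Suc_shift[of "Suc n"]
      by (metis ennreal_add_left_cancel_less)
    show "t - ?w < \<infinity>" using Suc.prems(3) by (simp add: less_top[symmetric])
  qed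
  then have "agree (?w + (t - ?w)) d (halted (Suc n) d)"
    by (intro agree.jump) (simp_all add: halted_Suc)
  then show ?case using t by simp
qed

text \<open>Jumps after \<open>t\<close> may differ, which is why jump times are compared only if
  one of them is at most \<open>t\<close>. An explosion before \<open>t\<close> is included: then
  all jump times of both paths coincide.\<close>

lemma path_at_eqI:
  assumes eq: "\<And>k. elapsed k P \<le> t \<or> elapsed k P' \<le> t \<Longrightarrow> elapsed k P = elapsed k P' \<and> fst (P !! k) = fst (P' !! k)"
    and "u \<le> t"
  shows "path_at P u = path_at P' u"
proof -
  have le: "elapsed k P \<le> u \<longleftrightarrow> elapsed k P' \<le> u" for k
    using eq[of k] assms(2) by (metis order_trans)
  then have less: "u < elapsed k P \<longleftrightarrow> u < elapsed k P'" for k by (metis not_le)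
  have "u < lifetime P \<longleftrightarrow> u < lifetime P'"
    unfolding lifetime_def less_SUP_iff less ..
  moreover have "index_at P u = index_at P' u"
    unfolding index_at_def less ..
  moreover have "fst (P !! index_at P u) = fst (P' !! index_at P u)" if "u < lifetime P"
    using eq[of "index_at P u"] index_at(1)[OF that] assms(2) by (metis order_trans)
  ultimately show ?thesis by (simp add: path_at_def state_at_def)
qed

lemma prob_space_noises: "prob_space (stream_space noise)"
  by (rule prob_space.prob_space_stream_space[OF prob_space_noise])

abbreviation noises :: "(real \<times> real) stream stream measure" where
  "noises \<equiv> stream_space noise"

lemma measurable_nn_integral_noises [measurable (raw)]:
  assumes [measurable]: "(\<lambda>(w, \<omega>). F w \<omega>) \<in> borel_measurable (M \<Otimes>\<^sub>M noises)"
  shows "(\<lambda>w. \<integral>\<^sup>+\<omega>. F w \<omega> \<partial>noises) \<in> borel_measurable M"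
proof -
  interpret prob_space noises by (rule prob_space_noises)
  show ?thesis by measurable
qed

section \<open>Adaptedness of the dual process to X\<close>

context intertwining
begin

lemma elapsed_advance:
  assumes "a < snd (shd d)"
  shows "a + elapsed (Suc k) (advance a d) = elapsed (Suc k) d"
proof -
  have "a + (snd (shd d) - a) = snd (shd d)" using assms by simp
  then show ?thesis by (simp add: elapsed_Suc_shift advance_def add.assoc[symmetric])
qed

lemma state_at_advance:
  assumes "a < snd (shd d)" "lifetime d = \<infinity>"
  shows "lifetime (advance a d) = \<infinity>" "s < \<infinity> \<Longrightarrow> state_at (advance a d) s = state_at d (a + s)"
proof -
  have a: "a < \<infinity>" using assms(1) by (rule less_le_trans) simp
  have "lifetime d \<le> a + lifetime (advance a d)"
    unfolding lifetime_def[of d]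
  proof (rule SUP_least)
    fix n
    have "elapsed n d \<le> elapsed (Suc n) d" by (rule elapsed_mono) simp
    also have "\<dots> = a + elapsed (Suc n) (advance a d)" by (rule elapsed_advance[OF assms(1), symmetric])
    also have "\<dots> \<le> a + lifetime (advance a d)" by (intro add_left_mono elapsed_le_lifetime)
    finally show "elapsed n d \<le> a + lifetime (advance a d)" .
  qed
  then show "lifetime (advance a d) = \<infinity>" using a assms(2) by (auto simp: top_unique)
  assume s: "s < \<infinity>"
  let ?m = "index_at d (a + s)"
  have "a + s < lifetime d" using a s assms(2) by simp
  note i = index_at[OF this]
  have "s < elapsed (Suc ?m) (advance a d)"
    using i(2) unfolding elapsed_advance[OF assms(1), symmetric] by (simp add: ennreal_add_left_cancel_less)
  moreover have "elapsed ?m (advance a d) \<le> s"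
  proof (cases ?m)
    case (Suc k)
    have "a + elapsed (Suc k) (advance a d) \<le> a + s" using i(1) Suc elapsed_advance[OF assms(1), of k] by simp
    then show ?thesis using a Suc by (auto simp: ennreal_add_left_cancel_le)
  qed simp
  ultimately have "state_at (advance a d) s = fst (advance a d !! ?m)" by (intro state_at_eqI)
  also have "\<dots> = fst (d !! ?m)" by (cases ?m) (simp_all add: advance_def)
  finally show "state_at (advance a d) s = state_at d (a + s)" by (simp add: state_at_def)
qed

text \<open>The remaining itinerary describes the original path of X shifted by the length of the
  episode, whether the episode ended inside a sojourn or at a jump of X.\<close>

lemma state_at_ep_rest:
  assumes "lifetime d = \<infinity>" "ep_time y d \<omega> < \<infinity>"
  shows "lifetime (ep_rest y d \<omega>) = \<infinity>" "s < \<infinity> \<Longrightarrow> state_at (ep_rest y d \<omega>) s = state_at d (ep_time y d \<omega> + s)"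
proof -
  have "ended y d \<omega>" using assms(2) by (auto simp: ep_time_def split: if_splits)
  then obtain n where n: "halts_at n y d \<omega>" unfolding ended_def by blast
  let ?e = "sdrop n d" and ?\<omega> = "sdrop n \<omega>"
  have T: "ep_time y d \<omega> = elapsed n d + halt_time y ?e ?\<omega>" and R: "ep_rest y d \<omega> = halt_rest y ?e ?\<omega>"
    using halts_at_imp_ended[OF n] by (simp_all add: ep_time_def ep_rest_def halt_index_eqI[OF n])
  have en: "elapsed n d < \<infinity>" and ht: "halt_time y ?e ?\<omega> < \<infinity>" using assms(2) T by auto
  have le: "lifetime ?e = \<infinity>" by (rule lifetime_sdrop[OF en assms(1)])
  have shift: "state_at ?e s = state_at d (elapsed n d + s)" if "s < \<infinity>" for s
    using state_at_shift[of n d s] en that assms(1) by simp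
  have *: "lifetime (halt_rest y ?e ?\<omega>) = \<infinity> \<and> (s < \<infinity> \<longrightarrow> state_at (halt_rest y ?e ?\<omega>) s = state_at ?e (halt_time y ?e ?\<omega> + s))" for s
  proof (cases "rings y ?e ?\<omega>")
    case True
    then have "alarm y ?e ?\<omega> < snd (shd ?e)" by (simp add: rings_def)
    from state_at_advance[OF this le] show ?thesis using True by (simp add: halt_rest_def halt_time_def)
  next
    case False
    then have w: "elapsed 1 ?e < \<infinity>" using ht by (simp add: halt_time_def elapsed_Suc)
    have "lifetime (sdrop 1 ?e) = \<infinity>" by (rule lifetime_sdrop[OF w le])
    moreover have "s < \<infinity> \<Longrightarrow> state_at ?e (elapsed 1 ?e + s) = state_at (sdrop 1 ?e) s"
      using state_at_shift[of 1 ?e s] w le by simp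
    ultimately show ?thesis using False by (simp add: halt_rest_def halt_time_def elapsed_Suc)
  qed
  show "lifetime (ep_rest y d \<omega>) = \<infinity>" using * R by simp
  assume s: "s < \<infinity>"
  have "state_at (ep_rest y d \<omega>) s = state_at ?e (halt_time y ?e ?\<omega> + s)" using * R s by simp
  also have "\<dots> = state_at d (ep_time y d \<omega> + s)"
    using shift[of "halt_time y ?e ?\<omega> + s"] ht s by (simp add: T add.assoc)
  finally show "state_at (ep_rest y d \<omega>) s = state_at d (ep_time y d \<omega> + s)" .
qed

lemma halts_at_Suc: "halts_at (Suc n) y d \<omega> \<longleftrightarrow> continues y d \<omega> \<and> halts_at n y (stl d) (stl \<omega>)"
  by (auto simp: halts_at_def alive_Suc)

lemma halts_at_0: "halts_at 0 y d \<omega> \<longleftrightarrow> halts y d \<omega>"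
  by (simp add: halts_at_def alive_def)

lemma ep_halts:
  assumes "halts y d \<omega>"
  shows "ep_time y d \<omega> = halt_time y d \<omega>" "ep_target y d \<omega> = halt_target y d \<omega>" "ep_rest y d \<omega> = halt_rest y d \<omega>"
proof -
  have "halts_at 0 y d \<omega>" using assms by (simp add: halts_at_0)
  from halts_at_imp_ended[OF this] halt_index_eqI[OF this] show
    "ep_time y d \<omega> = halt_time y d \<omega>" "ep_target y d \<omega> = halt_target y d \<omega>" "ep_rest y d \<omega> = halt_rest y d \<omega>"
    by (simp_all add: ep_time_def ep_target_def ep_rest_def)
qed

text \<open>For an episode that never ends \<open>ep_rest\<close> returns its argument, which is
  \<open>d\<close> on one side and \<open>stl d\<close> on the other; hence the condition
  \<open>ended\<close>.\<close>

lemma ep_continues: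
  assumes "continues y d \<omega>"
  shows "ep_time y d \<omega> = snd (shd d) + ep_time y (stl d) (stl \<omega>)"
    "ended y (stl d) (stl \<omega>) \<Longrightarrow> ep_target y d \<omega> = ep_target y (stl d) (stl \<omega>)"
    "ended y (stl d) (stl \<omega>) \<Longrightarrow> ep_rest y d \<omega> = ep_rest y (stl d) (stl \<omega>)"
proof -
  have e: "ended y d \<omega> \<longleftrightarrow> ended y (stl d) (stl \<omega>)"
  proof
    assume "ended y d \<omega>"
    then obtain n where n: "halts_at n y d \<omega>" unfolding ended_def by blast
    then show "ended y (stl d) (stl \<omega>)"
      using continues_not_halts[OF assms] by (cases n) (auto simp: halts_at_0 halts_at_Suc intro: halts_at_imp_ended)
  next
    assume "ended y (stl d) (stl \<omega>)"
    then obtain n where "halts_at n y (stl d) (stl \<omega>)" unfolding ended_def by blast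
    then have "halts_at (Suc n) y d \<omega>" using assms by (simp add: halts_at_Suc)
    then show "ended y d \<omega>" by (rule halts_at_imp_ended)
  qed
  have i: "halt_index y d \<omega> = Suc (halt_index y (stl d) (stl \<omega>))" if ed: "ended y (stl d) (stl \<omega>)"
  proof -
    obtain n where n: "halts_at n y (stl d) (stl \<omega>)" using ed unfolding ended_def by blast
    then have "halts_at (Suc n) y d \<omega>" using assms by (simp add: halts_at_Suc)
    then show ?thesis using n by (simp add: halt_index_eqI)
  qed
  show "ep_time y d \<omega> = snd (shd d) + ep_time y (stl d) (stl \<omega>)"
    using e i by (auto simp: ep_time_def Let_def elapsed_Suc_shift add.assoc)
  show "ended y (stl d) (stl \<omega>) \<Longrightarrow> ep_target y d \<omega> = ep_target y (stl d) (stl \<omega>)"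
    "ended y (stl d) (stl \<omega>) \<Longrightarrow> ep_rest y d \<omega> = ep_rest y (stl d) (stl \<omega>)"
    using e i by (auto simp: ep_target_def ep_rest_def Let_def)
qed

lemma ep_time_stuck:
  assumes "\<not> halts y d \<omega>" "\<not> continues y d \<omega>" shows "ep_time y d \<omega> = \<infinity>"
proof -
  have "\<not> halts_at n y d \<omega>" for n using assms by (cases n) (auto simp: halts_at_0 halts_at_Suc)
  then show ?thesis by (simp add: ep_time_def ended_def)
qed

lemma ep_time_greater:
  assumes "t < snd (shd d)" "t < alarm y d \<omega>" shows "t < ep_time y d \<omega>"
proof -
  consider "halts y d \<omega>" | "continues y d \<omega>" | "\<not> halts y d \<omega>" "\<not> continues y d \<omega>" by blast
  then show ?thesis
  proof cases
    case 1
    then show ?thesis using assms by (simp add: ep_halts halt_time_def)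
  next
    case 2
    then show ?thesis using assms(1) ep_continues(1)[OF 2] by (metis add.right_neutral add_left_mono less_le_trans zero_le)
  next
    case 3
    have "t < \<infinity>" using assms(1) by (rule less_le_trans) simp
    then show ?thesis using ep_time_stuck[OF 3] by simp
  qed
qed

text \<open>The dual process is adapted: an episode that ends before \<open>t\<close> only depends on the path of \<open>X\<close>
  up to time \<open>t\<close>.\<close>

lemma episode_agree:
  assumes "agree t d d'" "t < \<infinity>"
  shows "(t < ep_time y d \<omega> \<and> t < ep_time y d' \<omega>) \<or>
    (\<exists>s. ep_time y d' \<omega> = ep_time y d \<omega> \<and> t = ep_time y d \<omega> + s \<and> ended y d \<omega> \<and> ended y d' \<omega> \<and>
      ep_target y d' \<omega> = ep_target y d \<omega> \<and> agree s (ep_rest y d \<omega>) (ep_rest y d' \<omega>))"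
  using assms
proof (induction arbitrary: \<omega> rule: agree.induct)
  case (last d d' t)
  have al: "alarm y d' \<omega> = alarm y d \<omega>" and at: "alarm_target y d' \<omega> = alarm_target y d \<omega>"
    using last.hyps(1) by (simp_all add: alarm_def alarm_target_def)
  show ?case
  proof (cases "t < alarm y d \<omega>")
    case True
    then show ?thesis using last.hyps al by (auto intro: ep_time_greater)
  next
    case False
    then have le: "alarm y d \<omega> \<le> t" by simp
    have sum: "alarm y d \<omega> + (t - alarm y d \<omega>) = t" using le by (rule add_diff_inverse_ennreal)
    then have r: "rings y d \<omega>" "rings y d' \<omega>" using last.hyps al by (auto simp: rings_def)
    then have h: "halts y d \<omega>" "halts y d' \<omega>" by (auto simp: halts_def)
    have f: "alarm y d \<omega> < \<infinity>" using le last.prems by (rule le_less_trans)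
    have "agree (t - alarm y d \<omega>) (advance (alarm y d \<omega>) d) (advance (alarm y d \<omega>) d')"
    proof (rule agree.last)
      have *: "t - alarm y d \<omega> < w - alarm y d \<omega>" if "t < w" for w
        using that le f by (simp add: ennreal_minus_less_minus)
      show "t - alarm y d \<omega> < snd (shd (advance (alarm y d \<omega>) d))"
        "t - alarm y d \<omega> < snd (shd (advance (alarm y d \<omega>) d'))"
        using last.hyps by (simp_all add: advance_def *)
    qed (use last.hyps in \<open>simp add: advance_def\<close>)
    then show ?thesis
      using r h al at
      by (intro disjI2 exI[of _ "t - alarm y d \<omega>"])
        (simp add: sum ep_halts halt_time_def halt_target_def halt_rest_def halts_at_imp_ended[of 0] halts_at_0)
  qed
next
  case (jump d d' t)
  let ?w = "snd (shd d)"
  have w: "?w < \<infinity>" and t: "t < \<infinity>" using jump.prems by auto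
  have al: "alarm y d' \<omega> = alarm y d \<omega>" and at: "alarm_target y d' \<omega> = alarm_target y d \<omega>"
    using jump.hyps(1) by (simp_all add: alarm_def alarm_target_def)
  \<comment> \<open>The coin depends on the state entered at the jump. Agreement fixes that state
    even if no time is left after the jump, because a path up to \<open>t\<close> includes its value
    at \<open>t\<close>.\<close>
  have ct: "coin_toss y d' \<omega> = coin_toss y d \<omega>"
    using agree_fst[OF jump.hyps(2)] by (simp add: coin_toss_def)
  have same: "rings y d' \<omega> \<longleftrightarrow> rings y d \<omega>" "halts y d' \<omega> \<longleftrightarrow> halts y d \<omega>" "continues y d' \<omega> \<longleftrightarrow> continues y d \<omega>"
    using al ct jump.hyps(1) by (simp_all add: rings_def halts_def continues_def)
  consider (ring) "rings y d \<omega>" | (coin) "\<not> rings y d \<omega>" "halts y d \<omega>" | (cont) "continues y d \<omega>"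
    using w by (cases "coin_toss y d \<omega>") (auto simp: continues_def halts_def)
  then show ?case
  proof cases
    case ring
    then have h: "halts y d \<omega>" "halts y d' \<omega>" using same by (auto simp: halts_def)
    have a: "alarm y d \<omega> < ?w" using ring by (simp add: rings_def)
    have "alarm y d \<omega> + (?w - alarm y d \<omega>) = ?w"
      by (rule add_diff_inverse_ennreal) (use a in simp)
    then have sum: "alarm y d \<omega> + ((?w - alarm y d \<omega>) + t) = ?w + t" by (simp only: add.assoc[symmetric])
    have "agree (snd (shd (advance (alarm y d \<omega>) d)) + t) (advance (alarm y d \<omega>) d) (advance (alarm y d \<omega>) d')"
      by (rule agree.jump) (use jump.hyps in \<open>simp_all add: advance_def\<close>)
    then have "agree ((?w - alarm y d \<omega>) + t) (advance (alarm y d \<omega>) d) (advance (alarm y d \<omega>) d')"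
      by (simp add: advance_def)
    moreover have T: "?w + t = ep_time y d \<omega> + ((?w - alarm y d \<omega>) + t)"
      using ring h by (simp only: ep_halts halt_time_def if_True sum)
    ultimately show ?thesis
      using ring same h al at
      by (intro disjI2 exI[of _ "(?w - alarm y d \<omega>) + t"] conjI T)
        (simp_all add: ep_halts halt_time_def halt_target_def halt_rest_def halts_at_imp_ended[of 0] halts_at_0)
  next
    case coin
    then have h: "halts y d \<omega>" "halts y d' \<omega>" using same by auto
    then show ?thesis
      using coin same ct jump.hyps
      by (intro disjI2 exI[of _ t])
        (simp add: ep_halts halt_time_def halt_target_def halt_rest_def halts_at_imp_ended[of 0] halts_at_0)
  next
    case cont
    then have c: "continues y d \<omega>" "continues y d' \<omega>" using same by auto
    have en: "ended y d'' \<omega>" if ct: "continues y d'' \<omega>" and ed: "ended y (stl d'') (stl \<omega>)" for d''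
    proof -
      obtain n where "halts_at n y (stl d'') (stl \<omega>)" using ed unfolding ended_def by blast
      then have "halts_at (Suc n) y d'' \<omega>" using ct by (simp add: halts_at_Suc)
      then show ?thesis by (rule halts_at_imp_ended)
    qed
    from jump.IH[OF t, of "stl \<omega>"] show ?thesis
    proof (elim disjE exE conjE)
      assume "t < ep_time y (stl d) (stl \<omega>)" "t < ep_time y (stl d') (stl \<omega>)"
      then show ?thesis using w ep_continues(1)[OF c(1)] ep_continues(1)[OF c(2)] jump.hyps(1)
        by (intro disjI1) (simp add: ennreal_add_left_cancel_less)
    next
      fix s
      assume *: "ep_time y (stl d') (stl \<omega>) = ep_time y (stl d) (stl \<omega>)" "t = ep_time y (stl d) (stl \<omega>) + s"
        "ended y (stl d) (stl \<omega>)" "ended y (stl d') (stl \<omega>)"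
        "ep_target y (stl d') (stl \<omega>) = ep_target y (stl d) (stl \<omega>)" "agree s (ep_rest y (stl d) (stl \<omega>)) (ep_rest y (stl d') (stl \<omega>))"
      then show ?thesis
        using ep_continues[OF c(1)] ep_continues[OF c(2)] jump.hyps(1) en[OF c(1)] en[OF c(2)]
        by (intro disjI2 exI[of _ s]) (simp add: add.assoc)
    qed
  qed
qed

text \<open>Every episode receives a noise stream of its own and discards what it does not use, so
  successive episodes draw on independent noise.\<close>

primcorec dual_run :: "'t \<Rightarrow> ('s \<times> ennreal) stream \<Rightarrow> (real \<times> real) stream stream \<Rightarrow> ('t \<times> ennreal) stream" where
  "shd (dual_run y d v) = (y, ep_time y d (shd v))"
| "stl (dual_run y d v) = dual_run (ep_target y d (shd v)) (ep_rest y d (shd v)) (stl v)"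

primrec run_rest :: "nat \<Rightarrow> 't \<Rightarrow> ('s \<times> ennreal) stream \<Rightarrow> (real \<times> real) stream stream \<Rightarrow> ('s \<times> ennreal) stream" where
  "run_rest 0 y d v = d"
| "run_rest (Suc n) y d v = run_rest n (ep_target y d (shd v)) (ep_rest y d (shd v)) (stl v)"

lemma dual_run_snth: "dual_run y d v !! n = (fst (dual_run y d v !! n),
    ep_time (fst (dual_run y d v !! n)) (run_rest n y d v) (shd (sdrop n v)))"
  by (induction n arbitrary: y d v) simp_all

lemma dual_run_agree:
  assumes "agree t d d'" "t < \<infinity>"
    and "elapsed n (dual_run y d v) \<le> t \<or> elapsed n (dual_run y d' v) \<le> t"
  shows "elapsed n (dual_run y d v) = elapsed n (dual_run y d' v) \<and> fst (dual_run y d v !! n) = fst (dual_run y d' v !! n)"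
  using assms
proof (induction n arbitrary: y d d' v t)
  case (Suc n)
  let ?\<omega> = "shd v"
  from episode_agree[OF Suc.prems(1,2), of y ?\<omega>] show ?case
  proof (elim disjE exE conjE)
    assume "t < ep_time y d ?\<omega>" "t < ep_time y d' ?\<omega>"
    then have "t < elapsed (Suc n) (dual_run y d v)" "t < elapsed (Suc n) (dual_run y d' v)"
      unfolding elapsed_Suc_shift by (auto intro: less_le_trans)
    then show ?thesis using Suc.prems(3) by auto
  next
    fix s
    assume *: "ep_time y d' ?\<omega> = ep_time y d ?\<omega>" "t = ep_time y d ?\<omega> + s"
      "ep_target y d' ?\<omega> = ep_target y d ?\<omega>" "agree s (ep_rest y d ?\<omega>) (ep_rest y d' ?\<omega>)"
    then have f: "ep_time y d ?\<omega> < \<infinity>" "s < \<infinity>" using Suc.prems(2) by auto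
    have "elapsed n (stl (dual_run y d v)) \<le> s \<or> elapsed n (stl (dual_run y d' v)) \<le> s"
      using Suc.prems(3) * f unfolding elapsed_Suc_shift by (auto simp: ennreal_add_left_cancel_le)
    with Suc.IH[OF *(4) f(2), of "ep_target y d ?\<omega>" "stl v"] * show ?thesis
      unfolding elapsed_Suc_shift by simp
  qed
qed simp

lemma path_at_dual_run_agree:
  assumes "agree t d d'" "t < \<infinity>" "u \<le> t"
  shows "path_at (dual_run y d v) u = path_at (dual_run y d' v) u"
  by (rule path_at_eqI[OF _ assms(3)]) (rule dual_run_agree[OF assms(1,2)])

lemma state_at_run_rest:
  assumes "lifetime d = \<infinity>" "elapsed n (dual_run y d v) < \<infinity>" "s < \<infinity>"
  shows "state_at d (elapsed n (dual_run y d v) + s) = state_at (run_rest n y d v) s"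
  using assms
proof (induction n arbitrary: y d v)
  case (Suc n)
  let ?d = "ep_rest y d (shd v)" and ?y = "ep_target y d (shd v)"
  have e: "elapsed (Suc n) (dual_run y d v) = ep_time y d (shd v) + elapsed n (dual_run ?y ?d (stl v))"
    by (simp add: elapsed_Suc_shift)
  then have f: "ep_time y d (shd v) < \<infinity>" "elapsed n (dual_run ?y ?d (stl v)) < \<infinity>" using Suc.prems(2) by auto
  note r = state_at_ep_rest[OF Suc.prems(1) f(1)]
  show ?case
    using Suc.IH[OF r(1) f(2) Suc.prems(3)] r(2)[of "elapsed n (dual_run ?y ?d (stl v)) + s"] f Suc.prems(3)
    by (simp add: e add.assoc)
qed simp

end

lemma measurable_path_at [measurable (raw)]:
  fixes d :: "'m \<Rightarrow> ('s::countable \<times> ennreal) stream"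
  assumes [measurable]: "d \<in> M \<rightarrow>\<^sub>M itinerary_space" "t \<in> borel_measurable M"
  shows "(\<lambda>\<omega>. path_at (d \<omega>) (t \<omega>)) \<in> M \<rightarrow>\<^sub>M count_space UNIV"
  unfolding path_at_def by measurable

lemma measurable_discrete2:
  fixes a :: "'m \<Rightarrow> 'a::countable" and b :: "'m \<Rightarrow> 'b::countable"
  assumes "a \<in> M \<rightarrow>\<^sub>M count_space UNIV" "b \<in> M \<rightarrow>\<^sub>M count_space UNIV"
  shows "(\<lambda>\<omega>. g (a \<omega>) (b \<omega>) :: ennreal) \<in> borel_measurable M"
  by (rule measurable_compose_countable[of "\<lambda>a \<omega>. g a (b \<omega>)", OF _ assms(1)])
    (rule measurable_compose[OF assms(2)], simp)

section \<open>Regeneration and filtering along the run\<close>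

context intertwining
begin

lemma measurable_episode_random [measurable (raw)]:
  assumes [measurable]: "y \<in> M \<rightarrow>\<^sub>M count_space UNIV" "d \<in> M \<rightarrow>\<^sub>M itinerary_space" "\<omega> \<in> M \<rightarrow>\<^sub>M noise"
  shows "(\<lambda>x. ep_time (y x) (d x) (\<omega> x)) \<in> borel_measurable M"
    and "(\<lambda>x. ep_target (y x) (d x) (\<omega> x)) \<in> M \<rightarrow>\<^sub>M count_space UNIV"
    and "(\<lambda>x. ep_rest (y x) (d x) (\<omega> x)) \<in> M \<rightarrow>\<^sub>M itinerary_space"
proof -
  show "(\<lambda>x. ep_time (y x) (d x) (\<omega> x)) \<in> borel_measurable M"
    by (rule measurable_compose_countable[of "\<lambda>y x. ep_time y (d x) (\<omega> x)"]) measurable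
  show "(\<lambda>x. ep_target (y x) (d x) (\<omega> x)) \<in> M \<rightarrow>\<^sub>M count_space UNIV"
    by (rule measurable_compose_countable[of "\<lambda>y x. ep_target y (d x) (\<omega> x)"]) measurable
  show "(\<lambda>x. ep_rest (y x) (d x) (\<omega> x)) \<in> M \<rightarrow>\<^sub>M itinerary_space"
    by (rule measurable_compose_countable[of "\<lambda>y x. ep_rest y (d x) (\<omega> x)"]) measurable
qed

lemma measurable_dual_run [measurable (raw)]:
  assumes "y \<in> M \<rightarrow>\<^sub>M count_space UNIV" "d \<in> M \<rightarrow>\<^sub>M itinerary_space" "v \<in> M \<rightarrow>\<^sub>M noises"
  shows "(\<lambda>x. dual_run (y x) (d x) (v x)) \<in> M \<rightarrow>\<^sub>M itinerary_space"
proof -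
  define R where "R f \<longleftrightarrow> (\<exists>y \<in> M \<rightarrow>\<^sub>M count_space UNIV. \<exists>d \<in> M \<rightarrow>\<^sub>M itinerary_space. \<exists>v \<in> M \<rightarrow>\<^sub>M noises.
    f = (\<lambda>x. dual_run (y x) (d x) (v x)))" for f
  have "R (\<lambda>x. dual_run (y x) (d x) (v x))" unfolding R_def using assms by blast
  then show ?thesis
  proof (coinduct rule: measurable_stream_coinduct)
    case (shd f)
    then obtain y d v where [measurable]: "y \<in> M \<rightarrow>\<^sub>M count_space UNIV" "d \<in> M \<rightarrow>\<^sub>M itinerary_space" "v \<in> M \<rightarrow>\<^sub>M noises"
      and f: "f = (\<lambda>x. dual_run (y x) (d x) (v x))" unfolding R_def by blast
    show ?case unfolding f dual_run.sel by measurable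
  next
    case (stl f)
    then obtain y d v where m [measurable]: "y \<in> M \<rightarrow>\<^sub>M count_space UNIV" "d \<in> M \<rightarrow>\<^sub>M itinerary_space" "v \<in> M \<rightarrow>\<^sub>M noises"
      and f: "f = (\<lambda>x. dual_run (y x) (d x) (v x))" unfolding R_def by blast
    show ?case unfolding f R_def dual_run.sel
      by (intro bexI[of _ "\<lambda>x. ep_target (y x) (d x) (shd (v x))"] bexI[of _ "\<lambda>x. ep_rest (y x) (d x) (shd (v x))"]
          bexI[of _ "\<lambda>x. stl (v x)"] refl) measurable
  qed
qed

lemma measurable_run_rest [measurable (raw)]:
  assumes "y \<in> M \<rightarrow>\<^sub>M count_space UNIV" "d \<in> M \<rightarrow>\<^sub>M itinerary_space" "v \<in> M \<rightarrow>\<^sub>M noises"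
  shows "(\<lambda>x. run_rest n (y x) (d x) (v x)) \<in> M \<rightarrow>\<^sub>M itinerary_space"
  using assms
proof (induction n arbitrary: y d v)
  case (Suc n)
  note [measurable] = Suc.prems
  show ?case unfolding run_rest.simps by (rule Suc.IH) measurable
qed simp

lemma measurable_nn_integral_start_law_random [measurable (raw)]:
  assumes [measurable]: "(\<lambda>(w, d). F w d) \<in> borel_measurable (M \<Otimes>\<^sub>M itinerary_space)" "z \<in> M \<rightarrow>\<^sub>M count_space UNIV"
  shows "(\<lambda>w. \<integral>\<^sup>+d. F w d \<partial>start_law (z w)) \<in> borel_measurable M"
  by (rule measurable_compose_countable[of "\<lambda>z w. \<integral>\<^sup>+d. F w d \<partial>start_law z"]) measurable

lemma nn_integral_noises:
  assumes "f \<in> borel_measurable noises"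
  shows "(\<integral>\<^sup>+v. f v \<partial>noises) = (\<integral>\<^sup>+\<omega>. \<integral>\<^sup>+v. f (\<omega> ## v) \<partial>noises \<partial>noise)"
  by (rule prob_space.nn_integral_stream_space[OF prob_space_noise assms])

text \<open>Regeneration at the \<open>n\<close>-th jump of the dual process.\<close>

lemma run_law:
  assumes "(\<lambda>(p, d, v). F p d v) \<in> borel_measurable (itinerary_space \<Otimes>\<^sub>M itinerary_space \<Otimes>\<^sub>M noises)"
    and "\<And>p d v. F p d v \<le> 1"
  shows "(\<integral>\<^sup>+d. \<integral>\<^sup>+v. F (halted n (dual_run y d v)) (run_rest n y d v) (sdrop n v) \<partial>noises \<partial>start_law y)
    = (\<integral>\<^sup>+p. \<integral>\<^sup>+d. \<integral>\<^sup>+v. F (halted n p) d v \<partial>noises \<partial>start_law (fst (p !! n)) \<partial>jump_law_at Ls y)"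
  using assms
proof (induction n arbitrary: y F)
  case 0
  note [measurable (raw)] = measurable_app3[OF 0(1)]
  let ?c = "\<integral>\<^sup>+d. \<integral>\<^sup>+v. F (sconst (y, \<infinity>)) d v \<partial>noises \<partial>start_law y"
  have "(\<integral>\<^sup>+p. \<integral>\<^sup>+d. \<integral>\<^sup>+v. F (halted 0 p) d v \<partial>noises \<partial>start_law (fst (p !! 0)) \<partial>jump_law_at Ls y)
    = (\<integral>\<^sup>+p. ?c \<partial>jump_law_at Ls y)"
    by (rule nn_integral_cong_AE)
      (use AE_jump_law_at_shd[where L = Ls and x = y] in \<open>auto elim!: eventually_mono simp: halted_0\<close>)
  also have "\<dots> = ?c" using prob_space.emeasure_space_1[OF prob_space_jump_law_at, of Ls y] by simp
  finally show ?case by (simp add: halted_0)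
next
  case (Suc n)
  note [measurable (raw)] = measurable_app3[OF Suc.prems(1)]
  \<comment> \<open>Everything after the first episode, with its noise integrated out, as a function
    of the exit time, the exit point and the rest of X. It is bounded by 1, as
    \<open>episode_law\<close> requires.\<close>
  define G where "G w z d = (\<integral>\<^sup>+v. F ((y, w) ## halted n (dual_run z d v)) (run_rest n z d v) (sdrop n v) \<partial>noises)" for w z d
  have G: "(\<lambda>(w, z, d). G w z d) \<in> borel_measurable (borel \<Otimes>\<^sub>M count_space UNIV \<Otimes>\<^sub>M itinerary_space)"
    unfolding G_def by measurable
  interpret noises: prob_space noises by (rule prob_space_noises)
  have G1: "G w z d \<le> 1" for w z d
  proof -
    have "G w z d \<le> (\<integral>\<^sup>+v. 1 \<partial>noises)" unfolding G_def by (intro nn_integral_mono Suc.prems(2))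
    then show ?thesis by (simp add: noises.emeasure_space_1)
  qed
  have "(\<integral>\<^sup>+d. \<integral>\<^sup>+v. F (halted (Suc n) (dual_run y d v)) (run_rest (Suc n) y d v) (sdrop (Suc n) v) \<partial>noises \<partial>start_law y)
    = ep_mean y (\<lambda>d \<omega>. G (ep_time y d \<omega>) (ep_target y d \<omega>) (ep_rest y d \<omega>))"
    unfolding ep_mean_def G_def
    by (intro nn_integral_cong, subst nn_integral_noises, measurable) (simp add: halted_Suc)
  also have "\<dots> = ep_target_mean y G" by (rule episode_law[OF G G1])
  also have "\<dots> = (\<integral>\<^sup>+w. \<integral>\<^sup>+z. \<integral>\<^sup>+p. \<integral>\<^sup>+d. \<integral>\<^sup>+v. F ((y, w) ## halted n p) d v \<partial>noises \<partial>start_law (fst (p !! n)) \<partial>jump_law_at Ls z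
      \<partial>measure_pmf (jump_pmf Ls y) \<partial>expo (dual_rate y))"
    unfolding ep_target_mean_def G_def
    by (intro nn_integral_cong Suc.IH[where F = "\<lambda>p d v. F ((y, w) ## p) d v" for w] Suc.prems(2)) measurable
  also have "\<dots> = (\<integral>\<^sup>+p. \<integral>\<^sup>+d. \<integral>\<^sup>+v. F (halted (Suc n) p) d v \<partial>noises \<partial>start_law (fst (p !! Suc n)) \<partial>jump_law_at Ls y)"
    by (subst nn_integral_jump_law_at[of _ Ls y], measurable) (simp add: halted_Suc)
  finally show ?case .
qed

lemma emeasure_dual_run_cylinder:
  "(\<integral>\<^sup>+d. \<integral>\<^sup>+v. indicator (cylinder n yy t) (dual_run y d v) \<partial>noises \<partial>start_law y)
    = emeasure (jump_law_at Ls y) (cylinder n yy t)"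
proof -
  interpret noises: prob_space noises by (rule prob_space_noises)
  \<comment> \<open>A cylinder of index \<open>n\<close> reads the entries 0 to \<open>n\<close>,
    exactly those that \<open>halted (Suc n)\<close> keeps.\<close>
  have c: "indicator (cylinder n yy t) (halted (Suc n) p) = (indicator (cylinder n yy t) p :: ennreal)" for p
    by (auto simp: cylinder_def indicator_def halted_snth)
  have "(\<integral>\<^sup>+d. \<integral>\<^sup>+v. indicator (cylinder n yy t) (halted (Suc n) (dual_run y d v)) \<partial>noises \<partial>start_law y)
    = (\<integral>\<^sup>+p. \<integral>\<^sup>+d. \<integral>\<^sup>+v. indicator (cylinder n yy t) (halted (Suc n) p) \<partial>noises \<partial>start_law (fst (p !! Suc n)) \<partial>jump_law_at Ls y)"
    by (rule run_law[where F = "\<lambda>p d v. indicator (cylinder n yy t) p"]) (auto simp: indicator_def)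
  then show ?thesis
    unfolding c using prob_space.emeasure_space_1[OF prob_space_start_law]
    by (simp add: noises.emeasure_space_1)
qed

text \<open>On the event that the \<open>n\<close>-th sojourn of the dual process contains
  \<open>t\<close>, its past is \<open>halted n\<close>. By \<open>run_law\<close>, X has then been
  restarted from the kernel row of the current state, and by \<open>ep_survival\<close> it still has
  that law after the remaining time, given survival.\<close>

lemma filter_run:
  fixes f :: "'s \<Rightarrow> ennreal" and G :: "('t \<times> ennreal) stream \<Rightarrow> ennreal"
  assumes [measurable]: "G \<in> borel_measurable itinerary_space" and G1: "\<And>p. G p \<le> 1" and f1: "\<And>x. f x \<le> 1" and t: "0 \<le> t"
  shows "(\<integral>\<^sup>+d. \<integral>\<^sup>+v. (if elapsed n (dual_run y d v) \<le> ennreal t \<and> ennreal t < elapsed (Suc n) (dual_run y d v)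
      then G (halted n (dual_run y d v)) * f (state_at d (ennreal t)) else 0) \<partial>noises \<partial>start_law y)
    = (\<integral>\<^sup>+d. \<integral>\<^sup>+v. (if elapsed n (dual_run y d v) \<le> ennreal t \<and> ennreal t < elapsed (Suc n) (dual_run y d v)
      then G (halted n (dual_run y d v)) * (\<integral>\<^sup>+x. f x \<partial>measure_pmf (kernel_pmf (fst (dual_run y d v !! n)))) else 0) \<partial>noises \<partial>start_law y)"
proof -
  \<comment> \<open>A test function of both states, so that the two sides of the claim are instances
    of one expression.\<close>
  define H where "H g p d v = (if elapsed n p \<le> ennreal t \<and> ennreal t - elapsed n p < ep_time (fst (p !! n)) d (shd v)
    then G p * g (fst (p !! n)) (state_at d (ennreal t - elapsed n p)) else 0)" for g :: "'t \<Rightarrow> 's \<Rightarrow> ennreal" and p d v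
  have meas: "(\<lambda>(p, d, v). H g p d v) \<in> borel_measurable (itinerary_space \<Otimes>\<^sub>M itinerary_space \<Otimes>\<^sub>M noises)" for g
  proof -
    have [measurable]: "(\<lambda>(p, d, v). g (fst (p !! n)) (state_at d (ennreal t - elapsed n p)))
      \<in> borel_measurable (itinerary_space \<Otimes>\<^sub>M itinerary_space \<Otimes>\<^sub>M noises)"
      unfolding case_prod_beta' by (rule measurable_discrete2) measurable
    show ?thesis unfolding H_def by measurable
  qed
  have H1: "H g p d v \<le> 1" if "\<And>y x. g y x \<le> 1" for g p d v
    using mult_mono[OF G1[of p] that[of "fst (p !! n)" "state_at d (ennreal t - elapsed n p)"]] by (simp add: H_def)
  have inner: "(\<integral>\<^sup>+d. \<integral>\<^sup>+v. H g p d v \<partial>noises \<partial>start_law (fst (p !! n)))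
    = (if elapsed n p \<le> ennreal t then G p * (ennreal (exp (- (dual_rate (fst (p !! n)) * enn2real (ennreal t - elapsed n p)))) *
        (\<integral>\<^sup>+x. g (fst (p !! n)) x \<partial>measure_pmf (kernel_pmf (fst (p !! n))))) else 0)" for g p
  proof (cases "elapsed n p \<le> ennreal t")
    case True
    let ?z = "fst (p !! n)" and ?s = "enn2real (ennreal t - elapsed n p)"
    interpret noises: prob_space noises by (rule prob_space_noises)
    have "ennreal t - elapsed n p < \<infinity>" by (simp add: less_top[symmetric])
    then have s: "ennreal ?s = ennreal t - elapsed n p" by (simp add: less_top)
    have "(\<integral>\<^sup>+d. \<integral>\<^sup>+v. H g p d v \<partial>noises \<partial>start_law ?z)
      = (\<integral>\<^sup>+d. \<integral>\<^sup>+\<omega>. G p * (if ennreal ?s < ep_time ?z d \<omega> then g ?z (state_at d (ennreal ?s)) else 0) \<partial>noise \<partial>start_law ?z)"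
      unfolding H_def using True
      by (intro nn_integral_cong, subst nn_integral_noises, measurable)
        (auto intro!: nn_integral_cong simp: s noises.emeasure_space_1)
    also have "\<dots> = G p * ep_mean ?z (\<lambda>d \<omega>. if ennreal ?s < ep_time ?z d \<omega> then g ?z (state_at d (ennreal ?s)) else 0)"
      unfolding ep_mean_def by (simp add: nn_integral_cmult)
    also have "\<dots> = G p * (ennreal (exp (- (dual_rate ?z * ?s))) * (\<integral>\<^sup>+x. g ?z x \<partial>measure_pmf (kernel_pmf ?z)))"
      by (subst ep_survival) simp_all
    finally show ?thesis using True by simp
  qed (simp add: H_def)
  let ?\<Lambda> = "\<lambda>z. \<integral>\<^sup>+x. f x \<partial>measure_pmf (kernel_pmf z)"
  have \<Lambda>1: "?\<Lambda> z \<le> 1" for z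
  proof -
    have "?\<Lambda> z \<le> (\<integral>\<^sup>+x. 1 \<partial>measure_pmf (kernel_pmf z))" by (intro nn_integral_mono f1)
    then show ?thesis using prob_space.emeasure_space_1[OF prob_space_measure_pmf, of "kernel_pmf z"] by simp
  qed
  have path: "(\<integral>\<^sup>+d. \<integral>\<^sup>+v. (if elapsed n (dual_run y d v) \<le> ennreal t \<and> ennreal t < elapsed (Suc n) (dual_run y d v)
      then G (halted n (dual_run y d v)) * g (fst (dual_run y d v !! n)) (state_at d (ennreal t)) else 0) \<partial>noises \<partial>start_law y)
    = (\<integral>\<^sup>+d. \<integral>\<^sup>+v. H g (halted n (dual_run y d v)) (run_rest n y d v) (sdrop n v) \<partial>noises \<partial>start_law y)" for g
  proof (rule nn_integral_cong_AE, use AE_start_law_lifetime[of y] in eventually_elim)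
    case (elim d)
    show ?case
    proof (intro nn_integral_cong)
      fix v
      let ?P = "dual_run y d v" and ?d = "run_rest n y d v"
      have W: "snd (?P !! n) = ep_time (fst (?P !! n)) ?d (shd (sdrop n v))"
        by (subst dual_run_snth) simp
      have e: "elapsed n (halted n ?P) = elapsed n ?P" "halted n ?P !! n = (fst (?P !! n), \<infinity>)"
        by (simp_all add: elapsed_halted halted_snth)
      show "(if elapsed n ?P \<le> ennreal t \<and> ennreal t < elapsed (Suc n) ?P
        then G (halted n ?P) * g (fst (?P !! n)) (state_at d (ennreal t)) else 0) = H g (halted n ?P) ?d (sdrop n v)"
      proof (cases "elapsed n ?P \<le> ennreal t")
        case True
        have f: "elapsed n ?P < \<infinity>" using True by (rule le_less_trans) simp
        let ?s = "ennreal t - elapsed n ?P"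
        have ts: "elapsed n ?P + ?s = ennreal t" by (rule add_diff_inverse_ennreal[OF True])
        have "state_at d (elapsed n ?P + ?s) = state_at ?d ?s"
          by (rule state_at_run_rest[OF elim f]) (simp add: less_top[symmetric])
        then have st: "state_at d (ennreal t) = state_at ?d ?s" by (simp only: ts)
        have "elapsed n ?P + ?s < elapsed n ?P + snd (?P !! n) \<longleftrightarrow> ?s < snd (?P !! n)"
          using f by (simp only: ennreal_add_left_cancel_less) auto
        then have "ennreal t < elapsed (Suc n) ?P \<longleftrightarrow> ?s < snd (?P !! n)" by (simp only: ts elapsed_Suc)
        then show ?thesis using True by (simp add: H_def e W st)
      qed (simp add: H_def e)
    qed
  qed
  have "(\<integral>\<^sup>+d. \<integral>\<^sup>+v. H (\<lambda>_. f) (halted n (dual_run y d v)) (run_rest n y d v) (sdrop n v) \<partial>noises \<partial>start_law y)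
    = (\<integral>\<^sup>+d. \<integral>\<^sup>+v. H (\<lambda>z _. ?\<Lambda> z) (halted n (dual_run y d v)) (run_rest n y d v) (sdrop n v) \<partial>noises \<partial>start_law y)"
  proof -
    \<comment> \<open>Both sides carry the same survival factor, and averaging the constant
      \<open>?\<Lambda> z\<close> over a probability returns it.\<close>
    have "(\<integral>\<^sup>+d. \<integral>\<^sup>+v. H (\<lambda>_. f) (halted n p) d v \<partial>noises \<partial>start_law (fst (p !! n)))
      = (\<integral>\<^sup>+d. \<integral>\<^sup>+v. H (\<lambda>z _. ?\<Lambda> z) (halted n p) d v \<partial>noises \<partial>start_law (fst (p !! n)))" for p
      using inner[of "halted n p" "\<lambda>_. f"] inner[of "halted n p" "\<lambda>z _. ?\<Lambda> z"]
        prob_space.emeasure_space_1[OF prob_space_measure_pmf] by (simp add: halted_snth)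
    then show ?thesis
      unfolding run_law[OF meas[of "\<lambda>_. f"] H1[OF f1]] run_law[OF meas[of "\<lambda>z _. ?\<Lambda> z"] H1[OF \<Lambda>1]]
      by simp
  qed
  then show ?thesis using path[of "\<lambda>_. f"] path[of "\<lambda>z _. ?\<Lambda> z"] by simp
qed

end

section \<open>Construction of the dual process from X and a uniform variable\<close>

lemma space_process_sigma [simp]: "space (process_sigma M Z I) = space M"
  unfolding process_sigma_def by (intro space_measure_of) auto

lemma measurable_process_sigma:
  assumes "s \<in> I" shows "Z s \<in> process_sigma M Z I \<rightarrow>\<^sub>M count_space UNIV"
proof (rule measurableI)
  fix A
  have "Z s -` A \<inter> space M \<in> {Z s -` A \<inter> space M | s A. s \<in> I}" using assms by blast
  then show "Z s -` A \<inter> space (process_sigma M Z I) \<in> sets (process_sigma M Z I)"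
    unfolding space_process_sigma unfolding process_sigma_def
    by (subst sets_measure_of) (auto intro: sigma_sets.Basic)
qed simp

lemma sets_process_sigma_subset:
  assumes "\<And>s. s \<in> I \<Longrightarrow> Z s \<in> N \<rightarrow>\<^sub>M count_space UNIV" "space N = space M"
  shows "sets (process_sigma M Z I) \<subseteq> sets N"
proof -
  have "{Z s -` A \<inter> space M | s A. s \<in> I} \<subseteq> sets N"
    using measurable_sets[OF assms(1)] assms(2) by force
  then have "sigma_sets (space N) {Z s -` A \<inter> space M | s A. s \<in> I} \<subseteq> sets N"
    by (rule sets.sigma_sets_subset)
  then show ?thesis
    unfolding process_sigma_def by (subst sets_measure_of) (auto simp: assms(2))
qed

locale dual_construction = intertwining \<Lambda> L Ls + prob_space M
  for \<Lambda> :: "'t::countable \<Rightarrow> 's::countable \<Rightarrow> real" and L Ls and M :: "'w measure" +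
  fixes \<mu> :: "'s pmf" and \<mu>s :: "'t pmf"
    and X :: "real \<Rightarrow> 'w \<Rightarrow> 's" and TX :: "'w \<Rightarrow> ennreal" and U :: "'w \<Rightarrow> real"
  assumes X: "minimal_process M L \<mu> (\<lambda>t \<omega>. Some (X t \<omega>)) TX"
    and U: "U \<in> borel_measurable M" "distr M borel U = uniform_measure lborel {0..1}"
    and indep: "indep_set (sets (process_sigma M X {0..})) (sets (vimage_algebra (space M) U borel))"
    and init: "vec_mat_prod (pmf \<mu>s) \<Lambda> = pmf \<mu>"
begin

text \<open>Bayes' formula for the initial state of the dual process given that of X. The value at
  null states of \<open>\<mu>\<close> is arbitrary.\<close>

definition init_pmf :: "'s \<Rightarrow> 't pmf" where
  "init_pmf x = (if pmf \<mu> x = 0 then \<mu>s else embed_pmf (\<lambda>y. pmf \<mu>s y * \<Lambda> y x / pmf \<mu> x))"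

lemma nn_integral_init: "(\<integral>\<^sup>+y. ennreal (pmf \<mu>s y) * ennreal (\<Lambda> y x) \<partial>count_space UNIV) = ennreal (pmf \<mu> x)"
proof -
  have "Infinite_Sum.abs_summable_on (pmf \<mu>s) UNIV"
    unfolding abs_summable_equivalent by (rule pmf_abs_summable)
  then have s: "pmf \<mu>s summable_on UNIV" by simp
  have sm: "(\<lambda>y. pmf \<mu>s y * \<Lambda> y x) summable_on UNIV"
    by (rule summable_on_comparison_test[OF s]) (auto intro!: mult_left_le kernel_le_1 mult_nonneg_nonneg kernel_nonneg)
  have "(\<Sum>\<^sub>\<infinity>y. pmf \<mu>s y * \<Lambda> y x) = pmf \<mu> x"
    using fun_cong[OF init, of x] by (simp add: vec_mat_prod_def)
  then have "((\<lambda>y. pmf \<mu>s y * \<Lambda> y x) has_sum pmf \<mu> x) UNIV"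
    using has_sum_infsum[OF sm] by (simp only:)
  then have "(\<integral>\<^sup>+y. ennreal (pmf \<mu>s y * \<Lambda> y x) \<partial>count_space UNIV) = ennreal (pmf \<mu> x)"
    by (rule nn_integral_has_sum) (simp add: kernel_nonneg)
  then show ?thesis by (simp add: ennreal_mult kernel_nonneg)
qed

lemma pmf_init_pmf: "pmf \<mu> x * pmf (init_pmf x) y = pmf \<mu>s y * \<Lambda> y x"
proof (cases "pmf \<mu> x = 0")
  case True
  have "ennreal (pmf \<mu>s y) * ennreal (\<Lambda> y x) \<le> ennreal (pmf \<mu> x)"
    unfolding nn_integral_init[symmetric]
    by (rule nn_integral_ge_point[of y UNIV "\<lambda>y. ennreal (pmf \<mu>s y) * ennreal (\<Lambda> y x)"]) simp
  then show ?thesis using True kernel_nonneg by (simp add: ennreal_mult[symmetric] antisym)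
next
  case False
  then have o: "0 < pmf \<mu> x" by (simp add: order_le_neq_trans)
  have "(\<integral>\<^sup>+y. ennreal (pmf \<mu>s y * \<Lambda> y x / pmf \<mu> x) \<partial>count_space UNIV)
    = (\<integral>\<^sup>+y. ennreal (1 / pmf \<mu> x) * (ennreal (pmf \<mu>s y) * ennreal (\<Lambda> y x)) \<partial>count_space UNIV)"
    using o kernel_nonneg by (intro nn_integral_cong) (simp add: ennreal_mult[symmetric])
  also have "\<dots> = 1" using o by (simp add: nn_integral_cmult nn_integral_init ennreal_mult[symmetric])
  finally have "pmf (init_pmf x) y = pmf \<mu>s y * \<Lambda> y x / pmf \<mu> x"
    unfolding init_pmf_def using False o kernel_nonneg by (simp add: pmf_embed_pmf)
  then show ?thesis using False by simp
qed

text \<open>The joint initial law can be disintegrated in either order: X first, as the given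
  process requires, or the dual state first and X from the kernel, as the analysis of episodes
  requires.\<close>

lemma nn_integral_init_pmf:
  assumes G [measurable]: "\<And>y. G y \<in> borel_measurable itinerary_space"
  shows "(\<integral>\<^sup>+d. \<integral>\<^sup>+y. G y d \<partial>measure_pmf (init_pmf (fst (shd d))) \<partial>jump_law L \<mu>)
    = (\<integral>\<^sup>+y. \<integral>\<^sup>+d. G y d \<partial>start_law y \<partial>measure_pmf \<mu>s)"
proof -
  have [measurable]: "(\<lambda>d. \<integral>\<^sup>+y. G y d \<partial>measure_pmf (init_pmf (fst (shd d)))) \<in> borel_measurable itinerary_space"
    by (rule measurable_compose_countable[of "\<lambda>x d. \<integral>\<^sup>+y. G y d \<partial>measure_pmf (init_pmf x)"]) measurable
  have "(\<integral>\<^sup>+d. \<integral>\<^sup>+y. G y d \<partial>measure_pmf (init_pmf (fst (shd d))) \<partial>jump_law L \<mu>)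
    = (\<integral>\<^sup>+x. \<integral>\<^sup>+d. \<integral>\<^sup>+y. G y d \<partial>measure_pmf (init_pmf (fst (shd d))) \<partial>jump_law_at L x \<partial>measure_pmf \<mu>)"
    by (rule nn_integral_jump_law) measurable
  also have "\<dots> = (\<integral>\<^sup>+x. \<integral>\<^sup>+y. \<integral>\<^sup>+d. G y d \<partial>jump_law_at L x \<partial>measure_pmf (init_pmf x) \<partial>measure_pmf \<mu>)"
  proof (rule nn_integral_cong)
    fix x
    have "(\<integral>\<^sup>+d. \<integral>\<^sup>+y. G y d \<partial>measure_pmf (init_pmf (fst (shd d))) \<partial>jump_law_at L x)
      = (\<integral>\<^sup>+d. \<integral>\<^sup>+y. G y d \<partial>measure_pmf (init_pmf x) \<partial>jump_law_at L x)"
      by (rule nn_integral_cong_AE) (use AE_jump_law_at_shd[where L = L and x = x] in \<open>auto elim!: eventually_mono\<close>)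
    also have "\<dots> = (\<integral>\<^sup>+y. \<integral>\<^sup>+d. G y d \<partial>jump_law_at L x \<partial>measure_pmf (init_pmf x))"
      by (rule nn_integral_pmf_swap) measurable
    finally show "(\<integral>\<^sup>+d. \<integral>\<^sup>+y. G y d \<partial>measure_pmf (init_pmf (fst (shd d))) \<partial>jump_law_at L x) = \<dots>" .
  qed
  also have "\<dots> = (\<integral>\<^sup>+x. \<integral>\<^sup>+y. ennreal (pmf \<mu>s y) * (ennreal (\<Lambda> y x) * (\<integral>\<^sup>+d. G y d \<partial>jump_law_at L x)) \<partial>count_space UNIV \<partial>count_space UNIV)"
    unfolding nn_integral_measure_pmf
  proof (intro nn_integral_cong)
    fix x
    have *: "ennreal (pmf \<mu> x) * ennreal (pmf (init_pmf x) y) = ennreal (pmf \<mu>s y) * ennreal (\<Lambda> y x)" for y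
      using pmf_init_pmf[of x y] kernel_nonneg by (simp add: ennreal_mult[symmetric])
    show "ennreal (pmf \<mu> x) * (\<integral>\<^sup>+y. ennreal (pmf (init_pmf x) y) * (\<integral>\<^sup>+d. G y d \<partial>jump_law_at L x) \<partial>count_space UNIV)
      = (\<integral>\<^sup>+y. ennreal (pmf \<mu>s y) * (ennreal (\<Lambda> y x) * (\<integral>\<^sup>+d. G y d \<partial>jump_law_at L x)) \<partial>count_space UNIV)"
      by (subst nn_integral_cmult[symmetric]) (simp_all add: mult.assoc[symmetric] *)
  qed
  also have "\<dots> = (\<integral>\<^sup>+y. \<integral>\<^sup>+x. ennreal (pmf \<mu>s y) * (ennreal (\<Lambda> y x) * (\<integral>\<^sup>+d. G y d \<partial>jump_law_at L x)) \<partial>count_space UNIV \<partial>count_space UNIV)"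
    by (rule nn_integral_count_space_nn_integral) auto
  also have "\<dots> = (\<integral>\<^sup>+y. \<integral>\<^sup>+d. G y d \<partial>start_law y \<partial>measure_pmf \<mu>s)"
    unfolding nn_integral_measure_pmf
    by (intro nn_integral_cong) (simp add: nn_integral_cmult nn_integral_start_law)
  finally show ?thesis .
qed

definition randomness :: "(real \<times> (real \<times> real) stream stream) measure" where
  "randomness = unit_uniform \<Otimes>\<^sub>M noises"

definition dual_of :: "('s \<times> ennreal) stream \<Rightarrow> real \<times> (real \<times> real) stream stream \<Rightarrow> ('t \<times> ennreal) stream" where
  "dual_of d r = dual_run (sampler (measure_pmf (init_pmf (fst (shd d)))) (fst r)) d (snd r)"

lemma prob_space_randomness: "prob_space randomness"
proof -
  interpret unit_uniform: prob_space unit_uniform by (rule prob_space_unit_uniform)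
  interpret noises: prob_space noises by (rule prob_space_noises)
  interpret pair_prob_space unit_uniform noises ..
  show ?thesis unfolding randomness_def by unfold_locales
qed

lemma coded_randomness: "coded randomness"
proof -
  have "coded unit_uniform" using coded_real unfolding coded_def by (simp cong: measurable_cong_sets)
  then show ?thesis unfolding randomness_def
    by (intro coded_pair coded_stream coded_step_noise)
qed

lemma measurable_randomness [measurable]:
  "fst \<in> borel_measurable randomness" "snd \<in> randomness \<rightarrow>\<^sub>M noises"
proof -
  have "fst \<in> randomness \<rightarrow>\<^sub>M unit_uniform" unfolding randomness_def by measurable
  then show "fst \<in> borel_measurable randomness" by (simp cong: measurable_cong_sets)
  show "snd \<in> randomness \<rightarrow>\<^sub>M noises" unfolding randomness_def by measurable
qed

lemma measurable_dual_of [measurable (raw)]: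
  assumes [measurable]: "d \<in> N \<rightarrow>\<^sub>M itinerary_space" "r \<in> N \<rightarrow>\<^sub>M randomness"
  shows "(\<lambda>x. dual_of (d x) (r x)) \<in> N \<rightarrow>\<^sub>M itinerary_space"
  unfolding dual_of_def
  by (intro measurable_dual_run measurable_sampler_pmf) measurable

lemma nn_integral_dual_of:
  assumes F: "(\<lambda>(p, d). F p d) \<in> borel_measurable (itinerary_space \<Otimes>\<^sub>M itinerary_space)"
  shows "(\<integral>\<^sup>+d. \<integral>\<^sup>+r. F (dual_of d r) d \<partial>randomness \<partial>jump_law L \<mu>)
    = (\<integral>\<^sup>+y. \<integral>\<^sup>+d. \<integral>\<^sup>+v. F (dual_run y d v) d \<partial>noises \<partial>start_law y \<partial>measure_pmf \<mu>s)"
proof -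
  note [measurable (raw)] = measurable_app2[OF F]
  interpret noises: prob_space noises by (rule prob_space_noises)
  have "(\<integral>\<^sup>+r. F (dual_of d r) d \<partial>randomness)
    = (\<integral>\<^sup>+y. \<integral>\<^sup>+v. F (dual_run y d v) d \<partial>noises \<partial>measure_pmf (init_pmf (fst (shd d))))" for d
  proof -
    have m: "(\<lambda>r. F (dual_of d r) d) \<in> borel_measurable (unit_uniform \<Otimes>\<^sub>M noises)"
      unfolding randomness_def[symmetric] by measurable
    have "(\<integral>\<^sup>+r. F (dual_of d r) d \<partial>randomness) = (\<integral>\<^sup>+u. \<integral>\<^sup>+v. F (dual_of d (u, v)) d \<partial>noises \<partial>unit_uniform)"
      unfolding randomness_def by (rule noises.nn_integral_fst[OF m, symmetric])
    also have "\<dots> = (\<integral>\<^sup>+u. (\<lambda>y. \<integral>\<^sup>+v. F (dual_run y d v) d \<partial>noises) (sampler (measure_pmf (init_pmf (fst (shd d)))) u) \<partial>unit_uniform)"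
      by (simp add: dual_of_def)
    also have "\<dots> = (\<integral>\<^sup>+y. \<integral>\<^sup>+v. F (dual_run y d v) d \<partial>noises \<partial>measure_pmf (init_pmf (fst (shd d))))"
      by (rule nn_integral_sampler[OF coded_measure_pmf prob_space_measure_pmf]) simp
    finally show ?thesis .
  qed
  then have "(\<integral>\<^sup>+d. \<integral>\<^sup>+r. F (dual_of d r) d \<partial>randomness \<partial>jump_law L \<mu>)
    = (\<integral>\<^sup>+d. \<integral>\<^sup>+y. \<integral>\<^sup>+v. F (dual_run y d v) d \<partial>noises \<partial>measure_pmf (init_pmf (fst (shd d))) \<partial>jump_law L \<mu>)"
    by simp
  also have "\<dots> = (\<integral>\<^sup>+y. \<integral>\<^sup>+d. \<integral>\<^sup>+v. F (dual_run y d v) d \<partial>noises \<partial>start_law y \<partial>measure_pmf \<mu>s)"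
    by (rule nn_integral_init_pmf) measurable
  finally show ?thesis .
qed

text \<open>Computed from X and not taken from the representation in \<open>minimal_process\<close>:
  that one is not known to be measurable with respect to X, so its independence of \<open>U\<close>
  would not be available.\<close>

definition D :: "'w \<Rightarrow> ('s \<times> ennreal) stream" where
  "D \<omega> = itinerary_of (\<lambda>t. X t \<omega>)"

text \<open>The itinerary of X stopped at \<open>t\<close>. It uses X only at times up to
  \<open>t\<close>, which makes it measurable for the past of X.\<close>

definition D_until :: "real \<Rightarrow> 'w \<Rightarrow> ('s \<times> ennreal) stream" where
  "D_until t \<omega> = itinerary_of (\<lambda>s. X (min s t) \<omega>)"

abbreviation FX :: "real set \<Rightarrow> 'w measure" where
  "FX I \<equiv> process_sigma M X I"

lemma measurable_D: "D \<in> FX {0..} \<rightarrow>\<^sub>M itinerary_space"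
  unfolding D_def[abs_def] by (rule measurable_itinerary_of) (simp add: measurable_process_sigma)

lemma measurable_D_until: "0 \<le> t \<Longrightarrow> D_until t \<in> FX {0..t} \<rightarrow>\<^sub>M itinerary_space"
  unfolding D_until_def[abs_def] by (rule measurable_itinerary_of) (simp add: measurable_process_sigma)

lemma measurable_X [measurable]: "0 \<le> t \<Longrightarrow> X t \<in> M \<rightarrow>\<^sub>M count_space UNIV"
proof -
  assume "0 \<le> t"
  then have "(\<lambda>\<omega>. Some (X t \<omega>)) \<in> M \<rightarrow>\<^sub>M count_space UNIV" using X by (simp add: minimal_process_def)
  then have "(\<lambda>\<omega>. the (Some (X t \<omega>))) \<in> M \<rightarrow>\<^sub>M count_space UNIV"
    by (rule measurable_compose) simp
  then show ?thesis by simp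
qed

lemma subalgebra_FX: "I \<subseteq> {0..} \<Longrightarrow> subalgebra M (FX I)"
proof -
  assume I: "I \<subseteq> {0..}"
  have "sets (FX I) \<subseteq> sets M"
    by (rule sets_process_sigma_subset) (use I in \<open>auto intro: measurable_X\<close>)
  then show ?thesis by (simp add: subalgebra_def)
qed

lemma measurable_FX: "f \<in> FX {0..} \<rightarrow>\<^sub>M N \<Longrightarrow> f \<in> M \<rightarrow>\<^sub>M N"
  using measurable_from_subalg[OF subalgebra_FX[of "{0..}"]] by auto

lemma sets_FX_mono: "I \<subseteq> J \<Longrightarrow> sets (FX I) \<subseteq> sets (FX J)"
  by (rule sets_process_sigma_subset) (auto intro: measurable_process_sigma)

text \<open>The itinerary of a representation of X has law \<open>jump_law L \<mu>\<close>. It is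
  therefore almost surely regular, and a regular itinerary is recovered from its path, so it agrees
  almost surely with \<open>D\<close>.\<close>

lemma
  shows distr_D: "distr M itinerary_space D = jump_law L \<mu>"
    and AE_D: "AE \<omega> in M. regular (D \<omega>) \<and> (\<forall>t\<ge>0. X t \<omega> = state_at (D \<omega>) (ennreal t))"
proof -
  obtain Y W where h: "jump_hold M L \<mu> Y W" and path: "AE \<omega> in M. \<forall>t\<ge>0. Some (X t \<omega>) = jump_path Y W t \<omega>"
    using X unfolding minimal_process_def by (auto elim!: eventually_mono)
  let ?E = "\<lambda>\<omega>. smap (\<lambda>n. (Y n \<omega>, W n \<omega>)) nats"
  note E = distr_jump_hold[OF gen prob_space_axioms h]
  have "AE d in jump_law L \<mu>. regular d"
  proof -
    have "explosion_time (\<lambda>n d. snd (d !! n)) = (lifetime :: ('s \<times> ennreal) stream \<Rightarrow> ennreal)"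
      by (rule ext) (simp add: explosion_time_def jump_time_def lifetime_def elapsed_def)
    then have "AE d in jump_law L \<mu>. lifetime d = \<infinity>"
      using AE_jump_law_nonexplosive[OF gen nonexpl, of \<mu>] by simp
    then show ?thesis using AE_jump_law_proper_step[OF gen, of \<mu>]
      by eventually_elim (simp add: regular_def)
  qed
  then have "AE \<omega> in M. regular (?E \<omega>)" unfolding E(2)[symmetric] by (rule AE_distrD[OF E(1)])
  then have main: "AE \<omega> in M. D \<omega> = ?E \<omega> \<and> regular (?E \<omega>) \<and> (\<forall>t\<ge>0. X t \<omega> = state_at (?E \<omega>) (ennreal t))"
    using path
  proof eventually_elim
    case (elim \<omega>)
    have st: "X t \<omega> = state_at (?E \<omega>) (ennreal t)" if "0 \<le> t" for t
    proof -
      have "Some (X t \<omega>) = jump_path (\<lambda>n \<omega>. fst (?E \<omega> !! n)) (\<lambda>n \<omega>. snd (?E \<omega> !! n)) t \<omega>"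
        using elim(2) that by simp
      also have "\<dots> = (if ennreal t < lifetime (?E \<omega>) then Some (state_at (?E \<omega>) (ennreal t)) else None)"
        by (rule jump_path_stream(1))
      finally show ?thesis by (simp split: if_splits)
    qed
    have "D \<omega> = ?E \<omega>" unfolding D_def by (rule itinerary_of_eq[OF elim(1)]) (simp add: st)
    then show ?case using st elim(1) by simp
  qed
  then show "AE \<omega> in M. regular (D \<omega>) \<and> (\<forall>t\<ge>0. X t \<omega> = state_at (D \<omega>) (ennreal t))"
    by eventually_elim simp
  have "distr M itinerary_space D = distr M itinerary_space ?E"
    by (rule distr_cong_AE) (use main E(1) measurable_FX[OF measurable_D] in \<open>auto elim!: eventually_mono\<close>)
  then show "distr M itinerary_space D = jump_law L \<mu>" using E(2) by simp
qed

text \<open>The identity is viewed as a random element of the sample space equipped with the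
  \<sigma>-algebra of X. Independence says that its joint law with \<open>U\<close> is a product,
  and Tonelli applies.\<close>

lemma nn_integral_indep:
  assumes F: "(\<lambda>(\<omega>, u). F \<omega> u) \<in> borel_measurable (FX {0..} \<Otimes>\<^sub>M borel)"
  shows "(\<integral>\<^sup>+\<omega>. F \<omega> (U \<omega>) \<partial>M) = (\<integral>\<^sup>+\<omega>. \<integral>\<^sup>+u. F \<omega> u \<partial>unit_uniform \<partial>M)"
proof -
  have id: "(\<lambda>\<omega>. \<omega>) \<in> M \<rightarrow>\<^sub>M FX {0..}" by (rule measurable_FX) simp
  have pair: "(\<lambda>\<omega>. (\<omega>, U \<omega>)) \<in> M \<rightarrow>\<^sub>M FX {0..} \<Otimes>\<^sub>M borel" using id U(1) by measurable
  interpret id: prob_space "distr M (FX {0..}) (\<lambda>\<omega>. \<omega>)" by (rule prob_space_distr[OF id])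
  interpret Ud: prob_space "distr M borel U" by (rule prob_space_distr[OF U(1)])
  have eq: "distr M (FX {0..}) (\<lambda>\<omega>. \<omega>) \<Otimes>\<^sub>M distr M borel U = distr M (FX {0..} \<Otimes>\<^sub>M borel) (\<lambda>\<omega>. (\<omega>, U \<omega>))"
  proof (rule pair_measure_eqI[OF id.sigma_finite_measure_axioms Ud.sigma_finite_measure_axioms])
    fix A B assume "A \<in> sets (distr M (FX {0..}) (\<lambda>\<omega>. \<omega>))" "B \<in> sets (distr M borel U)"
    then have A: "A \<in> sets (FX {0..})" and B: "B \<in> sets borel" by simp_all
    have AM: "A \<in> sets M" "A \<subseteq> space M"
      using A subalgebra_FX[of "{0..}"] sets.sets_into_space[OF A] by (auto simp: subalgebra_def)
    have "U -` B \<inter> space M \<in> sets (vimage_algebra (space M) U borel)" by (rule in_vimage_algebra[OF B])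
    then have "prob (A \<inter> (U -` B \<inter> space M)) = prob A * prob (U -` B \<inter> space M)"
      using indep_setD[OF indep A] by simp
    moreover have "(\<lambda>\<omega>. (\<omega>, U \<omega>)) -` (A \<times> B) \<inter> space M = A \<inter> (U -` B \<inter> space M)" by auto
    moreover have "(\<lambda>\<omega>. \<omega>) -` A \<inter> space M = A" using AM by auto
    ultimately show "emeasure (distr M (FX {0..}) (\<lambda>\<omega>. \<omega>)) A * emeasure (distr M borel U) B
      = emeasure (distr M (FX {0..} \<Otimes>\<^sub>M borel) (\<lambda>\<omega>. (\<omega>, U \<omega>))) (A \<times> B)"
      using A B by (simp add: emeasure_distr[OF id] emeasure_distr[OF U(1)] emeasure_distr[OF pair]
        emeasure_eq_measure ennreal_mult)
  qed (simp cong: sets_pair_measure_cong)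
  have Ud: "distr M borel U = unit_uniform" using U(2) by (simp add: unit_uniform_def)
  interpret unit_uniform: prob_space unit_uniform by (rule prob_space_unit_uniform)
  have m: "(\<lambda>p. F (fst p) (snd p)) \<in> borel_measurable (distr M (FX {0..}) (\<lambda>\<omega>. \<omega>) \<Otimes>\<^sub>M unit_uniform)"
    using F by (simp add: case_prod_beta' cong: measurable_cong_sets sets_pair_measure_cong)
  have "(\<integral>\<^sup>+\<omega>. F \<omega> (U \<omega>) \<partial>M) = (\<integral>\<^sup>+p. F (fst p) (snd p) \<partial>distr M (FX {0..} \<Otimes>\<^sub>M borel) (\<lambda>\<omega>. (\<omega>, U \<omega>)))"
    using F by (subst nn_integral_distr[OF pair]) (simp_all add: case_prod_beta')
  also have "\<dots> = (\<integral>\<^sup>+p. F (fst p) (snd p) \<partial>(distr M (FX {0..}) (\<lambda>\<omega>. \<omega>) \<Otimes>\<^sub>M unit_uniform))"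
    unfolding eq[symmetric] Ud ..
  also have "\<dots> = (\<integral>\<^sup>+\<omega>. \<integral>\<^sup>+u. F \<omega> u \<partial>unit_uniform \<partial>distr M (FX {0..}) (\<lambda>\<omega>. \<omega>))"
    by (subst unit_uniform.nn_integral_fst[OF m, symmetric]) simp
  also have "\<dots> = (\<integral>\<^sup>+\<omega>. \<integral>\<^sup>+u. F \<omega> u \<partial>unit_uniform \<partial>M)"
  proof -
    have "(\<lambda>\<omega>. \<integral>\<^sup>+u. F \<omega> u \<partial>unit_uniform) \<in> borel_measurable (FX {0..})"
      by (rule unit_uniform.borel_measurable_nn_integral) (use F in \<open>simp cong: measurable_cong_sets sets_pair_measure_cong\<close>)
    then show ?thesis by (subst nn_integral_distr[OF id]) simp_all
  qed
  finally show ?thesis .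
qed

definition R :: "'w \<Rightarrow> real \<times> (real \<times> real) stream stream" where
  "R \<omega> = sampler randomness (U \<omega>)"

lemma measurable_sampler_randomness [measurable]: "sampler randomness \<in> borel \<rightarrow>\<^sub>M randomness"
  by (rule measurable_sampler[OF coded_randomness prob_space_randomness])

lemma measurable_R [measurable]: "R \<in> M \<rightarrow>\<^sub>M randomness"
  unfolding R_def[abs_def] using U(1) by measurable

lemma nn_integral_R:
  assumes F: "(\<lambda>(\<omega>, r). F \<omega> r) \<in> borel_measurable (FX {0..} \<Otimes>\<^sub>M randomness)"
  shows "(\<integral>\<^sup>+\<omega>. F \<omega> (R \<omega>) \<partial>M) = (\<integral>\<^sup>+\<omega>. \<integral>\<^sup>+r. F \<omega> r \<partial>randomness \<partial>M)"
proof -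
  note [measurable (raw)] = measurable_app2[OF F]
  have "(\<integral>\<^sup>+\<omega>. F \<omega> (R \<omega>) \<partial>M) = (\<integral>\<^sup>+\<omega>. \<integral>\<^sup>+u. F \<omega> (sampler randomness u) \<partial>unit_uniform \<partial>M)"
    unfolding R_def by (rule nn_integral_indep) measurable
  also have "\<dots> = (\<integral>\<^sup>+\<omega>. \<integral>\<^sup>+r. F \<omega> r \<partial>randomness \<partial>M)"
    by (intro nn_integral_cong nn_integral_sampler[OF coded_randomness prob_space_randomness])
      (auto simp: measurable_app2[OF F])
  finally show ?thesis .
qed

definition Z :: "'w \<Rightarrow> ('t \<times> ennreal) stream" where
  "Z \<omega> = dual_of (D \<omega>) (R \<omega>)"

lemma measurable_D_M [measurable]: "D \<in> M \<rightarrow>\<^sub>M itinerary_space"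
  by (rule measurable_FX[OF measurable_D])

lemma measurable_Z [measurable]: "Z \<in> M \<rightarrow>\<^sub>M itinerary_space"
  unfolding Z_def[abs_def] by measurable

lemma measurable_nn_integral_randomness [measurable (raw)]:
  assumes [measurable]: "(\<lambda>(w, r). F w r) \<in> borel_measurable (N \<Otimes>\<^sub>M randomness)"
  shows "(\<lambda>w. \<integral>\<^sup>+r. F w r \<partial>randomness) \<in> borel_measurable N"
proof -
  interpret r: prob_space randomness by (rule prob_space_randomness)
  show ?thesis by measurable
qed

text \<open>The joint law of the dual itinerary and of X, rewritten with the dual initial state
  drawn first. This reduces the theorem to runs under \<open>start_law y\<close>.\<close>

lemma nn_integral_Z:
  assumes F: "(\<lambda>(p, d). F p d) \<in> borel_measurable (itinerary_space \<Otimes>\<^sub>M itinerary_space)"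
  shows "(\<integral>\<^sup>+\<omega>. F (Z \<omega>) (D \<omega>) \<partial>M)
    = (\<integral>\<^sup>+y. \<integral>\<^sup>+d. \<integral>\<^sup>+v. F (dual_run y d v) d \<partial>noises \<partial>start_law y \<partial>measure_pmf \<mu>s)"
proof -
  note [measurable (raw)] = measurable_app2[OF F]
  note [measurable] = measurable_D
  have "(\<integral>\<^sup>+\<omega>. F (Z \<omega>) (D \<omega>) \<partial>M) = (\<integral>\<^sup>+\<omega>. \<integral>\<^sup>+r. F (dual_of (D \<omega>) r) (D \<omega>) \<partial>randomness \<partial>M)"
    unfolding Z_def by (rule nn_integral_R) measurable
  also have "\<dots> = (\<integral>\<^sup>+d. \<integral>\<^sup>+r. F (dual_of d r) d \<partial>randomness \<partial>distr M itinerary_space D)"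
    by (subst nn_integral_distr) auto
  also have "\<dots> = (\<integral>\<^sup>+y. \<integral>\<^sup>+d. \<integral>\<^sup>+v. F (dual_run y d v) d \<partial>noises \<partial>start_law y \<partial>measure_pmf \<mu>s)"
    unfolding distr_D by (rule nn_integral_dual_of[OF F])
  finally show ?thesis .
qed

definition Xs :: "real \<Rightarrow> 'w \<Rightarrow> 't option" where
  "Xs = jump_path (\<lambda>n \<omega>. fst (Z \<omega> !! n)) (\<lambda>n \<omega>. snd (Z \<omega> !! n))"

definition T :: "'w \<Rightarrow> ennreal" where
  "T = explosion_time (\<lambda>n \<omega>. snd (Z \<omega> !! n))"

lemma Xs_eq: "Xs t \<omega> = path_at (Z \<omega>) (ennreal t)"
  unfolding Xs_def path_at_def by (rule jump_path_stream(1))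

lemma T_eq: "T \<omega> = lifetime (Z \<omega>)"
  unfolding T_def by (rule jump_path_stream(2))

lemma minimal_process_Xs: "minimal_process M Ls \<mu>s Xs T"
  unfolding Xs_def T_def
proof (intro minimal_processI jump_holdI gen_s prob_space_axioms measurable_Z)
  fix n yy and t :: "nat \<Rightarrow> real"
  have "emeasure M (Z -` cylinder n yy t \<inter> space M) = (\<integral>\<^sup>+\<omega>. indicator (cylinder n yy t) (Z \<omega>) \<partial>M)"
  proof -
    have "(\<integral>\<^sup>+\<omega>. indicator (cylinder n yy t) (Z \<omega>) \<partial>M) = (\<integral>\<^sup>+\<omega>. indicator (Z -` cylinder n yy t \<inter> space M) \<omega> \<partial>M)"
      by (rule nn_integral_cong) (simp add: indicator_def)
    then show ?thesis using measurable_sets[OF measurable_Z sets_cylinder[of n yy t]] by simp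
  qed
  also have "\<dots> = (\<integral>\<^sup>+y. \<integral>\<^sup>+d. \<integral>\<^sup>+v. indicator (cylinder n yy t) (dual_run y d v) \<partial>noises \<partial>start_law y \<partial>measure_pmf \<mu>s)"
    by (rule nn_integral_Z[where F = "\<lambda>p d. indicator (cylinder n yy t) p"]) measurable
  also have "\<dots> = emeasure (jump_law Ls \<mu>s) (cylinder n yy t)"
    unfolding emeasure_dual_run_cylinder
    using nn_integral_jump_law[of "indicator (cylinder n yy t)" Ls \<mu>s] by simp
  finally show "emeasure M (Z -` cylinder n yy t \<inter> space M) = emeasure (jump_law Ls \<mu>s) (cylinder n yy t)" .
qed

end

section \<open>The two conditional laws\<close>

context dual_construction
begin

lemma measurable_Xs [measurable]: "Xs t \<in> M \<rightarrow>\<^sub>M count_space UNIV"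
proof -
  have "(\<lambda>\<omega>. path_at (Z \<omega>) (ennreal t)) \<in> M \<rightarrow>\<^sub>M count_space UNIV" by measurable
  then show ?thesis by (simp add: Xs_eq[abs_def])
qed

lemma measurable_T [measurable]: "T \<in> borel_measurable M"
proof -
  have "(\<lambda>\<omega>. lifetime (Z \<omega>)) \<in> borel_measurable M" by measurable
  then show ?thesis by (simp add: T_eq[abs_def])
qed

lemma subalgebra_FXs: "subalgebra M (process_sigma M Xs I)"
  unfolding subalgebra_def by (simp add: sets_process_sigma_subset)

definition sojourn :: "nat \<Rightarrow> real \<Rightarrow> 'w \<Rightarrow> bool" where
  "sojourn n t \<omega> \<longleftrightarrow> elapsed n (Z \<omega>) \<le> ennreal t \<and> ennreal t < elapsed (Suc n) (Z \<omega>)"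

text \<open>While the \<open>n\<close>-th sojourn contains \<open>t\<close>, the values of the dual
  process up to \<open>t\<close> are those of \<open>halted n (Z \<omega>)\<close>. The sets with
  the claimed property are closed under complements and countable unions, so the generators
  suffice.\<close>

lemma past_event:
  assumes "A \<in> sets (process_sigma M Xs {0..t})"
  shows "\<exists>A'\<in>sets itinerary_space. \<forall>\<omega>\<in>space M. sojourn n t \<omega> \<longrightarrow> (\<omega> \<in> A \<longleftrightarrow> halted n (Z \<omega>) \<in> A')"
proof -
  have "A \<in> sigma_sets (space M) {Xs s -` B \<inter> space M | s B. s \<in> {0..t}}"
    using assms unfolding process_sigma_def by (subst (asm) sets_measure_of) auto
  then show ?thesis
  proof induction
    case (Basic A)
    then obtain s B where s: "0 \<le> s" "s \<le> t" and A: "A = Xs s -` B \<inter> space M" by auto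
    let ?A = "{p. Some (state_at p (ennreal s)) \<in> B}"
    have "{p \<in> space itinerary_space. state_at p (ennreal s) \<in> {x. Some x \<in> B}} \<in> sets itinerary_space"
      by measurable
    then have "?A \<in> sets (itinerary_space :: ('t \<times> ennreal) stream measure)" by simp
    moreover have "\<omega> \<in> A \<longleftrightarrow> halted n (Z \<omega>) \<in> ?A" if "\<omega> \<in> space M" "sojourn n t \<omega>" for \<omega>
    proof -
      have i: "elapsed n (Z \<omega>) \<le> ennreal t" "ennreal t < elapsed (Suc n) (Z \<omega>)"
        using that(2) by (auto simp: sojourn_def)
      have st: "ennreal s \<le> ennreal t" using s by (simp add: ennreal_leI)
      then have "ennreal s < lifetime (Z \<omega>)"
        using i(2) elapsed_le_lifetime[of "Suc n" "Z \<omega>"] by (metis le_less_trans less_le_trans)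
      then have "Xs s \<omega> = Some (state_at (halted n (Z \<omega>)) (ennreal s))"
        using state_at_halted[OF i, of "ennreal s"] st by (simp add: Xs_eq path_at_def min_absorb1)
      then show ?thesis using that(1) A by simp
    qed
    ultimately show ?case by blast
  next
    case Empty
    show ?case by (intro bexI[of _ "{}"]) auto
  next
    case (Compl A)
    then obtain A' where "A' \<in> sets itinerary_space" "\<forall>\<omega>\<in>space M. sojourn n t \<omega> \<longrightarrow> (\<omega> \<in> A \<longleftrightarrow> halted n (Z \<omega>) \<in> A')"
      by blast
    moreover from this(1) have "- A' \<in> sets itinerary_space"
      using sets.compl_sets[of A' itinerary_space] by (simp add: Compl_eq_Diff_UNIV)
    ultimately show ?case by (intro bexI[of _ "- A'"]) auto
  next
    case (Union A)
    then have "\<forall>i. \<exists>A'. A' \<in> sets itinerary_space \<and> (\<forall>\<omega>\<in>space M. sojourn n t \<omega> \<longrightarrow> (\<omega> \<in> A i \<longleftrightarrow> halted n (Z \<omega>) \<in> A'))"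
      by blast
    then obtain A' where A': "\<And>i. A' i \<in> sets itinerary_space"
      "\<And>i \<omega>. \<omega> \<in> space M \<Longrightarrow> sojourn n t \<omega> \<Longrightarrow> \<omega> \<in> A i \<longleftrightarrow> halted n (Z \<omega>) \<in> A' i" by metis
    have "(\<Union>i. A' i) \<in> sets itinerary_space" using A'(1) by auto
    then show ?case using A'(2) by (intro bexI[of _ "\<Union>i. A' i"]) auto
  qed
qed

lemma T_greater_iff: "ennreal t < T \<omega> \<longleftrightarrow> (\<exists>n. sojourn n t \<omega>)"
  using index_at[of "ennreal t" "Z \<omega>"] less_le_trans[OF _ elapsed_le_lifetime]
  by (auto simp: T_eq sojourn_def)

lemma Xs_sojourn:
  assumes "sojourn n t \<omega>" shows "Xs t \<omega> = Some (fst (Z \<omega> !! n))"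
  using assms less_le_trans[OF _ elapsed_le_lifetime] state_at_eqI[of n "Z \<omega>" "ennreal t"]
  by (auto simp: Xs_eq path_at_def sojourn_def)

lemma sojourn_unique: "sojourn m t \<omega> \<Longrightarrow> sojourn n t \<omega> \<Longrightarrow> m = n"
  unfolding sojourn_def by (metis index_at_eqI)

lemma suminf_sojourn:
  fixes \<phi> :: "nat \<Rightarrow> ennreal"
  shows "(\<Sum>n. if sojourn n t \<omega> then \<phi> n else 0) = (if ennreal t < T \<omega> then \<phi> (THE n. sojourn n t \<omega>) else 0)"
proof (cases "ennreal t < T \<omega>")
  case True
  then obtain k where k: "sojourn k t \<omega>" by (auto simp: T_greater_iff)
  then have "(THE n. sojourn n t \<omega>) = k" by (rule the_equality) (rule sojourn_unique[OF _ k])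
  moreover have "(\<Sum>n. if sojourn n t \<omega> then \<phi> n else 0) = (\<Sum>n\<in>{k}. if sojourn n t \<omega> then \<phi> n else 0)"
    by (rule suminf_finite) (use sojourn_unique[OF k] in auto)
  ultimately show ?thesis using True k by simp
next
  case False
  then have "\<not> sojourn n t \<omega>" for n by (auto simp: T_greater_iff)
  then show ?thesis using False by simp
qed

text \<open>Survival until \<open>t\<close> is split by the index of the current dual sojourn. On
  each piece the event \<open>A\<close> becomes one about \<open>halted n\<close>, and
  \<open>filter_run\<close> applies for every initial dual state.\<close>

lemma filter_event:
  fixes g :: "'s \<Rightarrow> ennreal"
  assumes t: "0 \<le> t" and A: "A \<in> sets (process_sigma M Xs {0..t})" and g: "\<And>x. g x \<le> 1"
  shows "(\<integral>\<^sup>+\<omega>. indicator A \<omega> * (if ennreal t < T \<omega> then g (X t \<omega>) else 0) \<partial>M)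
    = (\<integral>\<^sup>+\<omega>. indicator A \<omega> * (if ennreal t < T \<omega> then \<integral>\<^sup>+x. g x \<partial>measure_pmf (kernel_pmf (the (Xs t \<omega>))) else 0) \<partial>M)"
proof -
  let ?\<Lambda> = "\<lambda>z. \<integral>\<^sup>+x. g x \<partial>measure_pmf (kernel_pmf z)"
  have AM [measurable]: "A \<in> sets M" using A subalgebra_FXs by (auto simp: subalgebra_def)
  have [measurable]: "Measurable.pred M (sojourn n t)" for n unfolding sojourn_def by measurable
  have split: "(\<integral>\<^sup>+\<omega>. indicator A \<omega> * (if ennreal t < T \<omega> then h (the (Xs t \<omega>)) (state_at (D \<omega>) (ennreal t)) else 0) \<partial>M)
    = (\<Sum>n. \<integral>\<^sup>+\<omega>. (if sojourn n t \<omega> then indicator A \<omega> * h (fst (Z \<omega> !! n)) (state_at (D \<omega>) (ennreal t)) else 0) \<partial>M)"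
    for h :: "'t \<Rightarrow> 's \<Rightarrow> ennreal"
  proof -
    have [measurable]: "(\<lambda>\<omega>. h (fst (Z \<omega> !! n)) (state_at (D \<omega>) (ennreal t))) \<in> borel_measurable M" for n
      by (rule measurable_discrete2) measurable
    have "indicator A \<omega> * (if ennreal t < T \<omega> then h (the (Xs t \<omega>)) (state_at (D \<omega>) (ennreal t)) else 0)
      = (\<Sum>n. if sojourn n t \<omega> then indicator A \<omega> * h (fst (Z \<omega> !! n)) (state_at (D \<omega>) (ennreal t)) else 0)" for \<omega>
    proof (cases "ennreal t < T \<omega>")
      case True
      then obtain k where k: "sojourn k t \<omega>" by (auto simp: T_greater_iff)
      then have "(THE n. sojourn n t \<omega>) = k" by (rule the_equality) (rule sojourn_unique[OF _ k])
      then show ?thesis using True k by (simp add: suminf_sojourn Xs_sojourn)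
    qed (simp add: suminf_sojourn)
    then show ?thesis by (simp add: nn_integral_suminf)
  qed
  have piece: "(\<integral>\<^sup>+\<omega>. (if sojourn n t \<omega> then indicator A \<omega> * g (state_at (D \<omega>) (ennreal t)) else 0) \<partial>M)
    = (\<integral>\<^sup>+\<omega>. (if sojourn n t \<omega> then indicator A \<omega> * ?\<Lambda> (fst (Z \<omega> !! n)) else 0) \<partial>M)" for n
  proof -
    obtain A' where [measurable]: "A' \<in> sets itinerary_space"
      and A': "\<forall>\<omega>\<in>space M. sojourn n t \<omega> \<longrightarrow> (\<omega> \<in> A \<longleftrightarrow> halted n (Z \<omega>) \<in> A')"
      using past_event[OF A] by blast
    have eq: "(\<integral>\<^sup>+\<omega>. (if sojourn n t \<omega> then indicator A \<omega> * h (fst (Z \<omega> !! n)) (state_at (D \<omega>) (ennreal t)) else 0) \<partial>M)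
      = (\<integral>\<^sup>+y. \<integral>\<^sup>+d. \<integral>\<^sup>+v. (if elapsed n (dual_run y d v) \<le> ennreal t \<and> ennreal t < elapsed (Suc n) (dual_run y d v)
          then indicator A' (halted n (dual_run y d v)) * h (fst (dual_run y d v !! n)) (state_at d (ennreal t)) else 0)
          \<partial>noises \<partial>start_law y \<partial>measure_pmf \<mu>s)" for h :: "'t \<Rightarrow> 's \<Rightarrow> ennreal"
    proof -
      define F where "F p d = (if elapsed n p \<le> ennreal t \<and> ennreal t < elapsed (Suc n) p
        then indicator A' (halted n p) * h (fst (p !! n)) (state_at d (ennreal t)) else 0)" for p d
      have [measurable]: "(\<lambda>(p, d). h (fst (p !! n)) (state_at d (ennreal t))) \<in> borel_measurable (itinerary_space \<Otimes>\<^sub>M itinerary_space)"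
        unfolding case_prod_beta' by (rule measurable_discrete2) measurable
      have F: "(\<lambda>(p, d). F p d) \<in> borel_measurable (itinerary_space \<Otimes>\<^sub>M itinerary_space)"
        unfolding F_def by measurable
      have "(\<integral>\<^sup>+\<omega>. (if sojourn n t \<omega> then indicator A \<omega> * h (fst (Z \<omega> !! n)) (state_at (D \<omega>) (ennreal t)) else 0) \<partial>M)
        = (\<integral>\<^sup>+\<omega>. F (Z \<omega>) (D \<omega>) \<partial>M)"
        using A' by (intro nn_integral_cong) (auto simp: F_def sojourn_def indicator_def)
      then show ?thesis unfolding nn_integral_Z[OF F] by (simp add: F_def)
    qed
    show ?thesis
      unfolding eq[of "\<lambda>_. g"] eq[of "\<lambda>z _. ?\<Lambda> z"]
      by (intro nn_integral_cong filter_run g t) (auto simp: indicator_def)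
  qed
  have "(\<integral>\<^sup>+\<omega>. indicator A \<omega> * (if ennreal t < T \<omega> then g (X t \<omega>) else 0) \<partial>M)
    = (\<integral>\<^sup>+\<omega>. indicator A \<omega> * (if ennreal t < T \<omega> then g (state_at (D \<omega>) (ennreal t)) else 0) \<partial>M)"
  proof (rule nn_integral_cong_AE, use AE_D in eventually_elim)
    case (elim \<omega>)
    then show ?case using t by simp
  qed
  then show ?thesis using split[of "\<lambda>_. g"] split[of "\<lambda>z _. ?\<Lambda> z"] piece by simp
qed

lemma summable_kernel_times:
  assumes "\<And>x. 0 \<le> g x" "\<And>x. g x \<le> 1"
  shows "(\<lambda>x. \<Lambda> y x * g x) summable_on UNIV"
proof -
  have "\<Lambda> y summable_on UNIV"
    using kernel unfolding transition_kernel_def by (blast intro: has_sum_imp_summable)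
  then show ?thesis
    by (rule summable_on_comparison_test) (auto intro!: mult_left_le mult_nonneg_nonneg kernel_nonneg assms)
qed

lemma kernel_apply_unit:
  assumes "\<And>x. 0 \<le> g x" "\<And>x. g x \<le> 1"
  shows "ennreal (kernel_apply \<Lambda> g y) = (\<integral>\<^sup>+x. ennreal (g x) \<partial>measure_pmf (kernel_pmf y))"
    and "0 \<le> kernel_apply \<Lambda> g y" "kernel_apply \<Lambda> g y \<le> 1"
proof -
  have nn: "0 \<le> \<Lambda> y x * g x" for x using kernel_nonneg assms by simp
  show e: "ennreal (kernel_apply \<Lambda> g y) = (\<integral>\<^sup>+x. ennreal (g x) \<partial>measure_pmf (kernel_pmf y))"
    unfolding kernel_apply_def nn_integral_measure_pmf pmf_kernel_pmf
    using nn_integral_has_sum[OF has_sum_infsum[OF summable_kernel_times[of g y, OF assms]]] nn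
    by (simp add: ennreal_mult' kernel_nonneg)
  show "0 \<le> kernel_apply \<Lambda> g y" unfolding kernel_apply_def by (intro infsum_nonneg nn)
  have "(\<integral>\<^sup>+x. ennreal (g x) \<partial>measure_pmf (kernel_pmf y)) \<le> (\<integral>\<^sup>+x. 1 \<partial>measure_pmf (kernel_pmf y))"
    using assms by (intro nn_integral_mono) (simp add: ennreal_le_1)
  then have "ennreal (kernel_apply \<Lambda> g y) \<le> 1"
    using prob_space.emeasure_space_1[OF prob_space_measure_pmf, of "kernel_pmf y"] by (simp add: e)
  then show "kernel_apply \<Lambda> g y \<le> 1" by (simp add: ennreal_le_1)
qed

lemma kernel_apply_affine:
  assumes "\<And>x. 0 \<le> g x" "\<And>x. g x \<le> 1"
  shows "kernel_apply \<Lambda> (\<lambda>x. a * g x + b) y = a * kernel_apply \<Lambda> g y + b"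
proof -
  have "((\<lambda>x. a * (\<Lambda> y x * g x) + \<Lambda> y x * b) has_sum (a * kernel_apply \<Lambda> g y + 1 * b)) UNIV"
    unfolding kernel_apply_def
    using kernel unfolding transition_kernel_def
    by (intro has_sum_add has_sum_cmult_right has_sum_cmult_left has_sum_infsum summable_kernel_times assms) auto
  then have "infsum (\<lambda>x. a * (\<Lambda> y x * g x) + \<Lambda> y x * b) UNIV = a * kernel_apply \<Lambda> g y + b"
    by (simp add: infsumI)
  moreover have "(\<lambda>x. \<Lambda> y x * (a * g x + b)) = (\<lambda>x. a * (\<Lambda> y x * g x) + \<Lambda> y x * b)"
    by (simp add: fun_eq_iff distrib_left mult_ac)
  ultimately show ?thesis by (simp add: kernel_apply_def)
qed

text \<open>The case of events and functions with values in \<open>{0..1}\<close> says that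
  \<open>\<phi>\<close> below has conditional expectation 0 given the past of the dual process.
  Hence it is orthogonal to every bounded \<open>H\<close> measurable with respect to that
  past.\<close>

lemma filter_identity:
  fixes f :: "'s \<Rightarrow> real" and H :: "'w \<Rightarrow> real"
  assumes t: "0 \<le> t" and f: "bounded (range f)" and Hb: "bounded (H ` space M)"
    and H: "H \<in> borel_measurable (process_sigma M Xs {0..t})"
  shows "(\<integral>\<omega>. H \<omega> * indicat_real {\<omega>. T \<omega> > ennreal t} \<omega> * f (X t \<omega>) \<partial>M) =
    (\<integral>\<omega>. H \<omega> * indicat_real {\<omega>. T \<omega> > ennreal t} \<omega> * kernel_apply \<Lambda> f (the (Xs t \<omega>)) \<partial>M)"
proof -
  let ?F = "process_sigma M Xs {0..t}"
  interpret F: finite_measure_subalgebra M ?F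
    by unfold_locales (rule subalgebra_FXs)
  have HM [measurable]: "H \<in> borel_measurable M" by (rule measurable_from_subalg[OF subalgebra_FXs H])
  obtain C where C: "0 < C" "\<And>x. \<bar>f x\<bar> \<le> C" using f unfolding bounded_pos by auto
  obtain B where B: "0 < B" "\<And>\<omega>. \<omega> \<in> space M \<Longrightarrow> \<bar>H \<omega>\<bar> \<le> B" using Hb unfolding bounded_pos by auto
  \<comment> \<open>The affine rescaling of \<open>f\<close> into the unit interval. Since rows of
    the kernel sum to 1, \<open>kernel_apply\<close> commutes with it.\<close>
  define g where "g x = (f x + C) / (2 * C)" for x
  have g: "0 \<le> g x" "g x \<le> 1" for x
    using C(1) C(2)[of x] by (auto simp: g_def abs_le_iff divide_le_eq)
  have fg: "f = (\<lambda>x. 2 * C * g x + (- C))" using C(1) by (auto simp: g_def fun_eq_iff field_simps)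
  have Kf: "kernel_apply \<Lambda> f y = 2 * C * kernel_apply \<Lambda> g y + (- C)" for y
    unfolding fg by (rule kernel_apply_affine[OF g])
  let ?I = "indicat_real {\<omega>. T \<omega> > ennreal t}"
  have X' [measurable]: "(\<lambda>\<omega>. g (X t \<omega>)) \<in> borel_measurable M"
    by (rule measurable_compose[OF measurable_X[OF t]]) simp
  have K' [measurable]: "(\<lambda>\<omega>. kernel_apply \<Lambda> g (the (Xs t \<omega>))) \<in> borel_measurable M"
    by (rule measurable_compose[OF measurable_Xs[of t]]) simp
  have I [measurable]: "?I \<in> borel_measurable M"
  proof -
    have "(\<lambda>\<omega>. if ennreal t < T \<omega> then 1 else 0 :: real) \<in> borel_measurable M" by measurable
    then show ?thesis by (simp add: indicator_def[abs_def] of_bool_def)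
  qed
  have K1: "0 \<le> kernel_apply \<Lambda> g y" "kernel_apply \<Lambda> g y \<le> 1" for y using kernel_apply_unit(2,3)[OF g] by auto
  define \<phi> where "\<phi> \<omega> = ?I \<omega> * (g (X t \<omega>) - kernel_apply \<Lambda> g (the (Xs t \<omega>)))" for \<omega>
  have \<phi> [measurable]: "\<phi> \<in> borel_measurable M" unfolding \<phi>_def[abs_def] by measurable
  have int: "integrable M (\<lambda>\<omega>. ?I \<omega> * g (X t \<omega>))" "integrable M (\<lambda>\<omega>. ?I \<omega> * kernel_apply \<Lambda> g (the (Xs t \<omega>)))"
    using g K1 by (auto intro!: integrable_const_bound[where B = 1] simp: indicator_def abs_mult)
  have \<phi>i: "integrable M \<phi>"
    using Bochner_Integration.integrable_diff[OF int] unfolding \<phi>_def[abs_def] by (simp add: right_diff_distrib)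
  have zero: "(\<integral>\<omega>\<in>A. \<phi> \<omega> \<partial>M) = (\<integral>\<omega>\<in>A. 0 \<partial>M)" if A: "A \<in> sets ?F" for A
  proof -
    have AM [measurable]: "A \<in> sets M" using A subalgebra_FXs by (auto simp: subalgebra_def)
    have conv: "(\<integral>\<omega>. indicat_real A \<omega> * (?I \<omega> * h \<omega>) \<partial>M) = enn2real (\<integral>\<^sup>+\<omega>. indicator A \<omega> * (if ennreal t < T \<omega> then ennreal (h \<omega>) else 0) \<partial>M)"
      if [measurable]: "h \<in> borel_measurable M" and h: "\<And>\<omega>. 0 \<le> h \<omega>" for h
    proof -
      have "(\<integral>\<omega>. indicat_real A \<omega> * (?I \<omega> * h \<omega>) \<partial>M) = enn2real (\<integral>\<^sup>+\<omega>. ennreal (indicat_real A \<omega> * (?I \<omega> * h \<omega>)) \<partial>M)"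
        by (rule integral_eq_nn_integral) (use h in auto)
      also have "(\<integral>\<^sup>+\<omega>. ennreal (indicat_real A \<omega> * (?I \<omega> * h \<omega>)) \<partial>M) = (\<integral>\<^sup>+\<omega>. indicator A \<omega> * (if ennreal t < T \<omega> then ennreal (h \<omega>) else 0) \<partial>M)"
        by (intro nn_integral_cong) (auto simp: indicator_def)
      finally show ?thesis .
    qed
    have e: "ennreal (kernel_apply \<Lambda> g y) = (\<integral>\<^sup>+x. ennreal (g x) \<partial>measure_pmf (kernel_pmf y))" for y
      by (rule kernel_apply_unit(1)[OF g])
    have fe: "(\<integral>\<^sup>+\<omega>. indicator A \<omega> * (if ennreal t < T \<omega> then ennreal (g (X t \<omega>)) else 0) \<partial>M)
      = (\<integral>\<^sup>+\<omega>. indicator A \<omega> * (if ennreal t < T \<omega> then ennreal (kernel_apply \<Lambda> g (the (Xs t \<omega>))) else 0) \<partial>M)"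
      unfolding e by (rule filter_event[OF t A]) (simp add: g ennreal_le_1)
    have "(\<integral>\<omega>. indicat_real A \<omega> * (?I \<omega> * g (X t \<omega>)) \<partial>M) = (\<integral>\<omega>. indicat_real A \<omega> * (?I \<omega> * kernel_apply \<Lambda> g (the (Xs t \<omega>))) \<partial>M)"
      unfolding conv[OF X' g(1)] conv[OF K' K1(1)] fe ..
    moreover have "integrable M (\<lambda>\<omega>. indicat_real A \<omega> * (?I \<omega> * g (X t \<omega>)))" "integrable M (\<lambda>\<omega>. indicat_real A \<omega> * (?I \<omega> * kernel_apply \<Lambda> g (the (Xs t \<omega>))))"
      using g K1 by (auto intro!: integrable_const_bound[where B = 1] simp: indicator_def abs_mult)
    ultimately have "(\<integral>\<omega>. indicat_real A \<omega> * \<phi> \<omega> \<partial>M) = 0"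
      unfolding \<phi>_def right_diff_distrib by simp
    then show ?thesis by (simp add: set_lebesgue_integral_def)
  qed
  have "AE \<omega> in M. real_cond_exp M ?F \<phi> \<omega> = 0"
    by (rule F.real_cond_exp_charact[OF zero \<phi>i]) auto
  have H\<phi>: "integrable M (\<lambda>\<omega>. H \<omega> * \<phi> \<omega>)"
  proof (rule integrable_const_bound[where B = "B * 1"])
    have "\<bar>\<phi> \<omega>\<bar> \<le> 1" for \<omega>
      using g[of "X t \<omega>"] K1[of "the (Xs t \<omega>)"] by (auto simp: \<phi>_def indicator_def abs_le_iff)
    then show "AE \<omega> in M. norm (H \<omega> * \<phi> \<omega>) \<le> B * 1"
      using B(1) by (intro AE_I2) (auto simp: abs_mult intro!: mult_mono[of _ B _ 1, simplified] B(2))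
  qed measurable
  have "(\<integral>\<omega>. H \<omega> * \<phi> \<omega> \<partial>M) = (\<integral>\<omega>. H \<omega> * real_cond_exp M ?F \<phi> \<omega> \<partial>M)"
    by (rule F.real_cond_exp_intg(2)[OF H\<phi> H \<phi>, symmetric])
  also have "\<dots> = (\<integral>\<omega>. 0 \<partial>M)"
    by (rule integral_cong_AE) (use \<open>AE \<omega> in M. real_cond_exp M ?F \<phi> \<omega> = 0\<close> in \<open>auto elim!: eventually_mono\<close>)
  finally have Hz: "(\<integral>\<omega>. H \<omega> * \<phi> \<omega> \<partial>M) = 0" by simp
  have i2: "integrable M (\<lambda>\<omega>. H \<omega> * ?I \<omega> * kernel_apply \<Lambda> f (the (Xs t \<omega>)))"
  proof (rule integrable_const_bound[where B = "B * C"])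
    have "\<bar>kernel_apply \<Lambda> f y\<bar> \<le> C" for y
      unfolding Kf using K1[of y] C(1) by (auto simp: abs_le_iff)
    then show "AE \<omega> in M. norm (H \<omega> * ?I \<omega> * kernel_apply \<Lambda> f (the (Xs t \<omega>))) \<le> B * C"
      using B C(1) by (intro AE_I2) (auto simp: abs_mult indicator_def intro!: mult_mono)
    show "(\<lambda>\<omega>. H \<omega> * ?I \<omega> * kernel_apply \<Lambda> f (the (Xs t \<omega>))) \<in> borel_measurable M"
      unfolding Kf by measurable
  qed
  have "(\<integral>\<omega>. H \<omega> * ?I \<omega> * f (X t \<omega>) \<partial>M) = (\<integral>\<omega>. H \<omega> * ?I \<omega> * kernel_apply \<Lambda> f (the (Xs t \<omega>)) + 2 * C * (H \<omega> * \<phi> \<omega>) \<partial>M)"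
  proof (rule Bochner_Integration.integral_cong[OF refl])
    fix \<omega>
    have "f (X t \<omega>) = kernel_apply \<Lambda> f (the (Xs t \<omega>)) + 2 * C * (g (X t \<omega>) - kernel_apply \<Lambda> g (the (Xs t \<omega>)))"
      unfolding Kf by (subst fg) (simp add: right_diff_distrib)
    then show "H \<omega> * ?I \<omega> * f (X t \<omega>) = H \<omega> * ?I \<omega> * kernel_apply \<Lambda> f (the (Xs t \<omega>)) + 2 * C * (H \<omega> * \<phi> \<omega>)"
      by (simp add: \<phi>_def distrib_left mult_ac)
  qed
  also have "\<dots> = (\<integral>\<omega>. H \<omega> * ?I \<omega> * kernel_apply \<Lambda> f (the (Xs t \<omega>)) \<partial>M)"
    using i2 H\<phi> Hz by simp
  finally show ?thesis .
qed

text \<open>Almost surely the path stopped at \<open>t\<close> has the itinerary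
  \<open>halted n (D \<omega>)\<close>, where \<open>n\<close> is the index of the sojourn of X that
  contains \<open>t\<close>.\<close>

lemma AE_D_until:
  assumes t: "0 \<le> t"
  shows "AE \<omega> in M. agree (ennreal t) (D \<omega>) (D_until t \<omega>)"
  using AE_D
proof eventually_elim
  case (elim \<omega>)
  let ?d = "D \<omega>"
  have "ennreal t < lifetime ?d" using elim by (simp add: regular_def)
  note i = index_at[OF this]
  let ?n = "index_at ?d (ennreal t)"
  have "D_until t \<omega> = halted ?n ?d"
    unfolding D_until_def
  proof (rule itinerary_of_eq)
    show "regular (halted ?n ?d)" using elim i(1) by (intro regular_halted) (auto intro: le_less_trans)
    fix q :: rat assume q: "0 \<le> q"
    have "min (ennreal (of_rat q)) (ennreal t) = ennreal (min (of_rat q) t)"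
      using q t by (simp add: min_def ennreal_le_iff)
    then show "X (min (of_rat q) t) \<omega> = state_at (halted ?n ?d) (ennreal (of_rat q))"
      using elim q t state_at_halted[OF i, of "ennreal (of_rat q)"] by simp
  qed
  then show ?case using agree_halted[OF i] by simp
qed

lemma path_at_dual_of_agree:
  assumes "agree (ennreal t) d d'"
  shows "path_at (dual_of d r) (ennreal t) = path_at (dual_of d' r) (ennreal t)"
  unfolding dual_of_def agree_fst[OF assms] by (rule path_at_dual_run_agree[OF assms]) auto

text \<open>A version of the conditional probability, given X, that the dual process is alive at
  \<open>t\<close> with state in \<open>B\<close>: the independent randomness is integrated
  out.\<close>

definition hit :: "real \<Rightarrow> 't set \<Rightarrow> ('s \<times> ennreal) stream \<Rightarrow> ennreal" where
  "hit t B d = (\<integral>\<^sup>+r. indicator (Some ` B) (path_at (dual_of d r) (ennreal t)) \<partial>randomness)"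

lemma measurable_indicator_discrete:
  "f \<in> N \<rightarrow>\<^sub>M count_space UNIV \<Longrightarrow> (\<lambda>x. indicator A (f x) :: ennreal) \<in> borel_measurable N"
  by (rule measurable_compose[where N = "count_space UNIV"]) auto

lemma measurable_hit [measurable]: "hit t B \<in> borel_measurable itinerary_space"
  unfolding hit_def[abs_def]
  by (intro measurable_nn_integral_randomness) (auto simp: case_prod_beta' intro!: measurable_indicator_discrete measurable_path_at measurable_dual_of)

lemma hit_mono: "B \<subseteq> C \<Longrightarrow> hit t B d \<le> hit t C d"
  unfolding hit_def by (intro nn_integral_mono) (auto simp: indicator_def)

lemma hit_le_1: "hit t B d \<le> 1"
proof -
  interpret r: prob_space randomness by (rule prob_space_randomness)
  have "hit t B d \<le> (\<integral>\<^sup>+r. 1 \<partial>randomness)" unfolding hit_def by (intro nn_integral_mono) (auto simp: indicator_def)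
  then show ?thesis by (simp add: r.emeasure_space_1)
qed

lemma nn_integral_hit:
  assumes k: "k \<in> borel_measurable (FX {0..})"
  shows "(\<integral>\<^sup>+\<omega>. k \<omega> * indicator (Some ` B) (Xs t \<omega>) \<partial>M) = (\<integral>\<^sup>+\<omega>. k \<omega> * hit t B (D \<omega>) \<partial>M)"
proof -
  note [measurable] = measurable_D k
  let ?F = "\<lambda>\<omega> r. k \<omega> * indicator (Some ` B) (path_at (dual_of (D \<omega>) r) (ennreal t))"
  have [measurable]: "(\<lambda>x. indicator (Some ` B) (path_at (dual_of (D (fst x)) (snd x)) (ennreal t)) :: ennreal) \<in> borel_measurable (FX {0..} \<Otimes>\<^sub>M randomness)"
    by (rule measurable_indicator_discrete) measurable
  have "(\<integral>\<^sup>+\<omega>. k \<omega> * indicator (Some ` B) (Xs t \<omega>) \<partial>M) = (\<integral>\<^sup>+\<omega>. ?F \<omega> (R \<omega>) \<partial>M)"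
    by (simp add: Xs_eq Z_def)
  also have "\<dots> = (\<integral>\<^sup>+\<omega>. \<integral>\<^sup>+r. ?F \<omega> r \<partial>randomness \<partial>M)"
    by (rule nn_integral_R) (simp add: case_prod_beta')
  also have "\<dots> = (\<integral>\<^sup>+\<omega>. k \<omega> * hit t B (D \<omega>) \<partial>M)"
    unfolding hit_def
    by (intro nn_integral_cong nn_integral_cmult measurable_indicator_discrete measurable_path_at measurable_dual_of) auto
  finally show ?thesis .
qed

text \<open>Given X, the randomness is independent, and the dual state at \<open>t\<close> only
  reads the path until \<open>t\<close>. So the quotient \<open>g\<close> of hitting probabilities
  for the stopped path is a version of both conditional expectations under the conditioned
  measure.\<close>

lemma conditional_law:
  fixes B :: "'t set"
  assumes t: "0 \<le> t"
  defines "N \<equiv> uniform_measure M {\<omega> \<in> space M. T \<omega> > ennreal t}"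
  shows "AE \<omega> in N. real_cond_exp N (FX {0..}) (indicat_real {\<omega>. Xs t \<omega> \<in> Some ` B}) \<omega> =
    real_cond_exp N (FX {0..t}) (indicat_real {\<omega>. Xs t \<omega> \<in> Some ` B}) \<omega>"
proof (cases "emeasure M {\<omega> \<in> space M. T \<omega> > ennreal t} = 0")
  case True
  \<comment> \<open>If survival has probability 0, the conditioned measure charges nothing and the
    statement is vacuous.\<close>
  then have "AE \<omega> in M. \<omega> \<notin> {\<omega> \<in> space M. T \<omega> > ennreal t}" by (intro AE_not_in) (auto simp: null_sets_def)
  then show ?thesis unfolding N_def by (intro AE_uniform_measureI) (auto elim!: eventually_mono)
next
  case False
  let ?E = "{\<omega> \<in> space M. T \<omega> > ennreal t}" and ?f = "indicat_real {\<omega>. Xs t \<omega> \<in> Some ` B}"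
  interpret N: prob_space N
    unfolding N_def using False by (intro prob_space_uniform_measure) (simp_all add: emeasure_eq_measure)
  have sN [measurable_cong]: "sets N = sets M" and spN: "space N = space M" by (simp_all add: N_def)
  have sub: "subalgebra N (FX I)" if "I \<subseteq> {0..}" for I
    using subalgebra_FX[OF that] by (simp add: subalgebra_def sN spN)
  have E_iff: "\<omega> \<in> ?E \<longleftrightarrow> Xs t \<omega> \<in> range Some" if "\<omega> \<in> space M" for \<omega>
    using that by (auto simp: Xs_eq T_eq path_at_def)
  \<comment> \<open>Conditional probability given X and survival. Where the denominator is 0 the
    numerator is 0 as well, so the convention for division by 0 is harmless; see
    \<open>ghit\<close>.\<close>
  define g where "g \<omega> = enn2real (hit t B (D_until t \<omega>)) / enn2real (hit t UNIV (D_until t \<omega>))" for \<omega>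
  have gFt: "g \<in> borel_measurable (FX {0..t})"
    unfolding g_def[abs_def] using measurable_compose[OF measurable_D_until[OF t] measurable_hit] by measurable
  have gFX: "g \<in> borel_measurable (FX {0..})"
    by (rule measurable_from_subalg[OF _ gFt]) (simp add: subalgebra_def sets_FX_mono)
  have g0: "0 \<le> g \<omega>" for \<omega> by (simp add: g_def)
  have gle: "g \<omega> \<le> 1" for \<omega>
  proof -
    have "enn2real (hit t B (D_until t \<omega>)) \<le> enn2real (hit t UNIV (D_until t \<omega>))"
      using hit_mono[of B UNIV t] hit_le_1[of t UNIV "D_until t \<omega>"]
      by (intro enn2real_mono) (auto simp: less_top[symmetric] top_unique)
    then show ?thesis unfolding g_def
      by (cases "enn2real (hit t UNIV (D_until t \<omega>)) = 0") (auto simp: divide_le_eq_1 less_le)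
  qed
  have ghit: "ennreal (g \<omega>) * hit t UNIV (D_until t \<omega>) = hit t B (D_until t \<omega>)" for \<omega>
  proof -
    have f: "hit t C (D_until t \<omega>) < \<infinity>" for C using hit_le_1 by (rule le_less_trans) simp
    then obtain b u where b: "hit t B (D_until t \<omega>) = ennreal b" "0 \<le> b" and u: "hit t UNIV (D_until t \<omega>) = ennreal u" "0 \<le> u"
      by (metis ennreal_enn2real enn2real_nonneg infinity_ennreal_def)
    have "b \<le> u" using hit_mono[of B UNIV t "D_until t \<omega>"] b u by (simp add: ennreal_le_iff)
    then show ?thesis using b u by (cases "u = 0") (auto simp: g_def ennreal_mult'[symmetric])
  qed
  have fM [measurable]: "?f \<in> borel_measurable M"
  proof -
    have "(\<lambda>\<omega>. (indicat_real (Some ` B)) (Xs t \<omega>)) \<in> borel_measurable M"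
      by (rule measurable_compose[OF measurable_Xs]) simp
    then show ?thesis by (simp add: indicator_def[abs_def] of_bool_def)
  qed
  have gM [measurable]: "g \<in> borel_measurable M" by (rule measurable_FX[OF gFX])
  have key: "(\<integral>\<omega>\<in>A. ?f \<omega> \<partial>N) = (\<integral>\<omega>\<in>A. g \<omega> \<partial>N)" if A: "A \<in> sets (FX {0..})" for A
  proof -
    have AM [measurable]: "A \<in> sets M" using A subalgebra_FX[of "{0..}"] by (auto simp: subalgebra_def)
    have conv: "(\<integral>\<omega>\<in>A. h \<omega> \<partial>N) = enn2real ((\<integral>\<^sup>+\<omega>. indicator A \<omega> * ennreal (h \<omega>) * indicator (Some ` UNIV) (Xs t \<omega>) \<partial>M) / emeasure M ?E)"
      if [measurable]: "h \<in> borel_measurable M" and h: "\<And>\<omega>. 0 \<le> h \<omega>" for h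
    proof -
      have "(\<integral>\<omega>\<in>A. h \<omega> \<partial>N) = enn2real (\<integral>\<^sup>+\<omega>. ennreal (indicat_real A \<omega> * h \<omega>) \<partial>N)"
        unfolding set_lebesgue_integral_def real_scaleR_def
        by (rule integral_eq_nn_integral) (use h in auto)
      also have "(\<integral>\<^sup>+\<omega>. ennreal (indicat_real A \<omega> * h \<omega>) \<partial>N) = (\<integral>\<^sup>+\<omega>. ennreal (indicat_real A \<omega> * h \<omega>) * indicator ?E \<omega> \<partial>M) / emeasure M ?E"
        unfolding N_def by (rule nn_integral_uniform_measure) auto
      also have "(\<integral>\<^sup>+\<omega>. ennreal (indicat_real A \<omega> * h \<omega>) * indicator ?E \<omega> \<partial>M)
        = (\<integral>\<^sup>+\<omega>. indicator A \<omega> * ennreal (h \<omega>) * indicator (Some ` UNIV) (Xs t \<omega>) \<partial>M)"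
        using E_iff by (intro nn_integral_cong) (auto simp: indicator_def)
      finally show ?thesis .
    qed
    have "(\<integral>\<^sup>+\<omega>. indicator A \<omega> * ennreal (?f \<omega>) * indicator (Some ` UNIV) (Xs t \<omega>) \<partial>M)
      = (\<integral>\<^sup>+\<omega>. indicator A \<omega> * indicator (Some ` B) (Xs t \<omega>) \<partial>M)"
      by (intro nn_integral_cong) (auto simp: indicator_def)
    also have "\<dots> = (\<integral>\<^sup>+\<omega>. indicator A \<omega> * hit t B (D \<omega>) \<partial>M)"
      by (rule nn_integral_hit) (use A in simp)
    \<comment> \<open>By adaptedness the hitting probabilities of \<open>D\<close> and of the
      stopped itinerary agree. Only \<open>hit t UNIV\<close> is then turned back into the survival
      indicator, which is the weight that defines \<open>N\<close>.\<close>
    also have "\<dots> = (\<integral>\<^sup>+\<omega>. indicator A \<omega> * ennreal (g \<omega>) * hit t UNIV (D \<omega>) \<partial>M)"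
    proof (rule nn_integral_cong_AE, use AE_D_until[OF t] in eventually_elim)
      case (elim \<omega>)
      have "hit t C (D \<omega>) = hit t C (D_until t \<omega>)" for C
        unfolding hit_def path_at_dual_of_agree[OF elim] ..
      then show ?case by (simp add: mult.assoc ghit)
    qed
    also have "\<dots> = (\<integral>\<^sup>+\<omega>. indicator A \<omega> * ennreal (g \<omega>) * indicator (Some ` UNIV) (Xs t \<omega>) \<partial>M)"
      by (rule nn_integral_hit[symmetric]) (use A gFX in measurable)
    finally show ?thesis using g0 by (simp add: conv)
  qed
  have int: "integrable N ?f" "integrable N g"
  proof -
    have [measurable]: "?f \<in> borel_measurable N" "g \<in> borel_measurable N" by measurable
    show "integrable N ?f" by (rule N.integrable_const_bound[where B = 1]) (auto simp: indicator_def)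
    show "integrable N g" by (rule N.integrable_const_bound[where B = 1]) (use g0 gle in auto)
  qed
  interpret FX: finite_measure_subalgebra N "FX {0..}"
    by unfold_locales (rule sub, simp)
  interpret Ft: finite_measure_subalgebra N "FX {0..t}"
    by unfold_locales (rule sub, auto)
  have "AE \<omega> in N. real_cond_exp N (FX {0..}) ?f \<omega> = g \<omega>"
    by (rule FX.real_cond_exp_charact[OF key int gFX])
  moreover have "AE \<omega> in N. real_cond_exp N (FX {0..t}) ?f \<omega> = g \<omega>"
    using sets_FX_mono[of "{0..t}" "{0..}"] by (intro Ft.real_cond_exp_charact[OF key int gFt]) auto
  ultimately show ?thesis by eventually_elim simp
qed

end

theorem theorem2p1:
  fixes \<Lambda> :: "'t::countable \<Rightarrow> 's::countable \<Rightarrow> real"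
    and L :: "'s \<Rightarrow> 's \<Rightarrow> real" and Ls :: "'t \<Rightarrow> 't \<Rightarrow> real"
    and \<mu> :: "'s pmf" and \<mu>s :: "'t pmf"
    and M :: "'w measure" and X :: "real \<Rightarrow> 'w \<Rightarrow> 's" and TX :: "'w \<Rightarrow> ennreal"
    and U :: "'w \<Rightarrow> real"
  assumes kernel: "transition_kernel \<Lambda>"
    and gen: "generator L" and nonexpl: "nonexplosive L"
    and gen_s: "generator Ls"
    and rate_sum: "\<And>y. (\<lambda>x. \<Lambda> y x * jump_rate L x) summable_on UNIV"
    and prob: "prob_space M"
    and X: "minimal_process M L \<mu> (\<lambda>t \<omega>. Some (X t \<omega>)) TX"
    \<comment> \<open>the probability space is large enough: it carries a randomization independent of X\<close>
    and U: "U \<in> borel_measurable M" "distr M borel U = uniform_measure lborel {0..1}"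
    and indep: "prob_space.indep_set M (sets (process_sigma M X {0..}))
                  (sets (vimage_algebra (space M) U borel))"
    and init: "vec_mat_prod (pmf \<mu>s) \<Lambda> = pmf \<mu>"
    and intertwine: "mat_prod Ls \<Lambda> = mat_prod \<Lambda> L"
  shows "\<exists>(Xs :: real \<Rightarrow> 'w \<Rightarrow> 't option) (T :: 'w \<Rightarrow> ennreal).
     minimal_process M Ls \<mu>s Xs T \<and>
     (\<forall>t\<ge>0.
        (\<forall>(f :: 's \<Rightarrow> real) (H :: 'w \<Rightarrow> real).
           bounded (range f) \<longrightarrow> bounded (H ` space M) \<longrightarrow>
           H \<in> borel_measurable (process_sigma M Xs {0..t}) \<longrightarrow>
           (\<integral>\<omega>. H \<omega> * indicat_real {\<omega>. T \<omega> > ennreal t} \<omega> * f (X t \<omega>) \<partial>M) =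
           (\<integral>\<omega>. H \<omega> * indicat_real {\<omega>. T \<omega> > ennreal t} \<omega> *
                kernel_apply \<Lambda> f (the (Xs t \<omega>)) \<partial>M)) \<and>
        (let N = uniform_measure M {\<omega> \<in> space M. T \<omega> > ennreal t} in
           \<forall>B :: 't set. AE \<omega> in N.
             real_cond_exp N (process_sigma M X {0..}) (indicat_real {\<omega>. Xs t \<omega> \<in> Some ` B}) \<omega> =
             real_cond_exp N (process_sigma M X {0..t}) (indicat_real {\<omega>. Xs t \<omega> \<in> Some ` B}) \<omega>))"
proof -
  have "intertwining \<Lambda> L Ls"
    by (rule intertwining.intro[OF kernel gen nonexpl gen_s rate_sum intertwine])
  then interpret dual_construction \<Lambda> L Ls M \<mu> \<mu>s X TX U
    by (rule dual_construction.intro[OF _ prob dual_construction_axioms.intro[OF X U indep init]])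
  show ?thesis
    unfolding Let_def
  proof (intro exI[of _ Xs] exI[of _ T] conjI allI impI)
    show "minimal_process M Ls \<mu>s Xs T" by (rule minimal_process_Xs)
  qed (rule filter_identity conditional_law; assumption)+
qed

end
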